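(* Let $\lambda$ be an infinite cardinal and assume $\mathrm{P}_\lambda(\lambda^+,2,{\sqsubseteq},\lambda^+)$. Then for every positive integer $n$ there exists a $\lambda^+$-Souslin tree $\mathbf T$ such that all $n$-derived trees of $\mathbf T$ are $\lambda^+$-Souslin, and all $(n+1)$-derived trees of $\mathbf T$ are special.
   Context: Let $\kappa=\lambda^+$. $H_\kappa$ is the collection of sets of hereditary cardinality $<\kappa$. A streamlined tree is a set $T\subseteq{}^{<\kappa}H_\kappa$ closed under restrictions $t\mapsto t\restriction\beta$, ordered by proper initial segment; $T_\alpha=\{x\in T\mid\mathrm{dom}(x)=\alpha\}$. A streamlined $\kappa$-tree has $0<|T_\alpha|<\kappa$ for all $\alpha<\kappa$; it is $\kappa$-Souslin if there is no $f:\kappa\to H_\kappa$ with $f\restriction\beta\in T$ for all $\beta<\kappa$ and there is no antichain (set of pairwise $\subseteq$-incomparable nodes) of size $\kappa$. For $x:\alpha\to{}^\tau H_\kappa$ and $i<\tau$, $(x)_i=\langle x(\beta)(i)\mid\beta<\alpha\rangle$. For a sequence $\vec s=\langle s_i\mid i<\tau\rangle$ of nodes of $T$, $T(\vec s)=\{x\in{}^{<\kappa}({}^\tau H_\kappa)\mid \forall i<\tau\,[(x)_i\cup s_i\in T]\}$ (a streamlined tree); a $\tau$-derived tree of $T$ is $T(\vec s)$ for some injective $\vec s$ of length $\tau$ consisting of nodes of $T$ all of the same domain. A tree of height $\lambda^+$ is special iff it is the union of $\lambda$ many antichains. Notation: $\mathrm{acc}(C)=\{\beta\in C\mid\sup(C\cap\beta)=\beta>0\}$,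 $\mathrm{nacc}(C)=C\setminus\mathrm{acc}(C)$, $\mathrm{suc}_n(D)=\{\delta\in\mathrm{nacc}(D)\mid 0<\mathrm{otp}(D\cap\delta)\le n\}$. $\mathrm{P}_\lambda(\lambda^+,2,{\sqsubseteq},\lambda^+)$ is the conjunction of $\diamondsuit(\lambda^+)$ with the existence of $\langle C_\alpha\mid\alpha<\lambda^+\rangle$ such that: (1) each $C_\alpha$ is a closed subset of $\alpha$ with $\sup(C_\alpha)=\sup(\alpha)$ and $\mathrm{otp}(C_\alpha)\le\lambda$; (2) $C_{\bar\alpha}=C_\alpha\cap\bar\alpha$ whenever $\bar\alpha\in\mathrm{acc}(C_\alpha)$; (3) for every sequence $\langle B_i\mid i<\lambda^+\rangle$ of cofinal subsets of $\lambda^+$ there are stationarily many $\alpha<\lambda^+$ such that for all $i<\alpha$ and $n<\omega$, $\sup\{\beta\in C_\alpha\mid\mathrm{suc}_n(C_\alpha\setminus\beta)\subseteq B_i\}=\alpha$. *)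

theory Defs
  imports Main
begin

text \<open>Ordinals below kappa = lambda^+ are the elements of a wellorder type 'k whose
order type is cardSuc of the cardinal of the type 'a (representing lambda).
Nodes of a streamlined tree are partial maps 'k to 'v whose domain is an initial
segment {..<alpha}.\<close>

definition wo_rel_of :: "('k::wellorder) rel" where
  "wo_rel_of = {(x, y). x \<le> y}"

definition sup_is :: "('k::wellorder) set \<Rightarrow> 'k \<Rightarrow> bool" where
  "sup_is S \<alpha> \<longleftrightarrow> (\<forall>c\<in>S. c \<le> \<alpha>) \<and> (\<forall>\<gamma>. (\<forall>c\<in>S. c \<le> \<gamma>) \<longrightarrow> \<alpha> \<le> \<gamma>)"

definition same_sup :: "('k::wellorder) set \<Rightarrow> 'k set \<Rightarrow> bool" where
  "same_sup A B \<longleftrightarrow> (\<forall>\<gamma>. (\<forall>c\<in>A. c \<le> \<gamma>) \<longleftrightarrow> (\<forall>c\<in>B. c \<le> \<gamma>))"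

definition positive :: "('k::wellorder) \<Rightarrow> bool" where
  "positive \<beta> \<longleftrightarrow> (\<exists>\<delta>. \<delta> < \<beta>)"

definition acc :: "('k::wellorder) set \<Rightarrow> 'k set" where
  "acc C = {\<beta>\<in>C. sup_is (C \<inter> {..<\<beta>}) \<beta> \<and> positive \<beta>}"

definition nacc :: "('k::wellorder) set \<Rightarrow> 'k set" where
  "nacc C = C - acc C"

(* suc_n(D) = {delta in nacc(D) | 0 < otp(D cap delta) <= n}; for finite n the order type
   of D cap delta is its cardinality *)
definition suc_n :: "nat \<Rightarrow> ('k::wellorder) set \<Rightarrow> 'k set" where
  "suc_n n D = {\<delta>\<in>nacc D. finite (D \<inter> {..<\<delta>}) \<and> 0 < card (D \<inter> {..<\<delta>})
                              \<and> card (D \<inter> {..<\<delta>}) \<le> n}"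

definition closed_below :: "('k::wellorder) set \<Rightarrow> 'k \<Rightarrow> bool" where
  "closed_below C \<alpha> \<longleftrightarrow> C \<subseteq> {..<\<alpha>} \<and>
     (\<forall>\<beta><\<alpha>. positive \<beta> \<and> sup_is (C \<inter> {..<\<beta>}) \<beta> \<longrightarrow> \<beta> \<in> C)"

definition club :: "('k::wellorder) set \<Rightarrow> bool" where
  "club C \<longleftrightarrow> (\<forall>\<alpha>. \<exists>\<beta>\<in>C. \<alpha> \<le> \<beta>) \<and>
     (\<forall>\<beta>. positive \<beta> \<and> sup_is (C \<inter> {..<\<beta>}) \<beta> \<longrightarrow> \<beta> \<in> C)"

definition stationary :: "('k::wellorder) set \<Rightarrow> bool" where
  "stationary S \<longleftrightarrow> (\<forall>C. club C \<longrightarrow> S \<inter> C \<noteq> {})"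

definition cofinal :: "('k::wellorder) set \<Rightarrow> bool" where
  "cofinal B \<longleftrightarrow> (\<forall>\<alpha>. \<exists>\<beta>\<in>B. \<alpha> \<le> \<beta>)"

definition diamond :: "('k::wellorder) itself \<Rightarrow> bool" where
  "diamond _ \<longleftrightarrow> (\<exists>A :: 'k \<Rightarrow> 'k set. (\<forall>\<alpha>. A \<alpha> \<subseteq> {..<\<alpha>}) \<and>
       (\<forall>X. stationary {\<alpha>. X \<inter> {..<\<alpha>} = A \<alpha>}))"

(* P_lambda(lambda^+, 2, sqsubseteq, lambda^+); lambda is the cardinal of type 'a,
   lambda^+ is the order type of 'k *)
definition P_principle :: "'a itself \<Rightarrow> ('k::wellorder) itself \<Rightarrow> bool" where
  "P_principle _ _ \<longleftrightarrow> diamond TYPE('k) \<and>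
    (\<exists>C :: 'k \<Rightarrow> 'k set.
       (\<forall>\<alpha>. closed_below (C \<alpha>) \<alpha> \<and> same_sup (C \<alpha>) {..<\<alpha>} \<and>
             (Restr wo_rel_of (C \<alpha>), card_of (UNIV :: 'a set)) \<in> ordLeq) \<and>
       (\<forall>\<alpha> \<alpha>'. \<alpha>' \<in> acc (C \<alpha>) \<longrightarrow> C \<alpha>' = C \<alpha> \<inter> {..<\<alpha>'}) \<and>
       (\<forall>B :: 'k \<Rightarrow> 'k set. (\<forall>i. cofinal (B i)) \<longrightarrow>
          stationary {\<alpha>. \<forall>i<\<alpha>. \<forall>n::nat.
             sup_is {\<beta>\<in>C \<alpha>. suc_n n (C \<alpha> - {..<\<beta>}) \<subseteq> B i} \<alpha>}))"

definition streamlined :: "('k::wellorder \<rightharpoonup> 'v) set \<Rightarrow> bool" where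
  "streamlined T \<longleftrightarrow> (\<forall>x\<in>T. \<exists>\<alpha>. dom x = {..<\<alpha>}) \<and>
                      (\<forall>x\<in>T. \<forall>\<beta>. x |` {..<\<beta>} \<in> T)"

definition level :: "('k::wellorder \<rightharpoonup> 'v) set \<Rightarrow> 'k \<Rightarrow> ('k \<rightharpoonup> 'v) set" where
  "level T \<alpha> = {x\<in>T. dom x = {..<\<alpha>}}"

definition antichain :: "('k \<rightharpoonup> 'v) set \<Rightarrow> bool" where
  "antichain A \<longleftrightarrow> (\<forall>x\<in>A. \<forall>y\<in>A. x \<noteq> y \<longrightarrow> \<not> x \<subseteq>\<^sub>m y \<and> \<not> y \<subseteq>\<^sub>m x)"

definition kappa_tree :: "('k::wellorder \<rightharpoonup> 'v) set \<Rightarrow> bool" where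
  "kappa_tree T \<longleftrightarrow> streamlined T \<and>
     (\<forall>\<alpha>. level T \<alpha> \<noteq> {} \<and> (card_of (level T \<alpha>), card_of (UNIV :: 'k set)) \<in> ordLess)"

definition souslin :: "('k::wellorder \<rightharpoonup> 'v) set \<Rightarrow> bool" where
  "souslin T \<longleftrightarrow> kappa_tree T \<and>
     \<not> (\<exists>f :: 'k \<Rightarrow> 'v. \<forall>\<beta>. (Some \<circ> f) |` {..<\<beta>} \<in> T) \<and>
     \<not> (\<exists>A\<subseteq>T. antichain A \<and> (card_of (UNIV :: 'k set), card_of A) \<in> ordLeq)"

definition special :: "'a itself \<Rightarrow> ('k \<rightharpoonup> 'v) set \<Rightarrow> bool" where
  "special _ T \<longleftrightarrow> (\<exists>A :: 'a \<Rightarrow> ('k \<rightharpoonup> 'v) set. (\<forall>i. antichain (A i)) \<and> T = (\<Union>i. A i))"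

definition proj :: "nat \<Rightarrow> ('k \<rightharpoonup> 'v list) \<Rightarrow> ('k \<rightharpoonup> 'v)" where
  "proj i x = (\<lambda>\<beta>. map_option (\<lambda>v. v ! i) (x \<beta>))"

(* the graph-union of f and g (as sets of pairs) is a function lying in T *)
definition union_in :: "('k \<rightharpoonup> 'v) set \<Rightarrow> ('k \<rightharpoonup> 'v) \<Rightarrow> ('k \<rightharpoonup> 'v) \<Rightarrow> bool" where
  "union_in T f g \<longleftrightarrow> (\<forall>\<beta>\<in>dom f \<inter> dom g. f \<beta> = g \<beta>) \<and> (f ++ g) \<in> T"

definition derived_tree :: "nat \<Rightarrow> ('k::wellorder \<rightharpoonup> 'v) set \<Rightarrow> (nat \<Rightarrow> ('k \<rightharpoonup> 'v))
                            \<Rightarrow> ('k \<rightharpoonup> 'v list) set" where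
  "derived_tree \<tau> T s = {x. (\<exists>\<alpha>. dom x = {..<\<alpha>}) \<and>
      (\<forall>\<beta>\<in>dom x. length (the (x \<beta>)) = \<tau>) \<and>
      (\<forall>i<\<tau>. union_in T (proj i x) (s i))}"

definition derived_seq :: "nat \<Rightarrow> ('k::wellorder \<rightharpoonup> 'v) set \<Rightarrow> (nat \<Rightarrow> ('k \<rightharpoonup> 'v)) \<Rightarrow> bool" where
  "derived_seq \<tau> T s \<longleftrightarrow> inj_on s {..<\<tau>} \<and> (\<forall>i<\<tau>. s i \<in> T) \<and>
      (\<exists>\<alpha>. \<forall>i<\<tau>. dom (s i) = {..<\<alpha>})"

end

theory Submission
  imports Defs
begin

text \<open>Every node of a limit level \<open>\<alpha>\<close> is the result of a walk along \<open>C\<^sub>\<alpha>\<close> that starts at a node of a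
  level in \<open>C\<^sub>\<alpha>\<close>. At every \<open>\<beta> \<in> C\<^sub>\<alpha>\<close> the walk writes the mark \<open>sup (C\<^sub>\<alpha> \<inter> \<beta>)\<close> at position \<open>\<beta>\<close> and then
  jumps to the next level \<open>\<gamma>\<close> of \<open>C\<^sub>\<alpha>\<close> by a map from level \<open>\<beta> + 1\<close> into level \<open>\<gamma>\<close> which respects the
  following promise: no \<open>n + 1\<close> distinct nodes are mapped to nodes that all show one and the same
  mark \<open>\<iota> \<le> \<beta>\<close> at one and the same position in \<open>[\<beta> + 1, \<gamma>)\<close>. The promise leaves the images of any \<open>n\<close>
  distinct nodes free.

  Hence \<open>n + 1\<close> distinct walkers jointly remember \<open>C\<^sub>\<alpha>\<close>: if their walks along \<open>C\<^sub>\<alpha>\<close> are extended by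
  their walks along \<open>C\<^bsub>\<alpha>'\<^esub>\<close>, then \<open>C\<^bsub>\<alpha>'\<^esub>\<close> cannot jump over an element of \<open>C\<^sub>\<alpha>\<close>, since the walkers jointly
  show a forbidden mark there, and vice versa. So \<open>\<alpha>\<close> is an accumulation point of \<open>C\<^bsub>\<alpha>'\<^esub>\<close>, and the order
  types of \<open>C\<^sub>\<alpha>\<close> and \<open>C\<^bsub>\<alpha>'\<^esub>\<close> differ; as these are at most \<open>\<lambda>\<close>, the map sending a tuple to its starting
  point yields a specializing colouring of the \<open>(n + 1)\<close>-derived trees.

  On the other hand the images of \<open>n\<close> walkers are free, so they may be chosen above a node of an
  antichain of an \<open>n\<close>-derived tree guessed by diamond; by clause (3) every \<open>n\<close>-tuple of a
  suitable limit level has been treated in this way.\<close>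

text \<open>Specialness wants \<open>n + 1\<close> walkers to be rigid, Souslinity wants
  \<open>n\<close> walkers to be free, and a single jump map has to serve all walkers of a level.
  The choice of the mark reconciles these demands. If two ladders agree below \<beta> from the
  common start on and one of them jumps over \<beta> from \<mu>, then the other writes at \<beta>
  the supremum of its earlier points; this is at most \<mu>, hence forbidden in the jump, whereas
  \<beta> itself would be a permitted mark. Conversely, a promise made at \<beta> survives the
  growth of the tree: a fresh value above \<beta> is always available, marks written beyond a ladder
  point above \<beta> exceed \<beta>, and each later jump forbids even more marks. So
  promise-keeping maps with \<open>n\<close> prescribed values exist into every level, and this is
  what the induction carries. Tuples compete for the single jump map. The guess settles this by
  naming the starting tuple for which it is meant, and clause (3) has enough indices to reserve
  jumps for every starting tuple below \<alpha>.\<close>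

section \<open>Sets of bounded cardinality\<close>

text \<open>The type argument names the bound: \<open>TYPE('a)\<close> stands for lambda, and for
  the coding of nodes the same notion is used with \<open>TYPE('k)\<close>, that is with
  lambda^+.\<close>

definition small :: "'a itself \<Rightarrow> 'b set \<Rightarrow> bool" where
  "small _ S \<longleftrightarrow> (\<exists>f :: 'b \<Rightarrow> 'a. inj_on f S)"

lemma small_iff: "small (L :: 'a itself) S \<longleftrightarrow> (card_of S, card_of (UNIV :: 'a set)) \<in> ordLeq"
  unfolding small_def card_of_ordLeq[symmetric] by simp

lemma small_subset: "small L B \<Longrightarrow> A \<subseteq> B \<Longrightarrow> small L A"
  unfolding small_def by (meson inj_on_subset)

lemma small_inj_on: "inj_on f A \<Longrightarrow> f ` A \<subseteq> B \<Longrightarrow> small L B \<Longrightarrow> small L A"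
  unfolding small_def by (meson comp_inj_on inj_on_subset)

lemma small_image:
  assumes "small L A"
  shows "small L (f ` A)"
  by (rule small_inj_on[of "inv_into A f" _ A]) (auto simp: assms inj_on_inv_into inv_into_into)

lemma small_UNIV: "small (L :: 'a itself) (S :: 'a set)"
  unfolding small_def by (rule exI[of _ id]) simp

lemma small_UN:
  fixes L :: "'a itself"
  assumes "infinite (UNIV :: 'a set)" "small L I" "\<And>i. i \<in> I \<Longrightarrow> small L (F i)"
  shows "small L (\<Union>i\<in>I. F i)"
  using assms unfolding small_iff by (intro card_of_UNION_ordLeq_infinite) auto

lemma small_Sigma:
  fixes L :: "'a itself"
  assumes "infinite (UNIV :: 'a set)" "small L I" "\<And>i. i \<in> I \<Longrightarrow> small L (F i)"
  shows "small L (Sigma I F)"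
  using assms unfolding small_iff by (intro card_of_Sigma_ordLeq_infinite) auto

lemma small_nat:
  fixes L :: "'a itself"
  assumes "infinite (UNIV :: 'a set)"
  shows "small L (S :: nat set)"
proof -
  have "small L (UNIV :: nat set)"
    using assms unfolding small_iff by (simp add: infinite_iff_card_of_nat)
  then show ?thesis using small_subset by blast
qed

lemma small_finite:
  fixes L :: "'a itself"
  assumes "infinite (UNIV :: 'a set)" "finite S"
  shows "small L S"
proof -
  obtain f :: "_ \<Rightarrow> nat" where "inj_on f S"
    using finite_imp_inj_to_nat_seg[OF assms(2)] by blast
  then show ?thesis
    using small_inj_on small_nat[OF assms(1)] by blast
qed

lemma small_Un:
  fixes L :: "'a itself"
  assumes "infinite (UNIV :: 'a set)" "small L A" "small L B"
  shows "small L (A \<union> B)"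
proof -
  have "A \<union> B = (\<Union>b\<in>UNIV. if b then A else B)"
    by (auto split: if_splits)
  then show ?thesis
    using small_UN[OF assms(1) small_finite[OF assms(1)], where I = "UNIV :: bool set" and F = "\<lambda>b. if b then A else B"] assms
    by auto
qed

lemma small_lists:
  fixes L :: "'a itself"
  assumes inf: "infinite (UNIV :: 'a set)" and S: "small L S"
  shows "small L (lists S)"
proof -
  have "small L {xs. set xs \<subseteq> S \<and> length xs = k}" for k
  proof (induction k)
    case 0
    show ?case by (rule small_finite[OF inf]) simp
  next
    case (Suc k)
    have "{xs. set xs \<subseteq> S \<and> length xs = Suc k} =
        (\<lambda>(x, xs). x # xs) ` (S \<times> {xs. set xs \<subseteq> S \<and> length xs = k})"
      by (auto simp: length_Suc_conv image_iff)
    then show ?case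
      using small_image[OF small_Sigma[OF inf S Suc.IH]] by simp
  qed
  then have "small L (\<Union>k. {xs. set xs \<subseteq> S \<and> length xs = k})"
    by (intro small_UN[OF inf small_nat[OF inf]])
  then show ?thesis
    by (rule small_subset) auto
qed

section \<open>The successor cardinal\<close>

text \<open>What the construction uses of lambda^+: its proper initial segments have size at most
  lambda, and \<open>bdd\<close> is its regularity.\<close>

locale succ_cardinal =
  fixes Lam :: "'a itself" and Kap :: "'k::wellorder itself"
  assumes inf: "infinite (UNIV :: 'a set)"
    and seg: "\<And>\<alpha> :: 'k. small Lam {..<\<alpha>}"
    and bdd: "\<And>S :: 'k set. small Lam S \<Longrightarrow> \<exists>\<alpha>. \<forall>x\<in>S. x < \<alpha>"
begin

abbreviation "sm S \<equiv> small Lam S"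

lemma not_small_UNIV: "\<not> sm (UNIV :: 'k set)"
  using bdd by blast

lemma seg_le: "sm {..\<alpha>::'k}"
proof -
  have "{..\<alpha>} = {\<alpha>} \<union> {..<\<alpha>}" by auto
  then show ?thesis using small_Un[OF inf small_finite[OF inf] seg, of "{\<alpha>}" \<alpha>] by simp
qed

lemma no_top: "\<exists>\<gamma>. (\<beta>::'k) < \<gamma>"
  using bdd[OF small_finite[OF inf], of "{\<beta>}"] by auto

end

section \<open>Successors, gaps and limits of a ladder\<close>

definition suc :: "'k::wellorder \<Rightarrow> 'k" where
  "suc \<beta> = (LEAST \<gamma>. \<beta> < \<gamma>)"

definition is_lim :: "'k::wellorder \<Rightarrow> bool" where
  "is_lim \<alpha> \<longleftrightarrow> positive \<alpha> \<and> (\<forall>\<beta><\<alpha>. suc \<beta> < \<alpha>)"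

text \<open>The upper end \<gamma> may lie outside C, so the notion also applies to a position over
  which C jumps.\<close>

definition gap :: "'k::wellorder set \<Rightarrow> 'k \<Rightarrow> 'k \<Rightarrow> bool" where
  "gap C \<beta> \<gamma> \<longleftrightarrow> \<beta> \<in> C \<and> \<beta> < \<gamma> \<and> C \<inter> {\<beta><..<\<gamma>} = {}"

text \<open>The mark written at \<beta>. It is the least ordinal if C has no point below \<beta>,
  and \<beta> itself if C is unbounded in \<beta>.\<close>

definition supb :: "'k::wellorder set \<Rightarrow> 'k \<Rightarrow> 'k" where
  "supb C \<beta> = (LEAST \<mu>. \<forall>c\<in>C \<inter> {..<\<beta>}. c \<le> \<mu>)"

lemma gap_iff: "gap C \<beta> \<gamma> \<longleftrightarrow> \<beta> \<in> C \<inter> {..<\<gamma>} \<and> (\<forall>c\<in>C \<inter> {..<\<gamma>}. c \<le> \<beta>)"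
  unfolding gap_def by (auto simp: disjoint_iff not_less[symmetric])

lemma gap_unique: "gap C \<beta> \<gamma> \<Longrightarrow> gap C \<beta>' \<gamma> \<Longrightarrow> \<beta> = (\<beta>'::'k::wellorder)"
  unfolding gap_iff by (meson order_antisym)

lemma the_gap: "gap C \<beta> \<gamma> \<Longrightarrow> (THE \<beta>. gap C \<beta> \<gamma>) = \<beta>"
  by (rule the_equality) (auto intro: gap_unique)

lemma gap_cong: "C \<inter> {..<\<gamma>} = C' \<inter> {..<\<gamma>} \<Longrightarrow> gap C \<beta> \<gamma> \<longleftrightarrow> gap C' \<beta> \<gamma>"
  by (simp only: gap_iff)

lemma supb_cong: "C \<inter> {..<\<beta>} = C' \<inter> {..<\<beta>} \<Longrightarrow> supb C \<beta> = supb C' \<beta>"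
  by (simp only: supb_def)

lemma supb_upper: "c \<in> C \<Longrightarrow> c < \<beta> \<Longrightarrow> c \<le> supb C \<beta>"
  unfolding supb_def by (rule LeastI2[of _ \<beta>]) auto

lemma supb_least: "(\<And>c. c \<in> C \<Longrightarrow> c < \<beta> \<Longrightarrow> c \<le> \<mu>) \<Longrightarrow> supb C \<beta> \<le> \<mu>"
  unfolding supb_def by (rule Least_le) auto

lemma supb_le: "supb C \<beta> \<le> \<beta>"
  by (rule supb_least) simp

lemma sup_isI:
  assumes "S \<subseteq> {..\<alpha>}" "\<And>\<gamma>. \<gamma> < \<alpha> \<Longrightarrow> \<exists>c\<in>S. \<gamma> < c"
  shows "sup_is S (\<alpha>::'k::wellorder)"
  unfolding sup_is_def using assms by (auto simp: not_less[symmetric])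

lemma sup_isD: "sup_is S (\<alpha>::'k::wellorder) \<Longrightarrow> \<gamma> < \<alpha> \<Longrightarrow> \<exists>c\<in>S. \<gamma> < c"
  unfolding sup_is_def by (auto simp: not_less[symmetric])

definition unbd :: "'k::wellorder set \<Rightarrow> 'k \<Rightarrow> bool" where
  "unbd C \<gamma> \<longleftrightarrow> (\<forall>\<xi><\<gamma>. \<exists>\<beta>\<in>C. \<xi> < \<beta> \<and> \<beta> < \<gamma>)"

lemma unbd_sup_is: "unbd C \<gamma> \<Longrightarrow> sup_is (C \<inter> {..<\<gamma>}) \<gamma>"
  unfolding unbd_def by (intro sup_isI) auto

lemma unbd_no_gap: "unbd C \<gamma> \<Longrightarrow> \<not> gap C \<beta> \<gamma>"
  unfolding unbd_def gap_def by fastforce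

text \<open>The supremum \<mu> of the part of C below \<gamma> is either \<gamma>, or it belongs to
  C by closedness and is the lower end of a gap. The point \<open>\<gamma>\<^sub>0\<close> makes
  \<mu> positive, as closedness requires.\<close>

lemma gap_or_unbd:
  fixes C :: "'k::wellorder set"
  assumes cl: "closed_below C \<delta>" and C0: "\<gamma>\<^sub>0 \<in> C" "\<gamma>\<^sub>0 < \<gamma>" and le: "\<gamma> \<le> \<delta>"
  shows "(\<exists>\<beta>\<ge>\<gamma>\<^sub>0. gap C \<beta> \<gamma>) \<or> unbd C \<gamma>"
proof (rule ccontr)
  assume neg: "\<not> ?thesis"
  then obtain \<xi> where \<xi>: "\<xi> < \<gamma>" "\<And>\<beta>. \<beta> \<in> C \<Longrightarrow> \<beta> < \<gamma> \<Longrightarrow> \<beta> \<le> \<xi>"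
    unfolding unbd_def by (meson leI)
  define \<mu> where "\<mu> = supb C \<gamma>"
  have \<mu>\<xi>: "\<mu> \<le> \<xi>" unfolding \<mu>_def by (rule supb_least) (use \<xi> in auto)
  have up: "c \<le> \<mu>" if "c \<in> C" "c < \<gamma>" for c
    unfolding \<mu>_def using that by (rule supb_upper)
  have "\<mu> \<in> C"
  proof (rule ccontr)
    assume nC: "\<mu> \<notin> C"
    have "\<gamma>\<^sub>0 \<le> \<mu>" using up C0 by auto
    with nC C0 have pos: "\<gamma>\<^sub>0 < \<mu>" by (metis order_le_less)
    have "sup_is (C \<inter> {..<\<mu>}) \<mu>"
    proof (rule sup_isI)
      fix \<eta> assume "\<eta> < \<mu>"
      then obtain c where c: "c \<in> C" "c < \<gamma>" "\<eta> < c"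
        unfolding \<mu>_def by (meson leD not_le_imp_less supb_least)
      then show "\<exists>c\<in>C \<inter> {..<\<mu>}. \<eta> < c"
        using up[OF c(1,2)] nC by (intro bexI[of _ c]) (auto simp: order_le_less)
    qed auto
    moreover have "\<mu> < \<delta>" using \<mu>\<xi> \<xi>(1) le by simp
    ultimately show False
      using cl nC pos unfolding closed_below_def positive_def by blast
  qed
  moreover have "\<gamma>\<^sub>0 \<le> \<mu>" using up C0 by auto
  moreover have "\<mu> < \<gamma>" using \<mu>\<xi> \<xi> by auto
  ultimately show False
    using neg up unfolding gap_def by (metis (no_types, lifting) disjoint_iff greaterThanLessThan_iff leD)
qed

context succ_cardinal
begin

lemma suc_gt: "(\<beta>::'k) < suc \<beta>"
  unfolding suc_def using no_top by (rule LeastI_ex)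

lemma suc_least: "\<beta> < \<gamma> \<Longrightarrow> suc \<beta> \<le> (\<gamma>::'k)"
  unfolding suc_def by (rule Least_le)

lemma less_suc_iff: "\<beta> < suc \<gamma> \<longleftrightarrow> \<beta> \<le> (\<gamma>::'k)"
proof
  assume "\<beta> < suc \<gamma>"
  then have "\<not> \<gamma> < \<beta>" using suc_least[of \<gamma> \<beta>] by auto
  then show "\<beta> \<le> \<gamma>" by simp
next
  assume "\<beta> \<le> \<gamma>"
  then show "\<beta> < suc \<gamma>" using suc_gt[of \<gamma>] by (rule order_le_less_trans)
qed

lemma suc_le_iff: "suc \<beta> \<le> \<gamma> \<longleftrightarrow> \<beta> < (\<gamma>::'k)"
  using suc_least[of \<beta> \<gamma>] order_less_le_trans[OF suc_gt, of \<beta> \<gamma>] by auto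

lemma suc_inject: "suc \<beta> = suc \<gamma> \<longleftrightarrow> \<beta> = (\<gamma>::'k)"
  using less_suc_iff[of \<beta> \<gamma>] less_suc_iff[of \<gamma> \<beta>] suc_gt[of \<beta>] suc_gt[of \<gamma>] by auto

lemma lessThan_suc: "{..<suc \<beta>} = insert \<beta> {..<(\<beta>::'k)}"
  by (auto simp: less_suc_iff)

lemma zero_suc_lim:
  obtains "\<not> positive (\<alpha>::'k)" | \<beta> where "\<alpha> = suc \<beta>" | "is_lim \<alpha>"
  unfolding is_lim_def using suc_least by (auto simp: order_le_less)

lemma not_lim_suc: "\<not> is_lim (suc (\<beta>::'k))"
  unfolding is_lim_def using suc_gt by auto

lemma positive_suc: "positive (suc (\<beta>::'k))"
  unfolding positive_def using suc_gt by auto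

lemma bdd_fun:
  assumes "sm I"
  shows "\<exists>\<alpha>::'k. \<forall>i\<in>I. f i < \<alpha>"
  using bdd[OF small_image[OF assms, of f]] by auto

lemma unbd_lim: "unbd C \<gamma> \<Longrightarrow> positive \<gamma> \<Longrightarrow> is_lim (\<gamma>::'k)"
  unfolding unbd_def is_lim_def by (meson order_le_less_trans suc_least)

text \<open>For unboundedness, iterate a map \<open>b\<close> that dominates \<open>g\<close> on
  initial segments. The countably many iterates are bounded because lambda is infinite, and their
  supremum is a closure point.\<close>

lemma club_closure_points:
  fixes g :: "'k \<Rightarrow> 'k"
  shows "club {\<gamma>. \<alpha> < \<gamma> \<and> (\<forall>\<beta><\<gamma>. g \<beta> < \<gamma>)}" (is "club ?S")
  unfolding club_def
proof (intro conjI allI impI)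
  fix \<alpha>' :: 'k
  have "\<exists>\<eta>. \<xi> < \<eta> \<and> (\<forall>\<beta>\<le>\<xi>. g \<beta> < \<eta>)" for \<xi> :: 'k
  proof -
    obtain \<eta> where \<eta>: "\<forall>\<beta>\<in>{..\<xi>}. g \<beta> < \<eta>" using bdd_fun[OF seg_le] by blast
    obtain \<eta>' where "\<xi> < \<eta>'" using no_top by blast
    then show ?thesis using \<eta> by (intro exI[of _ "max \<eta> \<eta>'"]) (auto simp: less_max_iff_disj)
  qed
  then obtain b where b: "\<And>\<xi>. \<xi> < b \<xi>" "\<And>\<xi> \<beta>. \<beta> \<le> \<xi> \<Longrightarrow> g \<beta> < b \<xi>"
    using choice[of "\<lambda>\<xi> \<eta>. \<xi> < \<eta> \<and> (\<forall>\<beta>\<le>\<xi>. g \<beta> < \<eta>)"] by blast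
  define f where "f k = (b ^^ k) (max \<alpha> \<alpha>')" for k
  have f0: "f 0 = max \<alpha> \<alpha>'" and fS: "\<And>k. f (Suc k) = b (f k)" by (auto simp: f_def)
  have "\<exists>\<gamma>. \<forall>k. f k \<le> \<gamma>"
    using bdd_fun[OF small_nat[OF inf], of UNIV f] by (auto intro: order_less_imp_le)
  define \<gamma> where "\<gamma> = (LEAST \<gamma>. \<forall>k. f k \<le> \<gamma>)"
  have \<gamma>1: "f k \<le> \<gamma>" for k
    using LeastI_ex[OF \<open>\<exists>\<gamma>. \<forall>k. f k \<le> \<gamma>\<close>] by (simp add: \<gamma>_def)
  have \<gamma>2: "\<exists>k. \<beta> < f k" if "\<beta> < \<gamma>" for \<beta>
    using not_less_Least[OF that[unfolded \<gamma>_def]] by (auto simp: not_le)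
  have lt: "f k < \<gamma>" for k
    using b(1)[of "f k"] \<gamma>1[of "Suc k"] unfolding fS by (rule order_less_le_trans)
  moreover have "g \<beta> < \<gamma>" if less: "\<beta> < \<gamma>" for \<beta>
  proof -
    obtain k where "\<beta> < f k" using \<gamma>2[OF less] by blast
    then have "g \<beta> < f (Suc k)" using b(2)[of \<beta> "f k"] fS[of k] by simp
    then show ?thesis using lt[of "Suc k"] by simp
  qed
  ultimately have "\<gamma> \<in> ?S" "\<alpha>' \<le> \<gamma>"
    using lt[of 0] unfolding f0 by auto
  then show "\<exists>\<gamma>\<in>?S. \<alpha>' \<le> \<gamma>" by blast
next
  fix \<beta> :: 'k
  assume *: "positive \<beta> \<and> sup_is (?S \<inter> {..<\<beta>}) \<beta>"
  have ex: "\<exists>c\<in>?S. \<xi> < c \<and> c < \<beta>" if "\<xi> < \<beta>" for \<xi>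
    using sup_isD[OF conjunct2[OF *] that] by auto
  obtain \<xi> where "\<xi> < \<beta>" using * unfolding positive_def by blast
  then show "\<beta> \<in> ?S" using ex by fastforce
qed

lemma stationary_Int_club_cofinal:
  assumes "stationary S"
  shows "cofinal {\<gamma>\<in>S. \<alpha> < \<gamma> \<and> (\<forall>\<beta><\<gamma>. g \<beta> < (\<gamma>::'k))}"
  unfolding cofinal_def
proof
  fix \<alpha>'
  have "\<exists>\<gamma>. \<gamma> \<in> S \<inter> {\<gamma>. max \<alpha> \<alpha>' < \<gamma> \<and> (\<forall>\<beta><\<gamma>. g \<beta> < \<gamma>)}"
    using assms club_closure_points unfolding stationary_def by blast
  then show "\<exists>\<beta>\<in>{\<gamma>\<in>S. \<alpha> < \<gamma> \<and> (\<forall>\<beta><\<gamma>. g \<beta> < \<gamma>)}. \<alpha>' \<le> \<beta>"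
    using order_less_imp_le by auto
qed

end

abbreviation less_rel :: "('k::wellorder \<times> 'k) set" where
  "less_rel \<equiv> {(x, y). x < y}"

section \<open>Restrictions of nodes to initial segments\<close>

lemma restrict_restrict_le: "\<beta> \<le> \<gamma> \<Longrightarrow> (x |` {..<\<gamma>}) |` {..<\<beta>} = x |` {..<(\<beta>::'k::wellorder)}"
  by (simp add: restrict_restrict Int_absorb1)

lemma restrict_id: "dom x \<subseteq> A \<Longrightarrow> x |` A = x"
  by (rule ext) (metis domIff restrict_map_def subsetD)

lemma dom_restrict_le: "dom x = {..<\<gamma>} \<Longrightarrow> \<beta> \<le> \<gamma> \<Longrightarrow> dom (x |` {..<\<beta>}) = {..<(\<beta>::'k::wellorder)}"
  by auto

lemma restrict_apply: "x |` {..<\<gamma>} = y \<Longrightarrow> \<xi> < \<gamma> \<Longrightarrow> x \<xi> = y (\<xi>::'k::wellorder)"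
  by auto

lemma map_le_restrict:
  assumes dom: "dom x = {..<\<alpha>}"
  shows "x \<subseteq>\<^sub>m y \<longleftrightarrow> y |` {..<\<alpha>} = x"
proof
  assume le: "x \<subseteq>\<^sub>m y"
  show "y |` {..<\<alpha>} = x"
  proof (rule ext)
    fix \<xi>
    show "(y |` {..<\<alpha>}) \<xi> = x \<xi>"
    proof (cases "\<xi> \<in> dom x")
      case True
      then show ?thesis using le dom unfolding map_le_def by simp
    next
      case False
      then show ?thesis using dom by (metis domIff restrict_map_def)
    qed
  qed
next
  assume "y |` {..<\<alpha>} = x"
  then show "x \<subseteq>\<^sub>m y" unfolding map_le_def dom by (metis restrict_in)
qed

lemma Int_lessThan_cong:
  assumes "C \<inter> {..<\<gamma>} = C' \<inter> {..<\<gamma>}" "\<beta> \<le> \<gamma>"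
  shows "C \<inter> {..<\<beta>} = C' \<inter> {..<(\<beta>::'k::wellorder)}"
proof -
  have "{..<\<beta>} = {..<\<gamma>} \<inter> {..<\<beta>}" using assms(2) by auto
  then show ?thesis using assms(1) by (metis Int_assoc)
qed

section \<open>Construction of the tree\<close>

definition nodes :: "('k::wellorder \<rightharpoonup> 'v) set" where
  "nodes = {x. \<exists>\<alpha>. dom x = {..<\<alpha>}}"

text \<open>\<open>h\<close> writes ordinals as node values. The guesses \<open>Ds\<close> and the
  coding \<open>code\<close> are arbitrary here: they only influence which of the promise-keeping
  maps is chosen, so the structure of the levels does not depend on the quality of the
  guesses.\<close>

locale tree_construction = succ_cardinal Lam Kap
  for Lam :: "'a itself" and Kap :: "'k::wellorder itself" +
  fixes h :: "'k \<Rightarrow> 'h" and n :: nat and Cs :: "'k \<Rightarrow> 'k set"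
    and code :: "('k \<rightharpoonup> 'h) list \<times> ('k \<rightharpoonup> 'h) list \<Rightarrow> 'k" and Ds :: "'k \<Rightarrow> 'k set"
  assumes h: "inj h"
    and Cs_closed: "\<And>\<alpha>. closed_below (Cs \<alpha>) \<alpha>"
    and Cs_sup: "\<And>\<alpha>. same_sup (Cs \<alpha>) {..<\<alpha>}"
    and Cs_coh: "\<And>\<alpha> \<alpha>'. \<alpha>' \<in> acc (Cs \<alpha>) \<Longrightarrow> Cs \<alpha>' = Cs \<alpha> \<inter> {..<\<alpha>'}"
begin

text \<open>The promise: at most \<open>n\<close> nodes can jointly show an old mark at a position jumped over.\<close>

definition good :: "('k \<Rightarrow> ('k \<rightharpoonup> 'h) set) \<Rightarrow> 'k \<Rightarrow> 'k \<Rightarrow> (('k \<rightharpoonup> 'h) \<Rightarrow> ('k \<rightharpoonup> 'h)) \<Rightarrow> bool" where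
  "good L \<beta> \<gamma> e \<longleftrightarrow> (\<forall>x\<in>L (suc \<beta>). e x \<in> L \<gamma> \<and> e x |` {..<suc \<beta>} = x) \<and>
     (\<forall>\<xi> \<iota> S. suc \<beta> \<le> \<xi> \<longrightarrow> \<xi> < \<gamma> \<longrightarrow> \<iota> \<le> \<beta> \<longrightarrow> S \<subseteq> L (suc \<beta>) \<longrightarrow> (\<forall>x\<in>S. e x \<xi> = Some (h \<iota>)) \<longrightarrow>
        finite S \<and> card S \<le> n)"

text \<open>\<open>code (xs, l) \<in> Ds \<gamma>\<close> says that diamond proposes, for the tuple of walkers started at \<open>xs\<close>, to
  pass through the tuple \<open>l\<close> on their way to level \<open>\<gamma>\<close>.\<close>

definition hits :: "(('k \<rightharpoonup> 'h) \<Rightarrow> ('k \<rightharpoonup> 'h)) \<Rightarrow> 'k \<Rightarrow> 'k \<Rightarrow> 'k \<Rightarrow> (('k \<rightharpoonup> 'h) \<Rightarrow> ('k \<rightharpoonup> 'h)) \<Rightarrow> bool" where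
  "hits z w \<beta> \<gamma> e \<longleftrightarrow> (\<exists>xs l. xs \<in> lists nodes \<and> l \<in> lists nodes \<and> length l = length xs \<and>
     code (xs, l) \<in> Ds \<gamma> \<and> (\<forall>j<length xs. l ! j \<subseteq>\<^sub>m e ((z (xs ! j))(\<beta> \<mapsto> h w))))"

text \<open>One map for all walkers. Of the ladder the choice sees only \<open>z\<close>, the walk
  up to \<beta>, and the mark \<open>w\<close>, both determined by the ladder below \<beta>; hence
  ladders with the same initial segment make the same jumps.\<close>

definition step :: "('k \<Rightarrow> ('k \<rightharpoonup> 'h) set) \<Rightarrow> (('k \<rightharpoonup> 'h) \<Rightarrow> ('k \<rightharpoonup> 'h)) \<Rightarrow> 'k \<Rightarrow> 'k \<Rightarrow> 'k \<Rightarrow> ('k \<rightharpoonup> 'h) \<Rightarrow> ('k \<rightharpoonup> 'h)" where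
  "step L z w \<beta> \<gamma> = (SOME e. good L \<beta> \<gamma> e \<and> ((\<exists>e'. good L \<beta> \<gamma> e' \<and> hits z w \<beta> \<gamma> e') \<longrightarrow> hits z w \<beta> \<gamma> e))"

text \<open>A node already reaching \<gamma> is returned unchanged, which spares the starting level
  as a parameter. The last branch is meant for limits of C: it glues the earlier stages, reading
  position \<xi> off the stage at the least ladder point past \<xi>.\<close>

definition walk_rec :: "('k \<Rightarrow> ('k \<rightharpoonup> 'h) set) \<Rightarrow> 'k set \<Rightarrow> ('k \<Rightarrow> ('k \<rightharpoonup> 'h) \<Rightarrow> ('k \<rightharpoonup> 'h)) \<Rightarrow> 'k \<Rightarrow> ('k \<rightharpoonup> 'h) \<Rightarrow> ('k \<rightharpoonup> 'h)" where
  "walk_rec L C f \<gamma> x =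
     (if {..<\<gamma>} \<subseteq> dom x then x
      else if \<exists>\<beta>. gap C \<beta> \<gamma> then
        (let \<beta> = (THE \<beta>. gap C \<beta> \<gamma>); w = supb C \<beta> in step L (f \<beta>) w \<beta> \<gamma> ((f \<beta> x)(\<beta> \<mapsto> h w)))
      else (\<lambda>\<xi>. if \<exists>\<beta>. \<beta> \<in> C \<and> \<xi> < \<beta> \<and> \<beta> < \<gamma> then f (LEAST \<beta>. \<beta> \<in> C \<and> \<xi> < \<beta> \<and> \<beta> < \<gamma>) x \<xi> else None))"

definition walk :: "('k \<Rightarrow> ('k \<rightharpoonup> 'h) set) \<Rightarrow> 'k set \<Rightarrow> 'k \<Rightarrow> ('k \<rightharpoonup> 'h) \<Rightarrow> ('k \<rightharpoonup> 'h)" where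
  "walk L C = wfrec less_rel (walk_rec L C)"

text \<open>Admitting at \<beta> only the values \<open>h \<iota>\<close> with \<iota> \<le> \<beta>
  keeps the levels of size at most lambda; these values contain every mark
  \<open>supb C \<beta>\<close> as well as \<open>h \<beta>\<close>, which is newer than any mark
  forbidden by an earlier promise.\<close>

definition Lv_rec :: "('k \<Rightarrow> ('k \<rightharpoonup> 'h) set) \<Rightarrow> 'k \<Rightarrow> ('k \<rightharpoonup> 'h) set" where
  "Lv_rec L \<alpha> =
     (if \<not> positive \<alpha> then {Map.empty}
      else if is_lim \<alpha> then {walk L (Cs \<alpha>) \<alpha> x |x \<gamma>. \<gamma> \<in> Cs \<alpha> \<and> x \<in> L \<gamma>}
      else (let \<beta> = (THE \<beta>. \<alpha> = suc \<beta>) in {x(\<beta> \<mapsto> h \<iota>) |x \<iota>. x \<in> L \<beta> \<and> \<iota> \<le> \<beta>}))"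

definition Lv :: "'k \<Rightarrow> ('k \<rightharpoonup> 'h) set" where
  "Lv = wfrec less_rel Lv_rec"

section \<open>Unfolding the recursions for walks and levels\<close>

lemma wf_less_rel: "wf (less_rel :: ('k \<times> 'k) set)"
  by (rule wf)

lemma good_cong:
  assumes "L (suc \<beta>) = L' (suc \<beta>)" "L \<gamma> = L' \<gamma>"
  shows "good L \<beta> \<gamma> = good L' \<beta> \<gamma>"
  unfolding good_def assms ..

lemma step_cong:
  assumes "L (suc \<beta>) = L' (suc \<beta>)" "L \<gamma> = L' \<gamma>"
  shows "step L z w \<beta> \<gamma> = step L' z w \<beta> \<gamma>"
  unfolding step_def good_cong[of L, OF assms] ..

lemma walk_rec_cong:
  assumes f: "\<And>\<beta>. \<beta> < \<gamma> \<Longrightarrow> f \<beta> = f' \<beta>"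
    and C: "C \<inter> {..<\<gamma>} = C' \<inter> {..<\<gamma>}"
    and L: "\<And>\<beta>. gap C \<beta> \<gamma> \<Longrightarrow> L (suc \<beta>) = L' (suc \<beta>) \<and> L \<gamma> = L' \<gamma>"
  shows "walk_rec L C f \<gamma> = walk_rec L' C' f' \<gamma>"
proof (rule ext)
  fix x
  show "walk_rec L C f \<gamma> x = walk_rec L' C' f' \<gamma> x"
  proof (cases "\<exists>\<beta>. gap C \<beta> \<gamma>")
    case True
    then obtain \<beta> where g: "gap C \<beta> \<gamma>" by blast
    have g': "gap C' \<beta> \<gamma>" using g gap_cong[OF C] by simp
    have lt: "\<beta> < \<gamma>" using g unfolding gap_def by simp
    then have "C \<inter> {..<\<beta>} = C' \<inter> {..<\<beta>}" using Int_lessThan_cong[OF C] by simp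
    then have s: "supb C \<beta> = supb C' \<beta>" by (rule supb_cong)
    have e: "(\<exists>\<beta>. gap C \<beta> \<gamma>) = True" "(\<exists>\<beta>. gap C' \<beta> \<gamma>) = True" using g g' by blast+
    have "step L z w \<beta> \<gamma> = step L' z w \<beta> \<gamma>" for z w
      using step_cong[of L \<beta> L' \<gamma>] L[OF g] by blast
    then show ?thesis
      unfolding walk_rec_def Let_def the_gap[OF g] the_gap[OF g'] s f[OF lt] e by simp
  next
    case False
    then have no': "\<not> (\<exists>\<beta>. gap C' \<beta> \<gamma>)" using gap_cong[OF C] by simp
    have C: "\<beta> \<in> C \<and> \<xi> < \<beta> \<and> \<beta> < \<gamma> \<longleftrightarrow> \<beta> \<in> C' \<and> \<xi> < \<beta> \<and> \<beta> < \<gamma>" for \<beta> \<xi>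
      using C by blast
    have "f (LEAST \<beta>. \<beta> \<in> C' \<and> \<xi> < \<beta> \<and> \<beta> < \<gamma>) = f' (LEAST \<beta>. \<beta> \<in> C' \<and> \<xi> < \<beta> \<and> \<beta> < \<gamma>)"
      if "\<exists>\<beta>. \<beta> \<in> C' \<and> \<xi> < \<beta> \<and> \<beta> < \<gamma>" for \<xi>
      using LeastI_ex[OF that] f by blast
    then show ?thesis
      unfolding walk_rec_def C using False no' by (simp cong: if_cong)
  qed
qed

lemma walk_unfold: "walk L C \<gamma> = walk_rec L C (walk L C) \<gamma>"
proof -
  have "walk L C \<gamma> = walk_rec L C (cut (walk L C) less_rel \<gamma>) \<gamma>"
    unfolding walk_def by (rule wfrec[OF wf_less_rel])
  also have "\<dots> = walk_rec L C (walk L C) \<gamma>"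
    by (rule walk_rec_cong) (auto simp: cut_apply)
  finally show ?thesis .
qed

text \<open>A walk to \<gamma> reads the ladder below \<gamma> and the levels below \<gamma>; level
  \<gamma> itself is read only if the last move is a jump. At a limit level the last move is a
  union, so defining that level by walks is not circular.\<close>

lemma walk_cong:
  assumes "C \<inter> {..<\<gamma>} = C' \<inter> {..<\<gamma>}" "\<And>\<beta>. \<beta> < \<gamma> \<Longrightarrow> L \<beta> = L' \<beta>"
    "(\<exists>\<beta>. gap C \<beta> \<gamma>) \<Longrightarrow> L \<gamma> = L' \<gamma>"
  shows "walk L C \<gamma> = walk L' C' \<gamma>"
  using assms
proof (induction \<gamma> rule: less_induct)
  case (less \<gamma>)
  have "walk L C \<beta> = walk L' C' \<beta>" if "\<beta> < \<gamma>" for \<beta>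
  proof (rule less.IH[OF that])
    show "C \<inter> {..<\<beta>} = C' \<inter> {..<\<beta>}"
      using Int_lessThan_cong[OF less.prems(1)] that by simp
  qed (use less.prems that in auto)
  moreover have "L (suc \<beta>) = L' (suc \<beta>) \<and> L \<gamma> = L' \<gamma>" if g: "gap C \<beta> \<gamma>" for \<beta>
  proof -
    have "suc \<beta> \<le> \<gamma>" using g unfolding gap_def by (simp add: suc_least)
    then show ?thesis using less.prems(2,3) g by (auto simp: order_le_less)
  qed
  ultimately show ?case
    unfolding walk_unfold[of L C \<gamma>] walk_unfold[of L' C' \<gamma>]
    by (intro walk_rec_cong less.prems(1)) auto
qed

lemma Cs_sub: "Cs \<alpha> \<subseteq> {..<\<alpha>}"
  using Cs_closed[of \<alpha>] unfolding closed_below_def by blast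

lemma unbd_Cs: "is_lim \<alpha> \<Longrightarrow> unbd (Cs \<alpha>) \<alpha>"
  unfolding unbd_def
proof (intro allI impI)
  fix \<xi> assume lim: "is_lim \<alpha>" and "\<xi> < \<alpha>"
  then have "\<exists>c\<in>{..<\<alpha>}. \<not> c \<le> \<xi>"
    using suc_gt[of \<xi>] unfolding is_lim_def by (auto simp: not_le)
  then have "\<exists>c\<in>Cs \<alpha>. \<not> c \<le> \<xi>"
    using Cs_sup[of \<alpha>] unfolding same_sup_def by blast
  then show "\<exists>\<beta>\<in>Cs \<alpha>. \<xi> < \<beta> \<and> \<beta> < \<alpha>"
    using Cs_sub[of \<alpha>] by (auto simp: not_le)
qed

lemma Lv_unfold: "Lv \<alpha> = Lv_rec (cut Lv less_rel \<alpha>) \<alpha>"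
  unfolding Lv_def by (rule wfrec[OF wf_less_rel])

lemma Lv_0: "\<not> positive \<alpha> \<Longrightarrow> Lv \<alpha> = {Map.empty}"
  unfolding Lv_unfold[of \<alpha>] Lv_rec_def by simp

lemma Lv_suc: "Lv (suc \<beta>) = {x(\<beta> \<mapsto> h \<iota>) |x \<iota>. x \<in> Lv \<beta> \<and> \<iota> \<le> \<beta>}"
  unfolding Lv_unfold[of "suc \<beta>"] Lv_rec_def
  by (simp add: positive_suc not_lim_suc suc_inject cut_apply suc_gt)

lemma Lv_lim:
  assumes "is_lim \<alpha>"
  shows "Lv \<alpha> = {walk Lv (Cs \<alpha>) \<alpha> x |x \<gamma>. \<gamma> \<in> Cs \<alpha> \<and> x \<in> Lv \<gamma>}"
proof -
  have "walk (cut Lv less_rel \<alpha>) (Cs \<alpha>) \<alpha> = walk Lv (Cs \<alpha>) \<alpha>"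
    using unbd_no_gap[OF unbd_Cs[OF assms]] by (intro walk_cong) (auto simp: cut_apply)
  moreover have "positive \<alpha>" using assms unfolding is_lim_def by simp
  moreover have "\<gamma> \<in> Cs \<alpha> \<Longrightarrow> cut Lv less_rel \<alpha> \<gamma> = Lv \<gamma>" for \<gamma>
    using Cs_sub[of \<alpha>] by (auto simp: cut_apply)
  ultimately show ?thesis
    unfolding Lv_unfold[of \<alpha>] Lv_rec_def using assms by auto
qed

abbreviation Wk :: "'k set \<Rightarrow> 'k \<Rightarrow> ('k \<rightharpoonup> 'h) \<Rightarrow> ('k \<rightharpoonup> 'h)" where "Wk \<equiv> walk Lv"

abbreviation st :: "'k set \<Rightarrow> 'k \<Rightarrow> 'k \<Rightarrow> ('k \<rightharpoonup> 'h) \<Rightarrow> ('k \<rightharpoonup> 'h)" where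
  "st C \<beta> \<gamma> \<equiv> step Lv (Wk C \<beta>) (supb C \<beta>) \<beta> \<gamma>"

lemma Wk_id: "{..<\<gamma>} \<subseteq> dom x \<Longrightarrow> Wk C \<gamma> x = x"
  unfolding walk_unfold[of _ _ \<gamma>] walk_rec_def by simp

lemma Wk_gap: "gap C \<beta> \<gamma> \<Longrightarrow> \<not> {..<\<gamma>} \<subseteq> dom x \<Longrightarrow>
    Wk C \<gamma> x = st C \<beta> \<gamma> ((Wk C \<beta> x)(\<beta> \<mapsto> h (supb C \<beta>)))"
  unfolding walk_unfold[of _ _ \<gamma>] walk_rec_def by (auto simp: the_gap Let_def)

lemma Wk_unbd: "unbd C \<gamma> \<Longrightarrow> \<not> {..<\<gamma>} \<subseteq> dom x \<Longrightarrow>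
    Wk C \<gamma> x \<xi> = (if \<exists>\<beta>. \<beta> \<in> C \<and> \<xi> < \<beta> \<and> \<beta> < \<gamma>
       then Wk C (LEAST \<beta>. \<beta> \<in> C \<and> \<xi> < \<beta> \<and> \<beta> < \<gamma>) x \<xi> else None)"
  using unbd_no_gap[of C \<gamma>] unfolding walk_unfold[of _ _ \<gamma>] walk_rec_def by auto

section \<open>The inductive invariant of a level\<close>

text \<open>The last clause is the freedom of \<open>n\<close> walkers: a promise-keeping map may be
  required to pass through \<open>n\<close> given nodes, provided these are already distinct at the
  level from which it starts. The empty set of requirements yields the existence of such
  maps.\<close>

definition level_ok :: "'k \<Rightarrow> bool" where
  "level_ok \<delta> \<longleftrightarrow> (\<forall>x\<in>Lv \<delta>. dom x = {..<\<delta>}) \<and> (\<forall>x\<in>Lv \<delta>. \<forall>\<gamma>\<le>\<delta>. x |` {..<\<gamma>} \<in> Lv \<gamma>) \<and> sm (Lv \<delta>) \<and>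
     (\<forall>\<beta> U. \<beta> < \<delta> \<longrightarrow> U \<subseteq> Lv \<delta> \<longrightarrow> finite U \<longrightarrow> card U \<le> n \<longrightarrow> inj_on (\<lambda>u. u |` {..<suc \<beta>}) U \<longrightarrow>
        (\<exists>e. good Lv \<beta> \<delta> e \<and> (\<forall>u\<in>U. e (u |` {..<suc \<beta>}) = u)))"

lemma level_ok_dom: "level_ok \<delta> \<Longrightarrow> x \<in> Lv \<delta> \<Longrightarrow> dom x = {..<\<delta>}"
  unfolding level_ok_def by simp

lemma level_ok_restrict: "level_ok \<delta> \<Longrightarrow> x \<in> Lv \<delta> \<Longrightarrow> \<gamma> \<le> \<delta> \<Longrightarrow> x |` {..<\<gamma>} \<in> Lv \<gamma>"
  unfolding level_ok_def by simp

lemma level_ok_sm: "level_ok \<delta> \<Longrightarrow> sm (Lv \<delta>)"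
  unfolding level_ok_def by simp

lemma level_ok_extend:
  assumes "level_ok \<delta>" "\<beta> < \<delta>" "U \<subseteq> Lv \<delta>" "finite U" "card U \<le> n" "inj_on (\<lambda>u. u |` {..<suc \<beta>}) U"
  obtains e where "good Lv \<beta> \<delta> e" "\<And>u. u \<in> U \<Longrightarrow> e (u |` {..<suc \<beta>}) = u"
proof -
  have "\<exists>e. good Lv \<beta> \<delta> e \<and> (\<forall>u\<in>U. e (u |` {..<suc \<beta>}) = u)"
    using assms unfolding level_ok_def by simp
  then show ?thesis using that by blast
qed

lemma good_in: "good L \<beta> \<gamma> e \<Longrightarrow> x \<in> L (suc \<beta>) \<Longrightarrow> e x \<in> L \<gamma>"
  unfolding good_def by simp

lemma good_restrict: "good L \<beta> \<gamma> e \<Longrightarrow> x \<in> L (suc \<beta>) \<Longrightarrow> e x |` {..<suc \<beta>} = x"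
  unfolding good_def by simp

lemma good_card:
  assumes "good L \<beta> \<gamma> e" "suc \<beta> \<le> \<xi>" "\<xi> < \<gamma>" "\<iota> \<le> \<beta>" "S \<subseteq> L (suc \<beta>)" "\<And>x. x \<in> S \<Longrightarrow> e x \<xi> = Some (h \<iota>)"
  shows "finite S \<and> card S \<le> n"
  using assms(1)[unfolded good_def, THEN conjunct2, rule_format, OF assms(2-5)] assms(6) by simp

lemma step_spec:
  assumes "level_ok \<gamma>" "\<beta> < \<gamma>"
  shows step_good: "good Lv \<beta> \<gamma> (step Lv z w \<beta> \<gamma>)"
    and step_hits: "good Lv \<beta> \<gamma> e \<Longrightarrow> hits z w \<beta> \<gamma> e \<Longrightarrow> hits z w \<beta> \<gamma> (step Lv z w \<beta> \<gamma>)"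
proof -
  let ?P = "\<lambda>e. good Lv \<beta> \<gamma> e \<and> ((\<exists>e'. good Lv \<beta> \<gamma> e' \<and> hits z w \<beta> \<gamma> e') \<longrightarrow> hits z w \<beta> \<gamma> e)"
  obtain e where "good Lv \<beta> \<gamma> e"
    by (rule level_ok_extend[OF assms, of "{}"]) auto
  then have "\<exists>e. ?P e" by blast
  then have "?P (step Lv z w \<beta> \<gamma>)"
    unfolding step_def by (rule someI_ex)
  then show "good Lv \<beta> \<gamma> (step Lv z w \<beta> \<gamma>)"
    "good Lv \<beta> \<gamma> e \<Longrightarrow> hits z w \<beta> \<gamma> e \<Longrightarrow> hits z w \<beta> \<gamma> (step Lv z w \<beta> \<gamma>)" for e
    by blast+
qed

lemma Lv_sucI: "x \<in> Lv \<beta> \<Longrightarrow> \<iota> \<le> \<beta> \<Longrightarrow> x(\<beta> \<mapsto> h \<iota>) \<in> Lv (suc \<beta>)"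
  unfolding Lv_suc by blast


text \<open>Gluing coherent stages at a limit of C. The coherence assumption speaks only of stages
  from \<open>\<gamma>\<^sub>0\<close> on, since below that level a stage is the starting node
  itself.\<close>

lemma walk_limit:
  assumes unbd: "unbd C \<gamma>" and \<gamma>0: "\<gamma>\<^sub>0 \<in> C" "\<gamma>\<^sub>0 < \<gamma>" and x: "dom x = {..<\<gamma>\<^sub>0}"
    and coh: "\<And>\<beta> \<beta>'. \<beta> \<in> C \<Longrightarrow> \<beta>' \<in> C \<Longrightarrow> \<gamma>\<^sub>0 \<le> \<beta>' \<Longrightarrow> \<beta>' \<le> \<beta> \<Longrightarrow> \<beta> < \<gamma> \<Longrightarrow>
      dom (Wk C \<beta> x) = {..<\<beta>} \<and> Wk C \<beta> x |` {..<\<beta>'} = Wk C \<beta>' x"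
  shows walk_limit_restrict: "\<And>\<beta>. \<beta> \<in> C \<Longrightarrow> \<gamma>\<^sub>0 \<le> \<beta> \<Longrightarrow> \<beta> < \<gamma> \<Longrightarrow> Wk C \<gamma> x |` {..<\<beta>} = Wk C \<beta> x"
    and walk_limit_dom: "dom (Wk C \<gamma> x) = {..<\<gamma>}"
proof -
  have nd: "\<not> {..<\<gamma>} \<subseteq> dom x" using x \<gamma>0 by auto
  have val: "Wk C \<gamma> x \<xi> = Wk C \<beta> x \<xi>" if \<beta>: "\<beta> \<in> C" "\<gamma>\<^sub>0 \<le> \<beta>" "\<beta> < \<gamma>" "\<xi> < \<beta>" for \<beta> \<xi>
  proof -
    let ?P = "\<lambda>\<beta>. \<beta> \<in> C \<and> \<xi> < \<beta> \<and> \<beta> < \<gamma>"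
    define \<beta>' where "\<beta>' = (LEAST \<beta>. ?P \<beta>)"
    have P: "?P \<beta>" using \<beta> by simp
    have \<beta>': "?P \<beta>'" "\<beta>' \<le> \<beta>"
      unfolding \<beta>'_def using LeastI[of ?P, OF P] Least_le[of ?P, OF P] by blast+
    have "\<exists>\<beta>. ?P \<beta>" using P by blast
    then have eq: "Wk C \<gamma> x \<xi> = Wk C \<beta>' x \<xi>"
      unfolding Wk_unbd[OF unbd nd] \<beta>'_def by simp
    show ?thesis
    proof (cases "\<gamma>\<^sub>0 \<le> \<beta>'")
      case True
      then have "Wk C \<beta> x |` {..<\<beta>'} = Wk C \<beta>' x"
        using coh[of \<beta> \<beta>'] \<beta> \<beta>' by simp
      then show ?thesis using eq restrict_apply[of "Wk C \<beta> x" \<beta>' _ \<xi>] \<beta>' by simp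
    next
      \<comment> \<open>The least ladder point past \<xi> may lie below the starting level. The walk
        then returns \<open>x\<close>, and so does the stage at \<open>\<gamma>\<^sub>0\<close>, of
        which all later stages are extensions.\<close>
      case False
      then have "Wk C \<beta>' x = x" using x by (intro Wk_id) auto
      moreover have "Wk C \<gamma>\<^sub>0 x = x" using x by (intro Wk_id) auto
      moreover have "Wk C \<beta> x |` {..<\<gamma>\<^sub>0} = Wk C \<gamma>\<^sub>0 x"
        using coh[of \<beta> \<gamma>\<^sub>0] \<beta> \<gamma>0 by simp
      moreover have "\<xi> < \<gamma>\<^sub>0" using \<beta>'(1) False by (meson not_le order.strict_trans)
      ultimately show ?thesis
        using eq restrict_apply[of "Wk C \<beta> x" \<gamma>\<^sub>0 _ \<xi>] by simp
    qed
  qed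
  have dom: "dom (Wk C \<beta> x) = {..<\<beta>}" if "\<beta> \<in> C" "\<gamma>\<^sub>0 \<le> \<beta>" "\<beta> < \<gamma>" for \<beta>
    using coh[of \<beta> \<beta>] that by simp
  show res: "Wk C \<gamma> x |` {..<\<beta>} = Wk C \<beta> x" if \<beta>: "\<beta> \<in> C" "\<gamma>\<^sub>0 \<le> \<beta>" "\<beta> < \<gamma>" for \<beta>
  proof (rule ext)
    fix \<xi>
    show "(Wk C \<gamma> x |` {..<\<beta>}) \<xi> = Wk C \<beta> x \<xi>"
      using val[OF \<beta>, of \<xi>] dom[OF \<beta>] by (metis domIff lessThan_iff restrict_map_def)
  qed
  show "dom (Wk C \<gamma> x) = {..<\<gamma>}"
  proof (intro set_eqI iffI)
    fix \<xi> assume \<xi>: "\<xi> \<in> dom (Wk C \<gamma> x)"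
    have "Wk C \<gamma> x \<xi> \<noteq> None" using \<xi> by auto
    then have "\<exists>\<beta>. \<beta> \<in> C \<and> \<xi> < \<beta> \<and> \<beta> < \<gamma>"
      using Wk_unbd[OF unbd nd, of \<xi>] by presburger
    then show "\<xi> \<in> {..<\<gamma>}" by auto
  next
    fix \<xi> assume "\<xi> \<in> {..<\<gamma>}"
    then obtain \<beta> where \<beta>: "\<beta> \<in> C" "max \<xi> \<gamma>\<^sub>0 < \<beta>" "\<beta> < \<gamma>"
      using unbd \<gamma>0(2) unfolding unbd_def by (metis lessThan_iff max_less_iff_conj)
    then have "Wk C \<gamma> x \<xi> = Wk C \<beta> x \<xi>" "\<xi> \<in> dom (Wk C \<beta> x)"
      using val[of \<beta> \<xi>] dom[of \<beta>] by (simp_all add: order_less_imp_le)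
    then show "\<xi> \<in> dom (Wk C \<gamma> x)" by (metis domIff)
  qed
qed

lemma supb_Lv: "y \<in> Lv \<beta> \<Longrightarrow> y(\<beta> \<mapsto> h (supb C \<beta>)) \<in> Lv (suc \<beta>)"
  by (rule Lv_sucI[OF _ supb_le])

lemma Cs_less: "\<gamma> \<in> Cs \<delta> \<Longrightarrow> \<gamma> < \<delta>"
  using Cs_sub by auto

lemma Cs_acc:
  assumes "\<gamma> \<in> Cs \<delta>" "unbd (Cs \<delta>) \<gamma>" "\<gamma>\<^sub>0 < \<gamma>"
  shows "Cs \<gamma> = Cs \<delta> \<inter> {..<\<gamma>}" "is_lim \<gamma>"
proof -
  have "positive \<gamma>" using assms(3) unfolding positive_def by blast
  then show "Cs \<gamma> = Cs \<delta> \<inter> {..<\<gamma>}" "is_lim \<gamma>"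
    using Cs_coh[of \<gamma> \<delta>] unbd_sup_is[OF assms(2)] assms(1,2) unbd_lim unfolding acc_def by auto
qed

lemma restrict_upd: "y \<in> Lv \<beta> \<Longrightarrow> dom y = {..<\<beta>} \<Longrightarrow> (y(\<beta> \<mapsto> v)) |` {..<\<beta>} = y"
  using restrict_id[of y "{..<\<beta>}"] by simp

text \<open>After a jump the node lies in level \<gamma> because promise-keeping maps end there. At
  an accumulation point the coherence of the ladders gives \<open>Cs \<gamma>\<close> as an initial
  segment of \<open>Cs \<delta>\<close>, so the stage is the walk along \<open>Cs \<gamma>\<close>
  and belongs to level \<gamma> by definition.\<close>

lemma walk_in:
  assumes IH: "\<forall>\<gamma><\<delta>. level_ok \<gamma>" and \<gamma>0: "\<gamma>\<^sub>0 \<in> Cs \<delta>" and x: "x \<in> Lv \<gamma>\<^sub>0"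
  shows "\<gamma> \<in> Cs \<delta> \<Longrightarrow> \<gamma>\<^sub>0 \<le> \<gamma> \<Longrightarrow> Wk (Cs \<delta>) \<gamma> x \<in> Lv \<gamma> \<and>
    (\<forall>\<gamma>\<^sub>1\<in>Cs \<delta>. \<gamma>\<^sub>0 \<le> \<gamma>\<^sub>1 \<longrightarrow> \<gamma>\<^sub>1 \<le> \<gamma> \<longrightarrow> Wk (Cs \<delta>) \<gamma> x |` {..<\<gamma>\<^sub>1} = Wk (Cs \<delta>) \<gamma>\<^sub>1 x)"
proof (induction \<gamma> rule: less_induct)
  case (less \<gamma>)
  let ?W = "Wk (Cs \<delta>)"
  have level_ok: "\<beta> \<in> Cs \<delta> \<Longrightarrow> level_ok \<beta>" for \<beta> using IH Cs_less by blast
  have domx: "dom x = {..<\<gamma>\<^sub>0}" using level_ok_dom[OF level_ok[OF \<gamma>0] x] .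
  note ih = less.IH
  show ?case
  proof (cases "\<gamma> = \<gamma>\<^sub>0")
    case True
    have "?W \<gamma>\<^sub>0 x = x" using domx by (intro Wk_id) auto
    then show ?thesis
      using True x domx restrict_id[of x "{..<\<gamma>\<^sub>0}"] by (auto dest: order_antisym)
  next
    case False
    then have lt: "\<gamma>\<^sub>0 < \<gamma>" using less.prems by simp
    then have nd: "\<not> {..<\<gamma>} \<subseteq> dom x" using domx by auto
    have "\<gamma> \<le> \<delta>" using Cs_less[OF less.prems(1)] by simp
    then consider \<beta> where "\<gamma>\<^sub>0 \<le> \<beta>" "gap (Cs \<delta>) \<beta> \<gamma>" | "unbd (Cs \<delta>) \<gamma>"
      using gap_or_unbd[OF Cs_closed \<gamma>0 lt] by blast
    then show ?thesis
    proof cases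
      case (1 \<beta>)
      then have \<beta>: "\<beta> \<in> Cs \<delta>" "\<beta> < \<gamma>" unfolding gap_def by auto
      note ih = ih[OF \<beta>(2,1) 1(1)]
      define w where "w = supb (Cs \<delta>) \<beta>"
      define y where "y = ?W \<beta> x"
      have y: "y \<in> Lv \<beta>" using ih unfolding y_def by simp
      define y' where "y' = y(\<beta> \<mapsto> h w)"
      have y': "y' \<in> Lv (suc \<beta>)" unfolding y'_def w_def by (rule supb_Lv[OF y])
      have good: "good Lv \<beta> \<gamma> (st (Cs \<delta>) \<beta> \<gamma>)"
        by (rule step_good[OF level_ok[OF less.prems(1)] \<beta>(2)])
      have eq: "?W \<gamma> x = st (Cs \<delta>) \<beta> \<gamma> y'"
        using Wk_gap[OF 1(2) nd] unfolding y'_def y_def w_def .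
      have mem: "?W \<gamma> x \<in> Lv \<gamma>" unfolding eq by (rule good_in[OF good y'])
      have domy: "dom y = {..<\<beta>}" using level_ok_dom[OF level_ok[OF \<beta>(1)] y] .
      have res: "?W \<gamma> x |` {..<\<beta>} = y"
      proof -
        have "?W \<gamma> x |` {..<\<beta>} = (?W \<gamma> x |` {..<suc \<beta>}) |` {..<\<beta>}"
          by (simp only: restrict_restrict_le[OF order_less_imp_le[OF suc_gt]])
        also have "\<dots> = y' |` {..<\<beta>}" unfolding eq good_restrict[OF good y'] ..
        also have "\<dots> = y" unfolding y'_def by (rule restrict_upd[OF y domy])
        finally show ?thesis .
      qed
      have "?W \<gamma> x |` {..<\<gamma>\<^sub>1} = ?W \<gamma>\<^sub>1 x" if \<gamma>1: "\<gamma>\<^sub>1 \<in> Cs \<delta>" "\<gamma>\<^sub>0 \<le> \<gamma>\<^sub>1" "\<gamma>\<^sub>1 \<le> \<gamma>" for \<gamma>\<^sub>1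
      proof (cases "\<gamma>\<^sub>1 = \<gamma>")
        case True
        then show ?thesis using restrict_id[of "?W \<gamma> x" "{..<\<gamma>}"] level_ok_dom[OF level_ok[OF less.prems(1)] mem] by simp
      next
        case False
        then have le: "\<gamma>\<^sub>1 \<le> \<beta>" using \<gamma>1 1(2) unfolding gap_iff by auto
        have "?W \<gamma> x |` {..<\<gamma>\<^sub>1} = (?W \<gamma> x |` {..<\<beta>}) |` {..<\<gamma>\<^sub>1}"
          by (simp only: restrict_restrict_le[OF le])
        also have "\<dots> = ?W \<gamma>\<^sub>1 x" unfolding res y_def using ih \<gamma>1 le by blast
        finally show ?thesis .
      qed
      with mem show ?thesis by blast
    next
      case 2
      have coh: "dom (?W \<beta> x) = {..<\<beta>} \<and> ?W \<beta> x |` {..<\<beta>'} = ?W \<beta>' x"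
        if "\<beta> \<in> Cs \<delta>" "\<beta>' \<in> Cs \<delta>" "\<gamma>\<^sub>0 \<le> \<beta>'" "\<beta>' \<le> \<beta>" "\<beta> < \<gamma>" for \<beta> \<beta>'
      proof -
        have "\<gamma>\<^sub>0 \<le> \<beta>" using that by simp
        from ih[OF that(5,1) this] show ?thesis
          using that level_ok_dom[OF level_ok[OF that(1)]] by blast
      qed
      note lim = walk_limit[OF 2 \<gamma>0 lt domx coh]
      have "?W \<gamma> x = Wk (Cs \<gamma>) \<gamma> x"
        using walk_cong[of "Cs \<delta>" \<gamma> "Cs \<gamma>" Lv Lv] Cs_acc(1)[OF less.prems(1) 2 lt] by auto
      moreover have "\<gamma>\<^sub>0 \<in> Cs \<gamma>" using Cs_acc(1)[OF less.prems(1) 2 lt] \<gamma>0 lt by simp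
      ultimately have mem: "?W \<gamma> x \<in> Lv \<gamma>"
        unfolding Lv_lim[OF Cs_acc(2)[OF less.prems(1) 2 lt]] using x by blast
      have "?W \<gamma> x |` {..<\<gamma>\<^sub>1} = ?W \<gamma>\<^sub>1 x" if \<gamma>1: "\<gamma>\<^sub>1 \<in> Cs \<delta>" "\<gamma>\<^sub>0 \<le> \<gamma>\<^sub>1" "\<gamma>\<^sub>1 \<le> \<gamma>" for \<gamma>\<^sub>1
      proof (cases "\<gamma>\<^sub>1 = \<gamma>")
        case True
        then show ?thesis using restrict_id[of "?W \<gamma> x" "{..<\<gamma>}"] level_ok_dom[OF level_ok[OF less.prems(1)] mem] by simp
      next
        case False
        then show ?thesis using lim(1)[of \<gamma>\<^sub>1] \<gamma>1 by simp
      qed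
      with mem show ?thesis by blast
    qed
  qed
qed

text \<open>The starting node need not be recorded: a walk extends its start, so the start is the
  restriction of \<open>z\<close>.\<close>

definition walks_from :: "'k \<Rightarrow> ('k \<rightharpoonup> 'h) \<Rightarrow> 'k \<Rightarrow> bool" where
  "walks_from \<delta> z \<gamma>\<^sub>0 \<longleftrightarrow> \<gamma>\<^sub>0 \<in> Cs \<delta> \<and> z |` {..<\<gamma>\<^sub>0} \<in> Lv \<gamma>\<^sub>0 \<and> z = Wk (Cs \<delta>) \<delta> (z |` {..<\<gamma>\<^sub>0})"

section \<open>Walks up to a limit level\<close>

context
  fixes \<delta> :: 'k
  assumes IH: "\<forall>\<gamma><\<delta>. level_ok \<gamma>" and lim: "is_lim \<delta>"
begin

lemma walk_mem:
  "\<gamma>\<^sub>0 \<in> Cs \<delta> \<Longrightarrow> x \<in> Lv \<gamma>\<^sub>0 \<Longrightarrow> \<gamma> \<in> Cs \<delta> \<Longrightarrow> \<gamma>\<^sub>0 \<le> \<gamma> \<Longrightarrow> Wk (Cs \<delta>) \<gamma> x \<in> Lv \<gamma>"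
  using walk_in[OF IH] by blast

lemma walk_coh:
  assumes \<gamma>0: "\<gamma>\<^sub>0 \<in> Cs \<delta>" and x: "x \<in> Lv \<gamma>\<^sub>0"
  shows "\<And>\<beta> \<beta>'. \<beta> \<in> Cs \<delta> \<Longrightarrow> \<beta>' \<in> Cs \<delta> \<Longrightarrow> \<gamma>\<^sub>0 \<le> \<beta>' \<Longrightarrow> \<beta>' \<le> \<beta> \<Longrightarrow>
      dom (Wk (Cs \<delta>) \<beta> x) = {..<\<beta>} \<and> Wk (Cs \<delta>) \<beta> x |` {..<\<beta>'} = Wk (Cs \<delta>) \<beta>' x"
proof -
  fix \<beta> \<beta>' assume *: "\<beta> \<in> Cs \<delta>" "\<beta>' \<in> Cs \<delta>" "\<gamma>\<^sub>0 \<le> \<beta>'" "\<beta>' \<le> \<beta>"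
  then have "\<gamma>\<^sub>0 \<le> \<beta>" by simp
  from walk_in[OF IH \<gamma>0 x *(1) this]
  show "dom (Wk (Cs \<delta>) \<beta> x) = {..<\<beta>} \<and> Wk (Cs \<delta>) \<beta> x |` {..<\<beta>'} = Wk (Cs \<delta>) \<beta>' x"
    using * level_ok_dom[OF IH[rule_format, OF Cs_less[OF *(1)]]] by blast
qed

lemma walk_top_dom: "\<gamma>\<^sub>0 \<in> Cs \<delta> \<Longrightarrow> x \<in> Lv \<gamma>\<^sub>0 \<Longrightarrow> dom (Wk (Cs \<delta>) \<delta> x) = {..<\<delta>}"
  by (rule walk_limit_dom[OF unbd_Cs[OF lim] _ _ level_ok_dom[OF IH[rule_format]]])
    (assumption | rule Cs_less walk_coh)+

lemma walk_top_restrict: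
  "\<gamma>\<^sub>0 \<in> Cs \<delta> \<Longrightarrow> x \<in> Lv \<gamma>\<^sub>0 \<Longrightarrow> \<gamma> \<in> Cs \<delta> \<Longrightarrow> \<gamma>\<^sub>0 \<le> \<gamma> \<Longrightarrow> Wk (Cs \<delta>) \<delta> x |` {..<\<gamma>} = Wk (Cs \<delta>) \<gamma> x"
  by (rule walk_limit_restrict[OF unbd_Cs[OF lim] _ _ level_ok_dom[OF IH[rule_format]]])
    (assumption | rule Cs_less walk_coh)+

text \<open>Each move depends on the ladder and on the current node, not on where the walk began. So
  a walk interrupted at a ladder point and restarted there continues as before.\<close>

lemma walk_trans:
  assumes \<gamma>0: "\<gamma>\<^sub>0 \<in> Cs \<delta>" and x: "x \<in> Lv \<gamma>\<^sub>0" and \<gamma>1: "\<gamma>\<^sub>1 \<in> Cs \<delta>" "\<gamma>\<^sub>0 \<le> \<gamma>\<^sub>1"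
  shows "\<gamma> \<in> Cs \<delta> \<or> \<gamma> = \<delta> \<Longrightarrow> \<gamma>\<^sub>1 \<le> \<gamma> \<Longrightarrow> Wk (Cs \<delta>) \<gamma> (Wk (Cs \<delta>) \<gamma>\<^sub>1 x) = Wk (Cs \<delta>) \<gamma> x"
proof (induction \<gamma> rule: less_induct)
  case (less \<gamma>)
  let ?W = "Wk (Cs \<delta>)"
  have domx: "dom x = {..<\<gamma>\<^sub>0}" using level_ok_dom[OF IH[rule_format, OF Cs_less[OF \<gamma>0]] x] .
  have dom1: "dom (?W \<gamma>\<^sub>1 x) = {..<\<gamma>\<^sub>1}" using walk_coh[OF \<gamma>0 x \<gamma>1(1) \<gamma>1(1)] \<gamma>1(2) by simp
  show ?case
  proof (cases "\<gamma>\<^sub>1 = \<gamma>")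
    case True
    have "?W \<gamma>\<^sub>1 (?W \<gamma>\<^sub>1 x) = ?W \<gamma>\<^sub>1 x" using dom1 by (intro Wk_id) auto
    then show ?thesis using True by simp
  next
    case False
    then have lt: "\<gamma>\<^sub>1 < \<gamma>" using less.prems by simp
    have nd: "\<not> {..<\<gamma>} \<subseteq> dom x" "\<not> {..<\<gamma>} \<subseteq> dom (?W \<gamma>\<^sub>1 x)" using domx dom1 \<gamma>1 lt by auto
    have "\<gamma> \<le> \<delta>" using less.prems(1) Cs_less[of \<gamma> \<delta>] order_less_imp_le by blast
    then consider \<beta> where "\<gamma>\<^sub>1 \<le> \<beta>" "gap (Cs \<delta>) \<beta> \<gamma>" | "unbd (Cs \<delta>) \<gamma>"
      using gap_or_unbd[OF Cs_closed \<gamma>1(1) lt] by blast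
    then show ?thesis
    proof cases
      case (1 \<beta>)
      then have "?W \<beta> (?W \<gamma>\<^sub>1 x) = ?W \<beta> x"
        using less.IH[of \<beta>] unfolding gap_def by blast
      then show ?thesis unfolding Wk_gap[OF 1(2) nd(1)] Wk_gap[OF 1(2) nd(2)] by simp
    next
      case 2
      show ?thesis
      proof (rule ext)
        fix \<xi>
        let ?P = "\<lambda>\<beta>. \<beta> \<in> Cs \<delta> \<and> \<xi> < \<beta> \<and> \<beta> < \<gamma>"
        show "?W \<gamma> (?W \<gamma>\<^sub>1 x) \<xi> = ?W \<gamma> x \<xi>"
        proof (cases "\<exists>\<beta>. ?P \<beta>")
          case True
          define \<beta> where "\<beta> = (LEAST \<beta>. ?P \<beta>)"
          have \<beta>: "?P \<beta>" unfolding \<beta>_def using True by (rule LeastI_ex)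
          have "?W \<beta> (?W \<gamma>\<^sub>1 x) \<xi> = ?W \<beta> x \<xi>"
          proof (cases "\<gamma>\<^sub>1 \<le> \<beta>")
            case True
            then show ?thesis using less.IH[of \<beta>] \<beta> by auto
          next
            case f1: False
            then have "?W \<beta> (?W \<gamma>\<^sub>1 x) = ?W \<gamma>\<^sub>1 x" using dom1 by (intro Wk_id) auto
            moreover have "?W \<beta> x \<xi> = ?W \<gamma>\<^sub>1 x \<xi>"
            proof (cases "\<gamma>\<^sub>0 \<le> \<beta>")
              case True
              then have "?W \<gamma>\<^sub>1 x |` {..<\<beta>} = ?W \<beta> x"
                using walk_coh[OF \<gamma>0 x \<gamma>1(1), of \<beta>] f1 \<beta> by auto
              then show ?thesis using restrict_apply[of "?W \<gamma>\<^sub>1 x" \<beta> _ \<xi>] \<beta> by simp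
            next
              case False
              then have "?W \<beta> x = x" "?W \<gamma>\<^sub>0 x = x" using domx by (auto intro!: Wk_id)
              moreover have "?W \<gamma>\<^sub>1 x |` {..<\<gamma>\<^sub>0} = ?W \<gamma>\<^sub>0 x"
                using walk_coh[OF \<gamma>0 x \<gamma>1(1) \<gamma>0] \<gamma>1 by simp
              ultimately show ?thesis
                using restrict_apply[of "?W \<gamma>\<^sub>1 x" \<gamma>\<^sub>0 _ \<xi>] \<beta> False by auto
            qed
            ultimately show ?thesis by simp
          qed
          then show ?thesis
            using Wk_unbd[OF 2 nd(1), of \<xi>] Wk_unbd[OF 2 nd(2), of \<xi>] True unfolding \<beta>_def by presburger
        next
          case False
          then show ?thesis
            using Wk_unbd[OF 2 nd(1), of \<xi>] Wk_unbd[OF 2 nd(2), of \<xi>] by (simp only: if_False)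
        qed
      qed
    qed
  qed
qed

lemma walks_from_walk:
  assumes "\<gamma>\<^sub>0 \<in> Cs \<delta>" "x \<in> Lv \<gamma>\<^sub>0"
  shows "walks_from \<delta> (Wk (Cs \<delta>) \<delta> x) \<gamma>\<^sub>0" "Wk (Cs \<delta>) \<delta> x |` {..<\<gamma>\<^sub>0} = x"
proof -
  have "Wk (Cs \<delta>) \<gamma>\<^sub>0 x = x"
    using level_ok_dom[OF IH[rule_format, OF Cs_less[OF assms(1)]] assms(2)] by (intro Wk_id) auto
  then show "Wk (Cs \<delta>) \<delta> x |` {..<\<gamma>\<^sub>0} = x"
    using walk_top_restrict[OF assms assms(1)] by simp
  then show "walks_from \<delta> (Wk (Cs \<delta>) \<delta> x) \<gamma>\<^sub>0"
    unfolding walks_from_def using assms by simp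
qed

text \<open>Starting levels can be moved up along the ladder. This lets finitely many walks share
  one starting level.\<close>

lemma walks_from_mono:
  assumes z: "walks_from \<delta> z \<gamma>\<^sub>0" and \<gamma>: "\<gamma> \<in> Cs \<delta>" "\<gamma>\<^sub>0 \<le> \<gamma>"
  shows "walks_from \<delta> z \<gamma>"
proof -
  from z have 0: "\<gamma>\<^sub>0 \<in> Cs \<delta>" "z |` {..<\<gamma>\<^sub>0} \<in> Lv \<gamma>\<^sub>0" and eq: "z = Wk (Cs \<delta>) \<delta> (z |` {..<\<gamma>\<^sub>0})"
    unfolding walks_from_def by blast+
  have r: "z |` {..<\<gamma>} = Wk (Cs \<delta>) \<gamma> (z |` {..<\<gamma>\<^sub>0})"
    using walk_top_restrict[OF 0 \<gamma>] eq by simp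
  have "\<gamma> \<le> \<delta>" using Cs_less[OF \<gamma>(1)] by simp
  then have "z = Wk (Cs \<delta>) \<delta> (z |` {..<\<gamma>})"
    unfolding r using walk_trans[OF 0 \<gamma>, of \<delta>] eq by simp
  moreover have "z |` {..<\<gamma>} \<in> Lv \<gamma>" unfolding r by (rule walk_mem[OF 0 \<gamma>])
  ultimately show ?thesis unfolding walks_from_def using \<gamma> by simp
qed

lemma Lv_walks_from: "z \<in> Lv \<delta> \<longleftrightarrow> (\<exists>\<gamma>\<^sub>0. walks_from \<delta> z \<gamma>\<^sub>0)"
proof
  assume "z \<in> Lv \<delta>"
  then show "\<exists>\<gamma>\<^sub>0. walks_from \<delta> z \<gamma>\<^sub>0"
    unfolding Lv_lim[OF lim] using walks_from_walk by blast
next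
  assume "\<exists>\<gamma>\<^sub>0. walks_from \<delta> z \<gamma>\<^sub>0"
  then show "z \<in> Lv \<delta>"
    unfolding Lv_lim[OF lim] walks_from_def by blast
qed

lemma walks_from_step:
  assumes z: "walks_from \<delta> z \<gamma>\<^sub>0" and g: "gap (Cs \<delta>) \<zeta> \<gamma>" and \<gamma>: "\<gamma> \<in> Cs \<delta>" and le: "\<gamma>\<^sub>0 \<le> \<zeta>"
  shows "z |` {..<suc \<zeta>} = (z |` {..<\<zeta>})(\<zeta> \<mapsto> h (supb (Cs \<delta>) \<zeta>))"
    and "z |` {..<suc \<zeta>} \<in> Lv (suc \<zeta>)"
    and "z |` {..<\<gamma>} = st (Cs \<delta>) \<zeta> \<gamma> (z |` {..<suc \<zeta>})"
    and "z |` {..<\<zeta>} = Wk (Cs \<delta>) \<zeta> (z |` {..<\<gamma>\<^sub>0})"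
    and "good Lv \<zeta> \<gamma> (st (Cs \<delta>) \<zeta> \<gamma>)"
proof -
  from z have 0: "\<gamma>\<^sub>0 \<in> Cs \<delta>" "z |` {..<\<gamma>\<^sub>0} \<in> Lv \<gamma>\<^sub>0" and eq: "z = Wk (Cs \<delta>) \<delta> (z |` {..<\<gamma>\<^sub>0})"
    unfolding walks_from_def by blast+
  have \<zeta>: "\<zeta> \<in> Cs \<delta>" "\<zeta> < \<gamma>" using g unfolding gap_def by auto
  let ?x = "z |` {..<\<gamma>\<^sub>0}"
  show r: "z |` {..<\<zeta>} = Wk (Cs \<delta>) \<zeta> ?x"
    using walk_top_restrict[OF 0 \<zeta>(1) le] eq by simp
  have nd: "\<not> {..<\<gamma>} \<subseteq> dom ?x" using le \<zeta> by auto
  let ?y = "(z |` {..<\<zeta>})(\<zeta> \<mapsto> h (supb (Cs \<delta>) \<zeta>))"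
  have "\<gamma>\<^sub>0 \<le> \<gamma>" using le \<zeta> by simp
  then have r': "z |` {..<\<gamma>} = st (Cs \<delta>) \<zeta> \<gamma> ?y"
    using walk_top_restrict[OF 0 \<gamma>] eq Wk_gap[OF g nd] r by simp
  show good: "good Lv \<zeta> \<gamma> (st (Cs \<delta>) \<zeta> \<gamma>)"
    by (rule step_good[OF IH[rule_format, OF Cs_less[OF \<gamma>]] \<zeta>(2)])
  have y: "?y \<in> Lv (suc \<zeta>)"
    using supb_Lv[OF walk_mem[OF 0 \<zeta>(1) le]] unfolding r .
  have "z |` {..<suc \<zeta>} = (z |` {..<\<gamma>}) |` {..<suc \<zeta>}"
    using suc_least[OF \<zeta>(2)] by (simp only: restrict_restrict_le)
  also have "\<dots> = ?y" unfolding r' by (rule good_restrict[OF good y])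
  finally show s: "z |` {..<suc \<zeta>} = ?y" .
  show "z |` {..<suc \<zeta>} \<in> Lv (suc \<zeta>)" unfolding s by (rule y)
  show "z |` {..<\<gamma>} = st (Cs \<delta>) \<zeta> \<gamma> (z |` {..<suc \<zeta>})" unfolding s by (rule r')
qed

lemma Cs_next:
  assumes "\<zeta> < \<delta>"
  obtains \<gamma> where "\<gamma> \<in> Cs \<delta>" "\<zeta> < \<gamma>" "Cs \<delta> \<inter> {\<zeta><..<\<gamma>} = {}"
proof -
  let ?P = "\<lambda>\<gamma>. \<gamma> \<in> Cs \<delta> \<and> \<zeta> < \<gamma>"
  have "\<exists>\<gamma>. ?P \<gamma>" using unbd_Cs[OF lim] assms unfolding unbd_def by blast
  then have "?P (LEAST \<gamma>. ?P \<gamma>)" by (rule LeastI_ex)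
  moreover have "Cs \<delta> \<inter> {\<zeta><..<(LEAST \<gamma>. ?P \<gamma>)} = {}"
    using not_less_Least[of _ ?P] by auto
  ultimately show ?thesis using that by blast
qed

lemma walks_from_mark:
  assumes z: "walks_from \<delta> z \<gamma>\<^sub>0" and \<zeta>: "\<zeta> \<in> Cs \<delta>" "\<gamma>\<^sub>0 \<le> \<zeta>"
  shows "z \<zeta> = Some (h (supb (Cs \<delta>) \<zeta>))"
proof -
  obtain \<gamma> where \<gamma>: "\<gamma> \<in> Cs \<delta>" "\<zeta> < \<gamma>" "Cs \<delta> \<inter> {\<zeta><..<\<gamma>} = {}"
    using Cs_next[OF Cs_less[OF \<zeta>(1)]] .
  then have "gap (Cs \<delta>) \<zeta> \<gamma>" using \<zeta> unfolding gap_def by simp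
  from walks_from_step(1)[OF z this \<gamma>(1) \<zeta>(2)] have "(z |` {..<suc \<zeta>}) \<zeta> = Some (h (supb (Cs \<delta>) \<zeta>))"
    by simp
  then show ?thesis using suc_gt[of \<zeta>] by simp
qed

text \<open>Closedness keeps \<xi> from being a limit of the ladder, so there is a last ladder point
  below \<xi>; with the next one above \<xi> it encloses \<xi> in a jump.\<close>

lemma Cs_around:
  assumes "\<gamma>\<^sub>0 \<in> Cs \<delta>" "\<gamma>\<^sub>0 \<le> \<xi>" "\<xi> < \<delta>" "\<xi> \<notin> Cs \<delta>"
  obtains \<zeta> \<gamma> where "gap (Cs \<delta>) \<zeta> \<gamma>" "\<gamma>\<^sub>0 \<le> \<zeta>" "\<zeta> < \<xi>" "\<xi> < \<gamma>" "\<gamma> \<in> Cs \<delta>"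
proof -
  have lt: "\<gamma>\<^sub>0 < \<xi>" using assms by (auto simp: order_le_less)
  have "\<xi> \<le> \<delta>" using assms by simp
  moreover have "\<not> unbd (Cs \<delta>) \<xi>"
  proof
    assume "unbd (Cs \<delta>) \<xi>"
    moreover have "positive \<xi>" using lt unfolding positive_def by blast
    ultimately show False
      using Cs_closed[of \<delta>] unbd_sup_is assms(3,4) unfolding closed_below_def by blast
  qed
  ultimately obtain \<zeta> where \<zeta>: "\<gamma>\<^sub>0 \<le> \<zeta>" "gap (Cs \<delta>) \<zeta> \<xi>"
    using gap_or_unbd[OF Cs_closed assms(1) lt] by blast
  obtain \<gamma> where \<gamma>: "\<gamma> \<in> Cs \<delta>" "\<xi> < \<gamma>" "Cs \<delta> \<inter> {\<xi><..<\<gamma>} = {}"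
    using Cs_next[OF assms(3)] .
  have "gap (Cs \<delta>) \<zeta> \<gamma>"
    unfolding gap_def
  proof (intro conjI)
    show "Cs \<delta> \<inter> {\<zeta><..<\<gamma>} = {}"
    proof (rule ccontr)
      assume "Cs \<delta> \<inter> {\<zeta><..<\<gamma>} \<noteq> {}"
      then obtain c where c: "c \<in> Cs \<delta>" "\<zeta> < c" "c < \<gamma>" by auto
      consider "c < \<xi>" | "c = \<xi>" | "\<xi> < c" by (rule linorder_cases)
      then show False
        using c \<zeta>(2) \<gamma>(3) assms(4) unfolding gap_def by cases auto
    qed
  qed (use \<zeta> \<gamma> in \<open>auto simp: gap_def\<close>)
  then show ?thesis using that \<zeta> \<gamma> unfolding gap_def by blast
qed

end


section \<open>Every level satisfies the invariant\<close>

lemma level_ok_0: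
  assumes "\<not> positive \<delta>"
  shows "level_ok \<delta>"
proof -
  have no: "\<not> \<beta> < \<delta>" for \<beta> using assms unfolding positive_def by blast
  then have "\<gamma> = \<delta>" if "\<gamma> \<le> \<delta>" for \<gamma> using that by (simp add: order_le_less)
  moreover have "{..<\<delta>} = {}" using no by auto
  ultimately show ?thesis
    unfolding level_ok_def Lv_0[OF assms] using no Lv_0[OF assms] by (auto intro!: small_finite[OF inf])
qed

lemma card_image_le_trans: "finite U \<Longrightarrow> card U \<le> n \<Longrightarrow> S \<subseteq> f ` U \<Longrightarrow> finite S \<and> card S \<le> n"
  by (meson card_image_le card_mono finite_imageI finite_subset le_trans)

text \<open>Outside the prescribed nodes the new position \<epsilon> receives the value
  \<open>h \<epsilon>\<close>. As \<beta> < \<epsilon> this is not an old mark, so only the at most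
  \<open>n\<close> prescribed nodes can show an old mark there; at earlier positions the promise is
  inherited from level \<epsilon>.\<close>

lemma suc_extend:
  assumes level_ok: "level_ok \<epsilon>" and \<beta>: "\<beta> < suc \<epsilon>"
    and U: "U \<subseteq> Lv (suc \<epsilon>)" "finite U" "card U \<le> n" "inj_on (\<lambda>u. u |` {..<suc \<beta>}) U"
    and dom: "\<And>x. x \<in> Lv (suc \<epsilon>) \<Longrightarrow> dom x = {..<suc \<epsilon>}"
    and res: "\<And>x. x \<in> Lv (suc \<epsilon>) \<Longrightarrow> x |` {..<\<epsilon>} \<in> Lv \<epsilon>"
  shows "\<exists>e. good Lv \<beta> (suc \<epsilon>) e \<and> (\<forall>u\<in>U. e (u |` {..<suc \<beta>}) = u)"
proof (cases "\<beta> = \<epsilon>")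
  case True
  \<comment> \<open>No position lies in the half-open interval from \<open>suc \<epsilon>\<close> to
    \<open>suc \<epsilon>\<close>, so the identity keeps the promise vacuously.\<close>
  have id: "x |` {..<suc \<epsilon>} = x" if "x \<in> Lv (suc \<epsilon>)" for x
    using dom[OF that] by (intro restrict_id) simp
  then have "good Lv \<epsilon> (suc \<epsilon>) (\<lambda>x. x)"
    unfolding good_def by auto
  then show ?thesis using id U(1) True by (intro exI[of _ "\<lambda>x. x"]) auto
next
  case False
  with \<beta> have lt: "\<beta> < \<epsilon>" by (simp add: less_suc_iff)
  then have le: "suc \<beta> \<le> \<epsilon>" by (rule suc_least)
  let ?r = "\<lambda>u. u |` {..<suc \<beta>}" and ?s = "\<lambda>u. u |` {..<\<epsilon>}"
  have rs: "?r (?s u) = ?r u" for u :: "'k \<rightharpoonup> 'h" by (rule restrict_restrict_le[OF le])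
  obtain e' where e': "good Lv \<beta> \<epsilon> e'" "\<And>u. u \<in> ?s ` U \<Longrightarrow> e' (?r u) = u"
  proof (rule level_ok_extend[OF level_ok lt, of "?s ` U"])
    show "?s ` U \<subseteq> Lv \<epsilon>" using res U(1) by blast
    show "finite (?s ` U)" using U(2) by simp
    show "card (?s ` U) \<le> n" using card_image_le[OF U(2), of ?s] U(3) by simp
    show "inj_on ?r (?s ` U)" using U(4) unfolding inj_on_def by (auto simp: rs simp del: restrict_restrict)
  qed blast
  define e where "e x = (if x \<in> ?r ` U then inv_into U ?r x else (e' x)(\<epsilon> \<mapsto> h \<epsilon>))" for x
  have eU: "e (?r u) = u" if "u \<in> U" for u
    unfolding e_def using that inv_into_f_f[OF U(4) that] by simp
  have es: "?s (e x) = e' x" and mem: "e x \<in> Lv (suc \<epsilon>)" if x: "x \<in> Lv (suc \<beta>)" for x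
  proof -
    note ex = good_in[OF e'(1) x]
    have "?s (e x) = e' x \<and> e x \<in> Lv (suc \<epsilon>)"
    proof (cases "x \<in> ?r ` U")
      case True
      then obtain u where u: "u \<in> U" "x = ?r u" by blast
      have "?s (e x) = ?s u" unfolding u(2) eU[OF u(1)] ..
      also have "\<dots> = e' (?r (?s u))" using e'(2)[of "?s u"] u(1) by simp
      also have "\<dots> = e' x" unfolding rs u(2) ..
      finally show ?thesis using eU[OF u(1)] u U(1) by auto
    next
      case False
      then have e: "e x = (e' x)(\<epsilon> \<mapsto> h \<epsilon>)" unfolding e_def by simp
      show ?thesis unfolding e
        using restrict_upd[OF ex level_ok_dom[OF level_ok ex]] Lv_sucI[OF ex, of \<epsilon>] by simp
    qed
    then show "?s (e x) = e' x" "e x \<in> Lv (suc \<epsilon>)" by auto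
  qed
  have "good Lv \<beta> (suc \<epsilon>) e"
    unfolding good_def
  proof (intro conjI ballI allI impI)
    fix x assume x: "x \<in> Lv (suc \<beta>)"
    show "e x \<in> Lv (suc \<epsilon>)" by (rule mem[OF x])
    have "?r (e x) = ?r (?s (e x))" by (rule rs[symmetric])
    also have "\<dots> = x" unfolding es[OF x] by (rule good_restrict[OF e'(1) x])
    finally show "?r (e x) = x" .
  next
    fix \<xi> \<iota> S
    assume \<xi>: "suc \<beta> \<le> \<xi>" "\<xi> < suc \<epsilon>" and \<iota>: "\<iota> \<le> \<beta>" and S: "S \<subseteq> Lv (suc \<beta>)" "\<forall>x\<in>S. e x \<xi> = Some (h \<iota>)"
    have "finite S \<and> card S \<le> n"
    proof (cases "\<xi> = \<epsilon>")
      case True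
      have "S \<subseteq> ?r ` U"
      proof
        fix x assume x: "x \<in> S"
        show "x \<in> ?r ` U"
        proof (rule ccontr)
          assume "x \<notin> ?r ` U"
          then have "e x \<epsilon> = Some (h \<epsilon>)" unfolding e_def by simp
          then have "h \<epsilon> = h \<iota>" using S(2) x True by auto
          then show False using h lt \<iota> by (auto dest: injD)
        qed
      qed
      then show ?thesis by (rule card_image_le_trans[OF U(2,3)])
    next
      case False
      then have \<xi>': "\<xi> < \<epsilon>" using \<xi>(2) by (simp add: less_suc_iff)
      have "e' x \<xi> = Some (h \<iota>)" if "x \<in> S" for x
        using restrict_apply[OF es \<xi>', of x] S that by auto
      then show ?thesis by (rule good_card[OF e'(1) \<xi>(1) \<xi>' \<iota> S(1)])
    qed
    then show "finite S" "card S \<le> n" by blast+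
  qed
  then show ?thesis using eU by blast
qed

lemma level_ok_suc:
  assumes level_ok: "level_ok \<epsilon>"
  shows "level_ok (suc \<epsilon>)"
proof -
  have dom: "dom x = {..<suc \<epsilon>}" and res: "x |` {..<\<epsilon>} \<in> Lv \<epsilon>" if "x \<in> Lv (suc \<epsilon>)" for x
  proof -
    from that obtain y \<iota> where y: "y \<in> Lv \<epsilon>" "x = y(\<epsilon> \<mapsto> h \<iota>)"
      unfolding Lv_suc by blast
    show "dom x = {..<suc \<epsilon>}" using y level_ok_dom[OF level_ok y(1)] by (simp add: lessThan_suc)
    show "x |` {..<\<epsilon>} \<in> Lv \<epsilon>" unfolding y(2) restrict_upd[OF y(1) level_ok_dom[OF level_ok y(1)]] by (rule y(1))
  qed
  have "x |` {..<\<gamma>} \<in> Lv \<gamma>" if x: "x \<in> Lv (suc \<epsilon>)" and \<gamma>: "\<gamma> \<le> suc \<epsilon>" for x \<gamma>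
  proof (cases "\<gamma> = suc \<epsilon>")
    case True
    then show ?thesis using x restrict_id[of x "{..<suc \<epsilon>}"] dom[OF x] by simp
  next
    case False
    then have le: "\<gamma> \<le> \<epsilon>" using \<gamma> False less_suc_iff[of \<gamma> \<epsilon>] order.not_eq_order_implies_strict by blast
    show ?thesis
      using level_ok_restrict[OF level_ok res[OF x] le] unfolding restrict_restrict_le[OF le] .
  qed
  moreover have "sm (Lv (suc \<epsilon>))"
  proof -
    have "Lv (suc \<epsilon>) = (\<lambda>(x, \<iota>). x(\<epsilon> \<mapsto> h \<iota>)) ` (Lv \<epsilon> \<times> {..\<epsilon>})"
      unfolding Lv_suc by auto
    moreover have "sm \<dots>" by (rule small_image[OF small_Sigma[OF inf level_ok_sm[OF level_ok] seg_le]])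
    ultimately show ?thesis by simp
  qed
  ultimately show ?thesis
    unfolding level_ok_def
    by (intro conjI ballI allI impI)
      (simp only: dom, simp only:, assumption, rule suc_extend[OF level_ok _ _ _ _ _ dom res])
qed

text \<open>To pass through the prescribed nodes, use the invariant at a ladder level \<gamma> above
  the starting levels of all of them, and walk on from there; the walks of their restrictions to
  \<gamma> are the prescribed nodes again. The promise must be checked below \<gamma>, at later
  ladder points, and inside later jumps.\<close>

lemma level_ok_lim:
  assumes lim: "is_lim \<delta>" and IH: "\<forall>\<gamma><\<delta>. level_ok \<gamma>"
  shows "level_ok \<delta>"
proof -
  let ?w = "walks_from \<delta>"
  note Lv_wf = Lv_walks_from[OF IH lim]
  have beyond: "\<exists>\<gamma>\<in>Cs \<delta>. \<xi> < \<gamma>" if "\<xi> < \<delta>" for \<xi>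
    using unbd_Cs[OF lim] that unfolding unbd_def by blast
  have dom: "dom z = {..<\<delta>}" if z: "z \<in> Lv \<delta>" for z
  proof -
    obtain \<gamma>\<^sub>0 where "?w z \<gamma>\<^sub>0" using z Lv_wf by blast
    then show ?thesis using walk_top_dom[OF IH lim, of \<gamma>\<^sub>0 "z |` {..<\<gamma>\<^sub>0}"]
      unfolding walks_from_def by simp
  qed
  have res: "z |` {..<\<gamma>} \<in> Lv \<gamma>" if z: "z \<in> Lv \<delta>" and \<gamma>: "\<gamma> \<le> \<delta>" for z \<gamma>
  proof (cases "\<gamma> = \<delta>")
    case True
    then show ?thesis using z restrict_id[of z "{..<\<delta>}"] dom[OF z] by simp
  next
    case False
    then have \<gamma>: "\<gamma> < \<delta>" using \<gamma> by simp
    obtain \<gamma>\<^sub>0 where w: "?w z \<gamma>\<^sub>0" using z Lv_wf by blast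
    then have "\<gamma>\<^sub>0 \<in> Cs \<delta>" unfolding walks_from_def by simp
    then have "max \<gamma>\<^sub>0 \<gamma> < \<delta>" using Cs_less \<gamma> by simp
    then obtain \<gamma>' where \<gamma>': "\<gamma>' \<in> Cs \<delta>" "max \<gamma>\<^sub>0 \<gamma> < \<gamma>'" using beyond by blast
    then have le: "\<gamma> \<le> \<gamma>'" "\<gamma>\<^sub>0 \<le> \<gamma>'" by (simp_all add: order_less_imp_le)
    have "z |` {..<\<gamma>'} \<in> Lv \<gamma>'"
      using walks_from_mono[OF IH lim w \<gamma>'(1) le(2)] unfolding walks_from_def by simp
    from level_ok_restrict[OF IH[rule_format, OF Cs_less[OF \<gamma>'(1)]] this le(1)] show ?thesis
      by (simp only: restrict_restrict_le[OF le(1)])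
  qed
  have sm: "sm (Lv \<delta>)"
  proof -
    have "Lv \<delta> = (\<lambda>(\<gamma>, x). Wk (Cs \<delta>) \<delta> x) ` (Sigma (Cs \<delta>) Lv)"
      unfolding Lv_lim[OF lim] by auto
    moreover have "sm (Sigma (Cs \<delta>) Lv)"
      by (rule small_Sigma[OF inf small_subset[OF seg Cs_sub]]) (rule level_ok_sm[OF IH[rule_format, OF Cs_less]])
    ultimately show ?thesis by (simp add: small_image)
  qed
  have ext: "\<exists>e. good Lv \<beta> \<delta> e \<and> (\<forall>u\<in>U. e (u |` {..<suc \<beta>}) = u)"
    if \<beta>: "\<beta> < \<delta>" and U: "U \<subseteq> Lv \<delta>" "finite U" "card U \<le> n" "inj_on (\<lambda>u. u |` {..<suc \<beta>}) U" for \<beta> U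
  proof -
    let ?r = "\<lambda>u. u |` {..<suc \<beta>}"
    \<comment> \<open>This ladder point will lie strictly between \<beta> and \<gamma>. It forces
      every mark written from \<gamma> on to be at least \<eta>, hence newer than \<beta>.\<close>
    obtain \<eta> where \<eta>: "\<eta> \<in> Cs \<delta>" "\<beta> < \<eta>" using beyond[OF \<beta>] by blast
    have "\<forall>u\<in>U. \<exists>g. ?w u g" using U(1) Lv_wf by blast
    then have "\<exists>g. \<forall>u\<in>U. ?w u (g u)" by (rule bchoice)
    then obtain g where g: "\<And>u. u \<in> U \<Longrightarrow> ?w u (g u)" by blast
    have gC: "g u \<in> Cs \<delta>" if "u \<in> U" for u using g[OF that] unfolding walks_from_def by simp
    define m where "m = Max (insert \<eta> (g ` U))"
    have "m \<in> insert \<eta> (g ` U)" unfolding m_def using U(2) by (intro Max_in) auto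
    then have "m \<in> Cs \<delta>" using gC \<eta> by auto
    then obtain \<gamma> where \<gamma>: "\<gamma> \<in> Cs \<delta>" "m < \<gamma>" using beyond[OF Cs_less] by blast
    have m: "\<eta> \<le> m" "\<And>u. u \<in> U \<Longrightarrow> g u \<le> m" unfolding m_def using U(2) by simp_all
    have \<eta>\<gamma>: "\<eta> < \<gamma>" by (rule order_le_less_trans[OF m(1) \<gamma>(2)])
    have gu: "g u \<le> \<gamma>" if "u \<in> U" for u
      by (rule order_less_imp_le[OF order_le_less_trans[OF m(2)[OF that] \<gamma>(2)]])
    have lt: "\<beta> < \<gamma>" using \<eta> \<eta>\<gamma> by simp
    then have le: "suc \<beta> \<le> \<gamma>" by (rule suc_least)
    let ?s = "\<lambda>u. u |` {..<\<gamma>}"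
    have rs: "?r (?s u) = ?r u" for u :: "'k \<rightharpoonup> 'h" by (rule restrict_restrict_le[OF le])
    have wU: "?w u \<gamma>" if "u \<in> U" for u
      by (rule walks_from_mono[OF IH lim g[OF that] \<gamma>(1) gu[OF that]])
    have level_ok: "level_ok \<gamma>" by (rule IH[rule_format, OF Cs_less[OF \<gamma>(1)]])
    obtain e' where e': "good Lv \<beta> \<gamma> e'" "\<And>u. u \<in> ?s ` U \<Longrightarrow> e' (?r u) = u"
    proof (rule level_ok_extend[OF level_ok lt, of "?s ` U"])
      show "?s ` U \<subseteq> Lv \<gamma>" using wU unfolding walks_from_def by auto
      show "finite (?s ` U)" using U(2) by simp
      show "card (?s ` U) \<le> n" using card_image_le[OF U(2), of ?s] U(3) by simp
      show "inj_on ?r (?s ` U)" using U(4) unfolding inj_on_def by (auto simp: rs simp del: restrict_restrict)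
    qed blast
    define e where "e x = Wk (Cs \<delta>) \<delta> (e' x)" for x
    have es: "?s (e x) = e' x" and w: "?w (e x) \<gamma>" if "x \<in> Lv (suc \<beta>)" for x
      unfolding e_def using walks_from_walk[OF IH lim \<gamma>(1) good_in[OF e'(1) that]] by auto
    have er: "?r (e x) = x" if x: "x \<in> Lv (suc \<beta>)" for x
    proof -
      have "?r (e x) = ?r (?s (e x))" by (rule rs[symmetric])
      also have "\<dots> = x" unfolding es[OF x] by (rule good_restrict[OF e'(1) x])
      finally show ?thesis .
    qed
    have "good Lv \<beta> \<delta> e"
      unfolding good_def
    proof (intro conjI ballI allI impI)
      fix x assume x: "x \<in> Lv (suc \<beta>)"
      show "e x \<in> Lv \<delta>" using w[OF x] Lv_wf by blast
      show "?r (e x) = x" by (rule er[OF x])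
    next
      fix \<xi> \<iota> S
      assume \<xi>: "suc \<beta> \<le> \<xi>" "\<xi> < \<delta>" and \<iota>: "\<iota> \<le> \<beta>" and S: "S \<subseteq> Lv (suc \<beta>)" "\<forall>x\<in>S. e x \<xi> = Some (h \<iota>)"
      have wS: "?w (e x) \<gamma>" if "x \<in> S" for x using w S that by blast
      consider "\<xi> < \<gamma>" | "\<gamma> \<le> \<xi>" "\<xi> \<in> Cs \<delta>" | "\<gamma> \<le> \<xi>" "\<xi> \<notin> Cs \<delta>" using leI[of \<xi> \<gamma>] by blast
      then have "finite S \<and> card S \<le> n"
      proof cases
        case 1
        have "e' x \<xi> = Some (h \<iota>)" if "x \<in> S" for x
          using restrict_apply[OF es 1, of x] S that by auto
        then show ?thesis by (rule good_card[OF e'(1) \<xi>(1) 1 \<iota> S(1)])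
      next
        case 2
        have "S = {}"
        proof (rule ccontr)
          assume "S \<noteq> {}"
          then obtain x where x: "x \<in> S" by blast
          have "Some (h (supb (Cs \<delta>) \<xi>)) = Some (h \<iota>)"
            using walks_from_mark[OF IH lim wS[OF x] 2(2,1)] S(2) x by simp
          then have "supb (Cs \<delta>) \<xi> = \<iota>" using h by (simp add: inj_eq)
          moreover have "\<eta> \<le> supb (Cs \<delta>) \<xi>" using \<eta>(1) \<eta>\<gamma> 2(1) by (intro supb_upper) auto
          ultimately show False using \<iota> \<eta>(2) by simp
        qed
        then show ?thesis by simp
      next
        case 3
        \<comment> \<open>Inside a later jump from \<zeta> the promise of that jump applies, because
          \<iota> \<le> \<beta> < \<zeta>. It bounds the number of nodes at level
          \<open>suc \<zeta>\<close>, and these correspond injectively to \<open>S\<close> since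
          they extend the elements of \<open>S\<close>.\<close>
        obtain \<zeta> \<gamma>' where z: "gap (Cs \<delta>) \<zeta> \<gamma>'" "\<gamma> \<le> \<zeta>" "\<zeta> < \<xi>" "\<xi> < \<gamma>'" "\<gamma>' \<in> Cs \<delta>"
          by (rule Cs_around[OF IH lim \<gamma>(1) 3(1) \<xi>(2) 3(2)])
        let ?f = "\<lambda>x. e x |` {..<suc \<zeta>}"
        note wstep = walks_from_step[OF IH lim wS z(1,5,2)]
        have fS: "?f ` S \<subseteq> Lv (suc \<zeta>)" using wstep(2) by blast
        have val: "st (Cs \<delta>) \<zeta> \<gamma>' y \<xi> = Some (h \<iota>)" if "y \<in> ?f ` S" for y
        proof -
          from that obtain x where x: "x \<in> S" "y = ?f x" by blast
          show ?thesis unfolding x(2)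
            using restrict_apply[OF wstep(3)[OF x(1)] z(4)] S(2) x(1) by simp
        qed
        have \<beta>\<zeta>: "\<beta> < \<zeta>" using lt z(2) by simp
        have \<iota>\<zeta>: "\<iota> \<le> \<zeta>" using \<iota> \<beta>\<zeta> by simp
        have fin: "finite (?f ` S) \<and> card (?f ` S) \<le> n"
        proof (cases "S = {}")
          case False
          then obtain x where "x \<in> S" by blast
          note good = wstep(5)[OF this]
          show ?thesis
            using good_card[OF good suc_least[OF z(3)] z(4) \<iota>\<zeta> fS] val by blast
        qed simp
        have "inj_on ?f S"
        proof (rule inj_onI)
          fix x y assume xy: "x \<in> S" "y \<in> S" "?f x = ?f y"
          have "?r (?f x) = x" if "x \<in> S" for x
          proof -
            have "suc \<beta> \<le> suc \<zeta>" by (rule suc_least[OF order.strict_trans[OF \<beta>\<zeta> suc_gt]])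
            note le = restrict_restrict_le[OF this]
            show ?thesis unfolding le using that S(1) by (intro er) blast
          qed
          from this[OF xy(1)] this[OF xy(2)] show "x = y" unfolding xy(3) by (simp only:)
        qed
        then show ?thesis using fin by (simp add: finite_image_iff card_image)
      qed
      then show "finite S" "card S \<le> n" by blast+
    qed
    moreover have "e (?r u) = u" if "u \<in> U" for u
    proof -
      have "e' (?r u) = ?s u" using e'(2)[of "?s u"] that unfolding rs by simp
      then show ?thesis unfolding e_def using wU[OF that] unfolding walks_from_def by simp
    qed
    ultimately show ?thesis by blast
  qed
  show ?thesis
    unfolding level_ok_def by (intro conjI ballI allI impI; (rule dom res sm ext)?)
qed

theorem level_ok: "level_ok \<delta>"
proof (induction \<delta> rule: less_induct)
  case (less \<delta>)
  show ?case
  proof (cases \<delta> rule: zero_suc_lim)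
    case 1
    then show ?thesis by (rule level_ok_0)
  next
    case (2 \<beta>)
    then show ?thesis using less.IH[of \<beta>] level_ok_suc suc_gt by simp
  next
    case 3
    then show ?thesis using less.IH level_ok_lim by blast
  qed
qed

end

section \<open>Specializing the derived trees\<close>

text \<open>The list records the colours met while iterating \<open>g\<close>, ending with the
  element of \<open>B\<close> that is reached. A relation is used because the iteration terminates
  only for nodes of the tree in question, which is shown separately.\<close>

inductive coloured :: "'x set \<Rightarrow> ('x \<Rightarrow> 'x) \<Rightarrow> ('x \<Rightarrow> 'c) \<Rightarrow> 'x \<Rightarrow> ('x + 'c) list \<Rightarrow> bool"
  for B g k where
  base: "x \<in> B \<Longrightarrow> coloured B g k x [Inl x]"
| step: "x \<notin> B \<Longrightarrow> coloured B g k (g x) cs \<Longrightarrow> coloured B g k x (Inr (k x) # cs)"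

lemma coloured_lists: "coloured B g k x cs \<Longrightarrow> cs \<in> lists (Inl ` B \<union> range Inr)"
  by (induction rule: coloured.induct) auto

lemma map_le_comparable:
  assumes "x \<subseteq>\<^sub>m z" "y \<subseteq>\<^sub>m z" "dom x = {..<\<alpha>}" "dom y = {..<(\<beta>::'k::wellorder)}"
  shows "x \<subseteq>\<^sub>m y \<or> y \<subseteq>\<^sub>m x"
proof (cases "\<alpha> \<le> \<beta>")
  case True
  then have "x \<subseteq>\<^sub>m y" using assms unfolding map_le_def by simp
  then show ?thesis ..
next
  case False
  then have "y \<subseteq>\<^sub>m x" using assms unfolding map_le_def by simp
  then show ?thesis ..
qed

text \<open>Iterating the regressive map \<open>g\<close> leads from a node down into \<open>B\<close> in finitely many
  steps; the finite sequence of colours met on the way is a colouring by antichains.\<close>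

lemma special_by_regression:
  fixes T :: "('k::wellorder \<rightharpoonup> 'v) set" and k :: "('k \<rightharpoonup> 'v) \<Rightarrow> 'c"
  assumes inf: "infinite (UNIV :: 'a set)"
    and dom: "\<And>x. x \<in> T \<Longrightarrow> \<exists>\<alpha>. dom x = {..<\<alpha>}"
    and B: "small TYPE('a) B" and k: "small TYPE('a) (UNIV :: 'c set)"
    and g: "\<And>x. x \<in> T - B \<Longrightarrow> g x \<in> T \<and> g x \<subseteq>\<^sub>m x \<and> g x \<noteq> x"
    and sep: "\<And>x y. x \<in> T - B \<Longrightarrow> y \<in> T - B \<Longrightarrow> x \<subseteq>\<^sub>m y \<Longrightarrow> g x = g y \<Longrightarrow> k x = k y \<Longrightarrow> x = y"
  shows "special TYPE('a) T"
proof -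
  have ex: "\<exists>cs. coloured B g k x cs" if "x \<in> T" "dom x = {..<\<alpha>}" for x \<alpha>
    using that
  proof (induction \<alpha> arbitrary: x rule: less_induct)
    case (less \<alpha>)
    show ?case
    proof (cases "x \<in> B")
      case True
      then show ?thesis by (intro exI[of _ "[Inl x]"] coloured.base)
    next
      case False
      then have gx: "g x \<in> T" "g x \<subseteq>\<^sub>m x" "g x \<noteq> x" using g[of x] less.prems(1) False by simp_all
      obtain \<beta> where \<beta>: "dom (g x) = {..<\<beta>}" using dom[OF gx(1)] by blast
      have "\<not> \<alpha> \<le> \<beta>"
      proof
        assume "\<alpha> \<le> \<beta>"
        then have "dom x \<subseteq> dom (g x)" using less.prems(2) \<beta> by simp
        then have "x \<subseteq>\<^sub>m g x" using gx(2) unfolding map_le_def by (metis subsetD)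
        then show False using map_le_antisym[OF gx(2)] gx(3) by simp
      qed
      then have "\<beta> < \<alpha>" by simp
      from less.IH[OF this gx(1) \<beta>] obtain cs where "coloured B g k (g x) cs" ..
      from coloured.step[OF False this] show ?thesis ..
    qed
  qed
  \<comment> \<open>Equal lists allow both nodes to be followed down in parallel. The images under
    \<open>g\<close> lie below the longer of the two nodes, so they remain comparable; once they are
    known to be equal, \<open>sep\<close> gives equality one step higher.\<close>
  have uniq: "x = y" if "coloured B g k x cs" "coloured B g k y cs" "x \<subseteq>\<^sub>m y \<or> y \<subseteq>\<^sub>m x" "x \<in> T" "y \<in> T" for x y cs
    using that
  proof (induction arbitrary: y rule: coloured.induct)
    case (base x)
    from base.prems(1) show ?case by cases auto
  next
    case (step x cs)
    from step.prems(1) have y: "y \<notin> B" "k x = k y" "coloured B g k (g y) cs" by (cases, auto)+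
    have gx: "g x \<in> T" "g x \<subseteq>\<^sub>m x" and gy: "g y \<in> T" "g y \<subseteq>\<^sub>m y"
      using g[of x] g[of y] step.hyps(1) y(1) step.prems by simp_all
    obtain \<alpha> \<beta> where d: "dom (g x) = {..<\<alpha>}" "dom (g y) = {..<\<beta>}"
      using dom gx(1) gy(1) by metis
    have "g x \<subseteq>\<^sub>m g y \<or> g y \<subseteq>\<^sub>m g x"
      using step.prems(2)
    proof
      assume "x \<subseteq>\<^sub>m y"
      then show ?thesis using map_le_comparable[OF map_le_trans[OF gx(2)] gy(2) d] by blast
    next
      assume "y \<subseteq>\<^sub>m x"
      then show ?thesis using map_le_comparable[OF gx(2) map_le_trans[OF gy(2)] d] by blast
    qed
    then have eq: "g x = g y" using step.IH[OF y(3) _ gx(1) gy(1)] by blast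
    from step.prems(2) show ?case
    proof
      assume "x \<subseteq>\<^sub>m y"
      then show ?thesis using sep[of x y] step.hyps(1) step.prems(3,4) y(1,2) eq by simp
    next
      assume "y \<subseteq>\<^sub>m x"
      then show ?thesis using sep[of y x] step.hyps(1) step.prems(3,4) y(1,2) eq by simp
    qed
  qed
  have "small TYPE('a) (lists (Inl ` B \<union> (range Inr :: (_ + 'c) set)))"
    by (intro small_lists[OF inf] small_Un[OF inf] small_image B k)
  then obtain f :: "(('k \<rightharpoonup> 'v) + 'c) list \<Rightarrow> 'a" where
    f: "inj_on f (lists (Inl ` B \<union> range Inr))" unfolding small_def by blast
  have "\<forall>x\<in>T. \<exists>cs. coloured B g k x cs" using ex dom by blast
  then obtain col where col: "\<And>x. x \<in> T \<Longrightarrow> coloured B g k x (col x)" by metis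
  define A where "A i = {x \<in> T. f (col x) = i}" for i
  have "antichain (A i)" for i
    unfolding antichain_def
  proof (intro ballI impI)
    fix x y assume x: "x \<in> A i" and y: "y \<in> A i" and "x \<noteq> y"
    have "col x = col y"
      using inj_onD[OF f _ coloured_lists coloured_lists, OF _ col col] x y unfolding A_def by auto
    then have "\<not> (x \<subseteq>\<^sub>m y \<or> y \<subseteq>\<^sub>m x)"
      using uniq[of x "col x" y] col[of x] col[of y] x y \<open>x \<noteq> y\<close> unfolding A_def by auto
    then show "\<not> x \<subseteq>\<^sub>m y \<and> \<not> y \<subseteq>\<^sub>m x" by simp
  qed
  moreover have "T = (\<Union>i. A i)" unfolding A_def by auto
  ultimately show ?thesis unfolding special_def by blast
qed

text \<open>An order type below lambda is represented by the element of \<open>'a\<close> whose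
  initial segment realizes it, and lambda itself by \<open>None\<close>. At an accumulation point
  the ladder is a proper initial segment of the longer one, so its order type is strictly
  smaller.\<close>

lemma order_type_colouring:
  fixes C :: "'k::wellorder \<Rightarrow> 'k set"
  assumes otp: "\<And>\<alpha>. (Restr wo_rel_of (C \<alpha>), card_of (UNIV :: 'a set)) \<in> ordLeq"
    and coh: "\<And>\<alpha> \<alpha>'. \<alpha>' \<in> acc (C \<alpha>) \<Longrightarrow> C \<alpha>' = C \<alpha> \<inter> {..<\<alpha>'}"
  shows "\<exists>ot :: 'k \<Rightarrow> 'a option. \<forall>\<alpha> \<alpha>'. \<alpha>' \<in> acc (C \<alpha>) \<longrightarrow> ot \<alpha>' \<noteq> ot \<alpha>"
proof -
  let ?r = "card_of (UNIV :: 'a set)" and ?R = "\<lambda>\<alpha>. Restr (wo_rel_of :: 'k rel) (C \<alpha>)"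
  have wr: "Well_order ?r" by (rule card_of_Well_order)
  have wR: "Well_order (?R \<alpha>)" for \<alpha> using otp[of \<alpha>] unfolding ordLeq_def by blast
  let ?P = "\<lambda>\<alpha> c. case c of None \<Rightarrow> (?R \<alpha>, ?r) \<in> ordIso | Some a \<Rightarrow> (?R \<alpha>, Restr ?r (underS ?r a)) \<in> ordIso"
  have "\<exists>c. ?P \<alpha> c" for \<alpha>
  proof (cases "(?R \<alpha>, ?r) \<in> ordIso")
    case True
    then show ?thesis by (intro exI[of _ None]) simp
  next
    case False
    then have "(?R \<alpha>, ?r) \<in> ordLess" using otp[of \<alpha>] ordLeq_iff_ordLess_or_ordIso by blast
    then obtain a where "(?R \<alpha>, Restr ?r (underS ?r a)) \<in> ordIso"
      using ordLess_iff_ordIso_Restr[OF wr wR] by blast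
    then show ?thesis by (intro exI[of _ "Some a"]) simp
  qed
  then have "\<exists>ot. \<forall>\<alpha>. ?P \<alpha> (ot \<alpha>)" by (intro choice allI)
  then obtain ot where ot: "\<And>\<alpha>. ?P \<alpha> (ot \<alpha>)" by blast
  have "ot \<alpha>' \<noteq> ot \<alpha>" if acc: "\<alpha>' \<in> acc (C \<alpha>)" for \<alpha> \<alpha>'
  proof
    assume eq: "ot \<alpha>' = ot \<alpha>"
    have iso: "(?R \<alpha>', ?R \<alpha>) \<in> ordIso"
    proof (cases "ot \<alpha>")
      case None
      then have "(?R \<alpha>', ?r) \<in> ordIso" "(?R \<alpha>, ?r) \<in> ordIso" using ot[of \<alpha>] ot[of \<alpha>'] eq by simp_all
      then show ?thesis using ordIso_transitive ordIso_symmetric by blast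
    next
      case (Some a)
      let ?r' = "Restr ?r (underS ?r a)"
      have "(?R \<alpha>', ?r') \<in> ordIso" "(?R \<alpha>, ?r') \<in> ordIso" using ot[of \<alpha>] ot[of \<alpha>'] eq Some by simp_all
      then show ?thesis using ordIso_transitive ordIso_symmetric by blast
    qed
    have mem: "\<alpha>' \<in> C \<alpha>" using acc unfolding acc_def by blast
    have under: "underS (?R \<alpha>) \<alpha>' = C \<alpha>'"
      unfolding coh[OF acc] underS_def wo_rel_of_def using mem by (auto simp: order_le_less)
    have "Field (?R \<alpha>) \<noteq> {}" using mem unfolding Field_def wo_rel_of_def by auto
    then have "(Restr (?R \<alpha>) (underS (?R \<alpha>) \<alpha>'), ?R \<alpha>) \<in> ordLess"
      by (rule underS_Restr_ordLess[OF wR])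
    moreover have "Restr (?R \<alpha>) (C \<alpha>') = ?R \<alpha>'"
      using coh[OF acc] by auto
    ultimately have "(?R \<alpha>', ?R \<alpha>) \<in> ordLess" unfolding under by simp
    then show False using iso not_ordLess_ordIso by blast
  qed
  then show ?thesis by blast
qed

section \<open>Tuples of nodes as nodes with list values\<close>

lemma proj_restrict: "proj i (x |` A) = proj i x |` A"
  unfolding proj_def restrict_map_def by auto

lemma dom_proj: "dom (proj i x) = dom x"
  unfolding proj_def by auto

lemma proj_map_le: "x \<subseteq>\<^sub>m y \<Longrightarrow> proj i x \<subseteq>\<^sub>m proj i y"
  unfolding map_le_def dom_proj by (simp add: proj_def)

lemma map_add_absorb: "f \<subseteq>\<^sub>m g \<Longrightarrow> f ++ g = g"
proof (rule ext)
  fix x assume "f \<subseteq>\<^sub>m g"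
  then have "f x = g x \<or> f x = None" unfolding map_le_def by (metis domIff)
  then show "(f ++ g) x = g x" by (auto simp: map_add_def split: option.splits)
qed

lemma map_add_absorb': "g \<subseteq>\<^sub>m f \<Longrightarrow> f ++ g = f"
proof (rule ext)
  fix x assume "g \<subseteq>\<^sub>m f"
  then have "g x = f x \<or> g x = None" unfolding map_le_def by (metis domIff)
  then show "(f ++ g) x = f x" by (auto simp: map_add_def split: option.splits)
qed

lemma proj_eqI:
  assumes dom: "dom x = dom y" and len: "\<And>\<beta>. \<beta> \<in> dom x \<Longrightarrow> length (the (x \<beta>)) = m"
    "\<And>\<beta>. \<beta> \<in> dom y \<Longrightarrow> length (the (y \<beta>)) = m" and proj: "\<And>i. i < m \<Longrightarrow> proj i x = proj i y"
  shows "x = y"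
proof (rule ext)
  fix \<beta>
  show "x \<beta> = y \<beta>"
  proof (cases "\<beta> \<in> dom x")
    case True
    then obtain u v where uv: "x \<beta> = Some u" "y \<beta> = Some v" using dom by blast
    have "u ! i = v ! i" if "i < m" for i
      using fun_cong[OF proj[OF that], of \<beta>] uv unfolding proj_def by simp
    moreover have "length u = m" "length v = m" using len[of \<beta>] uv by auto
    ultimately have "u = v" by (simp add: nth_equalityI)
    then show ?thesis using uv by simp
  next
    case False
    then show ?thesis using dom by (metis domIff)
  qed
qed

definition zip_nodes :: "nat \<Rightarrow> 'k::wellorder \<Rightarrow> (nat \<Rightarrow> 'k \<rightharpoonup> 'v) \<Rightarrow> ('k \<rightharpoonup> 'v list)" where
  "zip_nodes m \<alpha> z = (\<lambda>\<beta>. if \<beta> < \<alpha> then Some (map (\<lambda>i. the (z i \<beta>)) [0..<m]) else None)"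

lemma dom_zip_nodes: "dom (zip_nodes m \<alpha> z) = {..<\<alpha>}"
  unfolding zip_nodes_def by (auto split: if_splits)

lemma length_zip_nodes: "\<beta> < \<alpha> \<Longrightarrow> length (the (zip_nodes m \<alpha> z \<beta>)) = m"
  unfolding zip_nodes_def by simp

lemma proj_zip_nodes:
  assumes "i < m" "dom (z i) = {..<\<alpha>}"
  shows "proj i (zip_nodes m \<alpha> z) = z i"
proof (rule ext)
  fix \<beta>
  show "proj i (zip_nodes m \<alpha> z) \<beta> = z i \<beta>"
  proof (cases "\<beta> < \<alpha>")
    case True
    then have "\<beta> \<in> dom (z i)" using assms by simp
    then show ?thesis unfolding proj_def zip_nodes_def using True assms(1) by auto
  next
    case False
    then have "\<beta> \<notin> dom (z i)" using assms by simp
    then have "z i \<beta> = None" by (simp add: domIff)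
    then show ?thesis unfolding proj_def zip_nodes_def using False by simp
  qed
qed

section \<open>The tree and its levels\<close>

context tree_construction
begin

lemmas Lv_dom = level_ok_dom[OF level_ok]
  and Lv_restrict = level_ok_restrict[OF level_ok]
  and Lv_small = level_ok_sm[OF level_ok]

lemma level_ok_all: "\<forall>\<gamma><\<delta>. level_ok \<gamma>"
  using level_ok by blast

lemma Lv_extend:
  assumes "x \<in> Lv \<gamma>" "\<gamma> \<le> \<delta>"
  shows "\<exists>y\<in>Lv \<delta>. y |` {..<\<gamma>} = x"
proof (cases "\<gamma> = \<delta>")
  case True
  then show ?thesis using assms Lv_dom[OF assms(1)] restrict_id by (metis order_refl)
next
  case False
  then have lt: "\<gamma> < \<delta>" using assms by simp
  obtain e where e: "good Lv \<gamma> \<delta> e" by (rule level_ok_extend[OF level_ok lt, of "{}"]) auto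
  let ?x = "x(\<gamma> \<mapsto> h \<gamma>)"
  have x: "?x \<in> Lv (suc \<gamma>)" by (rule Lv_sucI[OF assms(1)]) simp
  have "e ?x |` {..<\<gamma>} = (e ?x |` {..<suc \<gamma>}) |` {..<\<gamma>}"
    by (simp only: restrict_restrict_le[OF order_less_imp_le[OF suc_gt]])
  also have "\<dots> = x" unfolding good_restrict[OF e x] by (rule restrict_upd[OF assms(1) Lv_dom[OF assms(1)]])
  finally show ?thesis using good_in[OF e x] by blast
qed

lemma zero_ex: "\<exists>\<gamma> :: 'k. \<not> positive \<gamma>"
  using not_less_Least[of _ "\<lambda>\<gamma> :: 'k. True"] unfolding positive_def by blast

lemma Lv_nonempty: "Lv \<delta> \<noteq> {}"
proof -
  obtain \<gamma> :: 'k where "\<not> positive \<gamma>" using zero_ex by blast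
  then have "Map.empty \<in> Lv \<gamma>" "\<gamma> \<le> \<delta>"
    using Lv_0 unfolding positive_def by (auto simp: not_less)
  then show ?thesis using Lv_extend by blast
qed

definition tree :: "('k \<rightharpoonup> 'h) set" where "tree = (\<Union>\<alpha>. Lv \<alpha>)"

lemma tree_iff: "dom x = {..<\<alpha>} \<Longrightarrow> x \<in> tree \<longleftrightarrow> x \<in> Lv \<alpha>"
  unfolding tree_def using Lv_dom by (metis UN_iff UNIV_I lessThan_eq_iff)

lemma level_tree: "level tree \<alpha> = Lv \<alpha>"
  unfolding level_def using tree_iff Lv_dom by blast

lemma streamlined_tree: "streamlined tree"
  unfolding streamlined_def
proof (intro conjI ballI allI)
  fix x assume "x \<in> tree"
  then obtain \<alpha> where x: "x \<in> Lv \<alpha>" unfolding tree_def by blast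
  then show "\<exists>\<alpha>. dom x = {..<\<alpha>}" using Lv_dom by blast
  fix \<beta>
  show "x |` {..<\<beta>} \<in> tree"
  proof (cases "\<beta> \<le> \<alpha>")
    case True
    then show ?thesis using Lv_restrict[OF x] unfolding tree_def by blast
  next
    case False
    then have "x |` {..<\<beta>} = x" using Lv_dom[OF x] by (intro restrict_id) auto
    then show ?thesis using x unfolding tree_def by auto
  qed
qed

lemma small_ordLess: "sm S \<Longrightarrow> (card_of S, card_of (UNIV :: 'k set)) \<in> ordLess"
proof -
  assume S: "sm S"
  have "(card_of (UNIV :: 'a set), card_of (UNIV :: 'k set)) \<in> ordLess"
    using not_small_UNIV unfolding small_iff
    by (simp add: not_ordLeq_iff_ordLess[OF card_of_Well_order card_of_Well_order])
  then show ?thesis using S ordLeq_ordLess_trans unfolding small_iff by blast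
qed

lemma kappa_tree_tree: "kappa_tree tree"
  unfolding kappa_tree_def level_tree
  using streamlined_tree Lv_nonempty small_ordLess[OF Lv_small] by blast

section \<open>Joint memory of n + 1 walkers\<close>

text \<open>Otherwise \<gamma> lies inside a jump of \<open>Cs \<alpha>'\<close> from some \<mu>.
  Points of \<open>Cs \<alpha>\<close> below \<gamma> are below the start or shared with
  \<open>Cs \<alpha>'\<close>, so none exceeds \<mu>, and the mark shown at \<gamma> is at most
  \<mu>. The \<open>n + 1\<close> walkers, distinct since their start, would all show it inside the
  jump.\<close>

lemma marks_agree:
  assumes lim: "is_lim \<alpha>" "is_lim \<alpha>'"
    and z: "\<And>i. i \<le> n \<Longrightarrow> walks_from \<alpha> (z i) \<gamma>\<^sub>0" and z': "\<And>i. i \<le> n \<Longrightarrow> walks_from \<alpha>' (z' i) \<gamma>\<^sub>0"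
    and inj: "inj_on (\<lambda>i. z' i |` {..<\<gamma>\<^sub>0}) {..n}"
    and \<gamma>: "\<gamma>\<^sub>0 \<le> \<gamma>" "\<gamma> < \<alpha>'" "\<gamma> \<in> Cs \<alpha>"
    and below: "\<And>c. \<gamma>\<^sub>0 \<le> c \<Longrightarrow> c < \<gamma> \<Longrightarrow> c \<in> Cs \<alpha> \<Longrightarrow> c \<in> Cs \<alpha>'"
    and eq: "\<And>i. i \<le> n \<Longrightarrow> z i \<gamma> = z' i \<gamma>"
  shows "\<gamma> \<in> Cs \<alpha>'"
proof (rule ccontr)
  assume no: "\<gamma> \<notin> Cs \<alpha>'"
  have "\<gamma>\<^sub>0 \<in> Cs \<alpha>'" using z'[of 0] unfolding walks_from_def by simp
  then obtain \<mu> \<gamma>' where g: "gap (Cs \<alpha>') \<mu> \<gamma>'" "\<gamma>\<^sub>0 \<le> \<mu>" "\<mu> < \<gamma>" "\<gamma> < \<gamma>'" "\<gamma>' \<in> Cs \<alpha>'"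
    using Cs_around[OF level_ok_all lim(2) _ \<gamma>(1,2) no] by metis
  note wstep = walks_from_step[OF level_ok_all lim(2) z' g(1,5,2)]
  let ?f = "\<lambda>i. z' i |` {..<suc \<mu>}"
  have le: "\<gamma>\<^sub>0 \<le> suc \<mu>" using g(2) suc_gt[of \<mu>] by (meson order.trans order_less_imp_le)
  have inj': "inj_on ?f {..n}"
  proof (rule inj_onI)
    fix i j assume ij: "i \<in> {..n}" "j \<in> {..n}" and "?f i = ?f j"
    then have "?f i |` {..<\<gamma>\<^sub>0} = ?f j |` {..<\<gamma>\<^sub>0}" by (simp only:)
    then have "z' i |` {..<\<gamma>\<^sub>0} = z' j |` {..<\<gamma>\<^sub>0}" by (simp only: restrict_restrict_le[OF le])
    then show "i = j" using inj_onD[OF inj _ ij] by blast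
  qed
  have supb: "supb (Cs \<alpha>) \<gamma> \<le> \<mu>"
  proof (rule supb_least)
    fix c assume c: "c \<in> Cs \<alpha>" "c < \<gamma>"
    show "c \<le> \<mu>"
    proof (cases "\<gamma>\<^sub>0 \<le> c")
      case True
      then have "c \<in> Cs \<alpha>'" using below c by blast
      then show ?thesis using g(1,4) c(2) unfolding gap_iff by simp
    next
      case False
      then show ?thesis using g(2) by simp
    qed
  qed
  have "st (Cs \<alpha>') \<mu> \<gamma>' y \<gamma> = Some (h (supb (Cs \<alpha>) \<gamma>))" if "y \<in> ?f ` {..n}" for y
  proof -
    from that obtain i where i: "i \<le> n" "y = ?f i" by auto
    have "st (Cs \<alpha>') \<mu> \<gamma>' y \<gamma> = z' i \<gamma>"
      unfolding i(2) using restrict_apply[OF wstep(3)[OF i(1)] g(4)] by simp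
    also have "\<dots> = Some (h (supb (Cs \<alpha>) \<gamma>))"
      using eq[OF i(1)] walks_from_mark[OF level_ok_all lim(1) z[OF i(1)] \<gamma>(3,1)] by simp
    finally show ?thesis .
  qed
  moreover have "?f ` {..n} \<subseteq> Lv (suc \<mu>)" using wstep(2) by auto
  ultimately have "card (?f ` {..n}) \<le> n"
    using good_card[OF wstep(5)[of 0] suc_least[OF g(3)] g(4) supb] by blast
  then show False using card_image[OF inj'] by simp
qed

text \<open>Both inclusions between the ladders are proved in one induction on \<gamma>, with the
  roles of \<alpha> and \<alpha>' exchanged, because either one needs agreement below \<gamma>. Then
  \<open>Cs \<alpha>'\<close> is unbounded in \<alpha>, and closedness puts \<alpha> into
  it.\<close>

lemma walks_coherent:
  assumes lim: "is_lim \<alpha>" "is_lim \<alpha>'"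
    and z: "\<And>i. i \<le> n \<Longrightarrow> walks_from \<alpha> (z i) \<gamma>\<^sub>0" and z': "\<And>i. i \<le> n \<Longrightarrow> walks_from \<alpha>' (z' i) \<gamma>\<^sub>0"
    and inj: "inj_on (\<lambda>i. z i |` {..<\<gamma>\<^sub>0}) {..n}"
    and lt: "\<alpha> < \<alpha>'" and res: "\<And>i. i \<le> n \<Longrightarrow> z' i |` {..<\<alpha>} = z i"
  shows "\<alpha> \<in> acc (Cs \<alpha>')"
proof -
  have \<gamma>0: "\<gamma>\<^sub>0 \<in> Cs \<alpha>" using z[of 0] unfolding walks_from_def by simp
  have le: "\<gamma>\<^sub>0 \<le> \<alpha>" using Cs_less[OF \<gamma>0] by simp
  have inj': "inj_on (\<lambda>i. z' i |` {..<\<gamma>\<^sub>0}) {..n}"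
  proof -
    have "z' i |` {..<\<gamma>\<^sub>0} = z i |` {..<\<gamma>\<^sub>0}" if "i \<le> n" for i
      using restrict_restrict_le[OF le, of "z' i"] res[OF that] by simp
    then show ?thesis using inj unfolding inj_on_def by simp
  qed
  have eq: "z' i \<xi> = z i \<xi>" if "i \<le> n" "\<xi> < \<alpha>" for i \<xi>
    by (rule restrict_apply[OF res[OF that(1)] that(2)])
  have same: "\<gamma> \<in> Cs \<alpha> \<longleftrightarrow> \<gamma> \<in> Cs \<alpha>'" if "\<gamma>\<^sub>0 \<le> \<gamma>" "\<gamma> < \<alpha>" for \<gamma>
    using that
  proof (induction \<gamma> rule: less_induct)
    case (less \<gamma>)
    have ih: "c \<in> Cs \<alpha> \<longleftrightarrow> c \<in> Cs \<alpha>'" if "\<gamma>\<^sub>0 \<le> c" "c < \<gamma>" for c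
      using less.IH[OF that(2,1)] that(2) less.prems(2) by simp
    have lt': "\<gamma> < \<alpha>'" using less.prems(2) lt by simp
    show ?case
    proof
      assume "\<gamma> \<in> Cs \<alpha>"
      then show "\<gamma> \<in> Cs \<alpha>'"
        using marks_agree[OF lim z z' inj' less.prems(1) lt'] ih eq less.prems(2) by simp
    next
      assume "\<gamma> \<in> Cs \<alpha>'"
      then show "\<gamma> \<in> Cs \<alpha>"
        using marks_agree[OF lim(2,1) z' z inj less.prems(1,2)] ih eq less.prems(2) by simp
    qed
  qed
  have "unbd (Cs \<alpha>') \<alpha>"
    unfolding unbd_def
  proof (intro allI impI)
    fix \<xi> assume "\<xi> < \<alpha>"
    then have "max \<xi> \<gamma>\<^sub>0 < \<alpha>" using Cs_less[OF \<gamma>0] by simp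
    then obtain c where c: "c \<in> Cs \<alpha>" "max \<xi> \<gamma>\<^sub>0 < c" "c < \<alpha>"
      using unbd_Cs[OF lim(1)] unfolding unbd_def by blast
    then show "\<exists>\<beta>\<in>Cs \<alpha>'. \<xi> < \<beta> \<and> \<beta> < \<alpha>" using same[of c] by (intro bexI[of _ c]) (simp_all add: order_less_imp_le)
  qed
  then have sup: "sup_is (Cs \<alpha>' \<inter> {..<\<alpha>}) \<alpha>" by (rule unbd_sup_is)
  have pos: "positive \<alpha>" using lim(1) unfolding is_lim_def by simp
  then have "\<alpha> \<in> Cs \<alpha>'" using Cs_closed[of \<alpha>'] sup lt unfolding closed_below_def by blast
  then show ?thesis using sup pos unfolding acc_def by simp
qed

section \<open>Derived trees in terms of levels\<close>

text \<open>Two nodes that agree on their common domain have the longer one as their union. If that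
  is \<open>t\<close>, then \<open>p\<close> is a restriction of a node of the tree and so belongs
  to its level.\<close>

lemma union_in_tree:
  assumes s: "t \<in> Lv \<delta>" and dp: "dom p = {..<\<alpha>}"
  shows "union_in tree p t \<longleftrightarrow> p \<in> Lv \<alpha> \<and> (\<forall>\<xi><\<alpha>. \<xi> < \<delta> \<longrightarrow> p \<xi> = t \<xi>)"
proof -
  have dt: "dom t = {..<\<delta>}" by (rule Lv_dom[OF s])
  have "(p ++ t \<in> tree) = (p \<in> Lv \<alpha>)"
    if c: "\<And>\<xi>. \<xi> < \<alpha> \<Longrightarrow> \<xi> < \<delta> \<Longrightarrow> p \<xi> = t \<xi>"
  proof (cases "\<alpha> \<le> \<delta>")
    case True
    have le: "p \<subseteq>\<^sub>m t" using c True unfolding map_le_def dp by simp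
    have "p ++ t = t" by (rule map_add_absorb[OF le])
    moreover have r: "t |` {..<\<alpha>} = p" using le map_le_restrict[OF dp] by simp
    moreover have "t \<in> tree" using s unfolding tree_def by blast
    moreover have "p \<in> Lv \<alpha>" using Lv_restrict[OF s True] unfolding r .
    ultimately show ?thesis by simp
  next
    case False
    then have "t \<subseteq>\<^sub>m p" using c unfolding map_le_def dt by simp
    then have "p ++ t = p" by (rule map_add_absorb')
    then show ?thesis using tree_iff[OF dp] by simp
  qed
  moreover have "(\<forall>\<beta>\<in>dom p \<inter> dom t. p \<beta> = t \<beta>) \<longleftrightarrow> (\<forall>\<xi><\<alpha>. \<xi> < \<delta> \<longrightarrow> p \<xi> = t \<xi>)"
    unfolding dp dt by (simp only: Ball_def Int_iff lessThan_iff imp_conjL)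
  ultimately show ?thesis unfolding union_in_def by blast
qed

lemma derived_iff:
  assumes s: "\<And>i. i < m \<Longrightarrow> s i \<in> Lv \<delta>"
  shows "x \<in> derived_tree m tree s \<longleftrightarrow> (\<exists>\<alpha>. dom x = {..<\<alpha>} \<and> (\<forall>\<beta><\<alpha>. length (the (x \<beta>)) = m) \<and>
    (\<forall>i<m. proj i x \<in> Lv \<alpha> \<and> (\<forall>\<xi><\<alpha>. \<xi> < \<delta> \<longrightarrow> proj i x \<xi> = s i \<xi>)))"
proof -
  have "(\<forall>i<m. union_in tree (proj i x) (s i)) \<longleftrightarrow>
      (\<forall>i<m. proj i x \<in> Lv \<alpha> \<and> (\<forall>\<xi><\<alpha>. \<xi> < \<delta> \<longrightarrow> proj i x \<xi> = s i \<xi>))" if "dom x = {..<\<alpha>}" for \<alpha>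
    using union_in_tree[OF s, of _ "proj _ x"] that dom_proj[of _ x] by simp
  moreover have "(\<forall>\<beta>\<in>dom x. length (the (x \<beta>)) = m) \<longleftrightarrow> (\<forall>\<beta><\<alpha>. length (the (x \<beta>)) = m)"
    if "dom x = {..<\<alpha>}" for \<alpha>
    unfolding that by (simp only: Ball_def lessThan_iff)
  \<comment> \<open>Pure logic: both preceding equivalences hold once \<alpha> is the height of
    \<open>x\<close>, and this moves them under the quantifier.\<close>
  moreover have "(\<exists>\<alpha>. A \<alpha>) \<and> Q \<and> P \<longleftrightarrow> (\<exists>\<alpha>. A \<alpha> \<and> Q' \<alpha> \<and> P' \<alpha>)"
    if "\<And>\<alpha>. A \<alpha> \<Longrightarrow> P = P' \<alpha>" "\<And>\<alpha>. A \<alpha> \<Longrightarrow> Q = Q' \<alpha>" for A P' Q' :: "'k \<Rightarrow> bool" and P Q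
    using that by blast
  ultimately show ?thesis unfolding derived_tree_def mem_Collect_eq by presburger
qed


lemma derived_seqD:
  assumes "derived_seq m tree s" "0 < m"
  obtains \<delta> where "\<forall>i<m. s i \<in> Lv \<delta>" "inj_on s {..<m}"
proof -
  from assms obtain \<delta> where "inj_on s {..<m}" "\<forall>i<m. s i \<in> tree" "\<forall>i<m. dom (s i) = {..<\<delta>}"
    unfolding derived_seq_def by blast
  then show ?thesis using that tree_iff by blast
qed

lemma derived_dom: "x \<in> derived_tree m T s \<Longrightarrow> \<exists>\<alpha>. dom x = {..<\<alpha>}"
  unfolding derived_tree_def by blast

context
  fixes m :: nat and s :: "nat \<Rightarrow> ('k \<rightharpoonup> 'h)" and \<delta> :: 'k
  assumes s: "\<forall>i<m. s i \<in> Lv \<delta>"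
begin

abbreviation "derived \<equiv> derived_tree m tree s"

lemma derivedD:
  assumes "x \<in> derived" "dom x = {..<\<alpha>}"
  shows "\<And>\<beta>. \<beta> < \<alpha> \<Longrightarrow> length (the (x \<beta>)) = m" "\<And>i. i < m \<Longrightarrow> proj i x \<in> Lv \<alpha>"
    "\<And>i \<xi>. i < m \<Longrightarrow> \<xi> < \<alpha> \<Longrightarrow> \<xi> < \<delta> \<Longrightarrow> proj i x \<xi> = s i \<xi>"
proof -
  from assms(1) obtain \<alpha>' where \<alpha>': "dom x = {..<\<alpha>'}" and *: "\<forall>\<beta><\<alpha>'. length (the (x \<beta>)) = m"
      "\<forall>i<m. proj i x \<in> Lv \<alpha>' \<and> (\<forall>\<xi><\<alpha>'. \<xi> < \<delta> \<longrightarrow> proj i x \<xi> = s i \<xi>)"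
    using derived_iff[of m s \<delta> x, OF s[rule_format]] by blast
  have "\<alpha>' = \<alpha>" using \<alpha>' assms(2) by simp
  with * show "\<And>\<beta>. \<beta> < \<alpha> \<Longrightarrow> length (the (x \<beta>)) = m" "\<And>i. i < m \<Longrightarrow> proj i x \<in> Lv \<alpha>"
    "\<And>i \<xi>. i < m \<Longrightarrow> \<xi> < \<alpha> \<Longrightarrow> \<xi> < \<delta> \<Longrightarrow> proj i x \<xi> = s i \<xi>" by auto
qed

lemma derivedI:
  assumes "dom x = {..<\<alpha>}" "\<And>\<beta>. \<beta> < \<alpha> \<Longrightarrow> length (the (x \<beta>)) = m" "\<And>i. i < m \<Longrightarrow> proj i x \<in> Lv \<alpha>"
    "\<And>i \<xi>. i < m \<Longrightarrow> \<xi> < \<alpha> \<Longrightarrow> \<xi> < \<delta> \<Longrightarrow> proj i x \<xi> = s i \<xi>"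
  shows "x \<in> derived"
  using derived_iff[of m s \<delta> x, OF s[rule_format]] assms by blast

lemma derived_eqI:
  assumes "x \<in> derived" "y \<in> derived" "dom x = {..<\<alpha>}" "dom y = {..<\<alpha>}" "\<And>i. i < m \<Longrightarrow> proj i x = proj i y"
  shows "x = y"
  by (rule proj_eqI[of x y m]) (use assms derivedD(1) in auto)

lemma derived_restrict:
  assumes x: "x \<in> derived" "dom x = {..<\<alpha>}" and le: "\<beta> \<le> \<alpha>"
  shows "x |` {..<\<beta>} \<in> derived"
proof (rule derivedI[of _ \<beta>])
  show "dom (x |` {..<\<beta>}) = {..<\<beta>}" by (rule dom_restrict_le[OF x(2) le])
  show "length (the ((x |` {..<\<beta>}) \<xi>)) = m" if "\<xi> < \<beta>" for \<xi>
    using derivedD(1)[OF x, of \<xi>] that le by simp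
  show "proj i (x |` {..<\<beta>}) \<in> Lv \<beta>" if "i < m" for i
    unfolding proj_restrict by (rule Lv_restrict[OF derivedD(2)[OF x that] le])
  show "proj i (x |` {..<\<beta>}) \<xi> = s i \<xi>" if "i < m" "\<xi> < \<beta>" "\<xi> < \<delta>" for i \<xi>
    unfolding proj_restrict using derivedD(3)[OF x, of i \<xi>] that le by simp
qed

lemma derived_streamlined: "streamlined derived"
  unfolding streamlined_def
proof (intro conjI ballI allI)
  fix x assume x: "x \<in> derived"
  then obtain \<alpha> where \<alpha>: "dom x = {..<\<alpha>}" using derived_dom by blast
  then show "\<exists>\<alpha>. dom x = {..<\<alpha>}" by blast
  fix \<beta>
  show "x |` {..<\<beta>} \<in> derived"
  proof (cases "\<beta> \<le> \<alpha>")
    case True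
    then show ?thesis by (rule derived_restrict[OF x \<alpha>])
  next
    case False
    then have "x |` {..<\<beta>} = x" using \<alpha> by (intro restrict_id) auto
    then show ?thesis using x by simp
  qed
qed

lemma derived_level_small: "sm (level derived \<alpha>)"
proof (rule small_inj_on)
  let ?f = "\<lambda>x. map (\<lambda>i. proj i x) [0..<m]"
  show "inj_on ?f (level derived \<alpha>)"
  proof (rule inj_onI)
    fix x y assume xy: "x \<in> level derived \<alpha>" "y \<in> level derived \<alpha>" "?f x = ?f y"
    have "proj i x = proj i y" if "i < m" for i
      using arg_cong[OF xy(3), of "\<lambda>l. l ! i"] that by simp
    then show "x = y" using xy derived_eqI[of x y \<alpha>] unfolding level_def by blast
  qed
  show "?f ` level derived \<alpha> \<subseteq> lists (Lv \<alpha>)"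
    using derivedD(2) unfolding level_def by auto
  show "sm (lists (Lv \<alpha>))" by (rule small_lists[OF inf Lv_small])
qed

lemma derived_extend:
  assumes x: "x \<in> derived" "dom x = {..<\<beta>}" "\<delta> \<le> \<beta>"
    and z: "\<And>i. i < m \<Longrightarrow> z i \<in> Lv \<alpha>" "\<And>i. i < m \<Longrightarrow> z i |` {..<\<beta>} = proj i x" and le: "\<beta> \<le> \<alpha>"
  shows "zip_nodes m \<alpha> z \<in> derived" "zip_nodes m \<alpha> z |` {..<\<beta>} = x"
proof -
  have dz: "dom (zip_nodes m \<alpha> z) = {..<\<alpha>}" by (rule dom_zip_nodes)
  have pz: "proj i (zip_nodes m \<alpha> z) = z i" if "i < m" for i
    by (rule proj_zip_nodes[where z = z, OF that Lv_dom[OF z(1)[OF that]]])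
  show D: "zip_nodes m \<alpha> z \<in> derived"
  proof (rule derivedI[OF dz length_zip_nodes])
    show "proj i (zip_nodes m \<alpha> z) \<in> Lv \<alpha>" if "i < m" for i
      unfolding pz[OF that] by (rule z(1)[OF that])
    show "proj i (zip_nodes m \<alpha> z) \<xi> = s i \<xi>" if "i < m" "\<xi> < \<alpha>" "\<xi> < \<delta>" for i \<xi>
    proof -
      have \<xi>: "\<xi> < \<beta>" using that x(3) by simp
      have "z i \<xi> = proj i x \<xi>" by (rule restrict_apply[OF z(2)[OF that(1)] \<xi>])
      also have "\<dots> = s i \<xi>" by (rule derivedD(3)[OF x(1,2) that(1) \<xi> that(3)])
      finally show ?thesis unfolding pz[OF that(1)] .
    qed
  qed
  show "zip_nodes m \<alpha> z |` {..<\<beta>} = x"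
  proof (rule derived_eqI[OF derived_restrict[OF D dz le] x(1) dom_restrict_le[OF dz le] x(2)])
    fix i assume "i < m"
    then show "proj i (zip_nodes m \<alpha> z |` {..<\<beta>}) = proj i x"
      unfolding proj_restrict using pz z(2) by simp
  qed
qed

lemma derived_level_\<delta>: "zip_nodes m \<delta> s \<in> derived"
proof (rule derivedI[OF dom_zip_nodes length_zip_nodes])
  show "proj i (zip_nodes m \<delta> s) \<in> Lv \<delta>" if "i < m" for i
    using proj_zip_nodes[of i m s \<delta>] that s[rule_format, OF that] Lv_dom[OF s[rule_format, OF that]] by simp
  show "proj i (zip_nodes m \<delta> s) \<xi> = s i \<xi>" if "i < m" for i \<xi>
    using proj_zip_nodes[of i m s \<delta>] that Lv_dom[OF s[rule_format, OF that]] by simp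
qed

lemma derived_level_nonempty: "level derived \<alpha> \<noteq> {}"
proof (cases "\<alpha> \<le> \<delta>")
  case True
  have "zip_nodes m \<delta> s |` {..<\<alpha>} \<in> derived"
    by (rule derived_restrict[OF derived_level_\<delta> dom_zip_nodes True])
  moreover have "dom (zip_nodes m \<delta> s |` {..<\<alpha>}) = {..<\<alpha>}"
    by (rule dom_restrict_le[OF dom_zip_nodes True])
  ultimately show ?thesis unfolding level_def by blast
next
  case False
  then have le: "\<delta> \<le> \<alpha>" by simp
  have "\<exists>y\<in>Lv \<alpha>. y |` {..<\<delta>} = s i" if "i < m" for i
    by (rule Lv_extend[OF s[rule_format, OF that] le])
  then have "\<forall>i. \<exists>y. i < m \<longrightarrow> y \<in> Lv \<alpha> \<and> y |` {..<\<delta>} = s i" by blast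
  then obtain z where z: "\<And>i. i < m \<Longrightarrow> z i \<in> Lv \<alpha>" "\<And>i. i < m \<Longrightarrow> z i |` {..<\<delta>} = s i"
    using choice[of "\<lambda>i y. i < m \<longrightarrow> y \<in> Lv \<alpha> \<and> y |` {..<\<delta>} = s i"] by blast
  have "zip_nodes m \<alpha> z \<in> derived"
  proof (rule derived_extend(1)[OF derived_level_\<delta> dom_zip_nodes order_refl z(1) _ le])
    show "z i |` {..<\<delta>} = proj i (zip_nodes m \<delta> s)" if "i < m" for i
      using proj_zip_nodes[of i m s \<delta>] that Lv_dom[OF s[rule_format, OF that]] z(2)[OF that] by simp
  qed
  then show ?thesis unfolding level_def using dom_zip_nodes by blast
qed

lemma derived_kappa_tree: "kappa_tree derived"
  unfolding kappa_tree_def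
  using derived_streamlined derived_level_nonempty small_ordLess[OF derived_level_small] by blast

lemma derived_proj_restrict:
  assumes "x \<in> derived" "dom x = {..<\<alpha>}" "\<delta> \<le> \<alpha>" "i < m"
  shows "proj i x |` {..<\<delta>} = s i"
proof (rule ext)
  fix \<xi>
  show "(proj i x |` {..<\<delta>}) \<xi> = s i \<xi>"
  proof (cases "\<xi> < \<delta>")
    case True
    then show ?thesis using derivedD(3)[OF assms(1,2,4), of \<xi>] assms(3) by simp
  next
    case False
    then have "s i \<xi> = None" using Lv_dom[OF s[rule_format, OF assms(4)]] by (auto simp: domIff[symmetric])
    then show ?thesis using False by simp
  qed
qed

end

section \<open>Specializing the (n + 1)-derived trees\<close>

text \<open>The regression sends a node of successor height to its predecessor, and a node of limit
  height \<alpha> to a common start of its \<open>n + 1\<close> walks, coloured by the order type of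
  \<open>Cs \<alpha>\<close>. Two comparable nodes of different limit heights with the same start
  would make one height an accumulation point of the ladder of the other, contradicting equal
  colours.\<close>

lemma special_derived:
  assumes otp: "\<And>\<alpha>. (Restr wo_rel_of (Cs \<alpha>), card_of (UNIV :: 'a set)) \<in> ordLeq"
    and ds: "derived_seq (n + 1) tree s"
  shows "special TYPE('a) (derived_tree (n + 1) tree s)"
proof -
  let ?D = "derived_tree (n + 1) tree s"
  obtain \<delta> where s: "\<forall>i<n + 1. s i \<in> Lv \<delta>" and inj: "inj_on s {..<n + 1}"
    using derived_seqD[OF ds] by auto
  obtain ot :: "'k \<Rightarrow> 'a option" where ot: "\<And>\<alpha> \<alpha>'. \<alpha>' \<in> acc (Cs \<alpha>) \<Longrightarrow> ot \<alpha>' \<noteq> ot \<alpha>"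
    using order_type_colouring[of Cs, OF otp Cs_coh] by blast
  \<comment> \<open>The regression stays at or above \<delta>, where the base nodes already differ,
    so the \<open>n + 1\<close> walkers are distinct at their common start. The heights up to
    \<delta> form the small set in which the iteration ends. The outer \<open>None\<close> of a
    colour signals a successor height, the inner one the order type lambda.\<close>
  define B where "B = (\<Union>\<alpha>\<in>{..\<delta>}. level ?D \<alpha>)"
  let ?P = "\<lambda>x \<gamma> c. \<exists>\<alpha>. dom x = {..<\<alpha>} \<and> \<delta> \<le> \<gamma> \<and> \<gamma> < \<alpha> \<and>
    (\<alpha> = suc \<gamma> \<and> c = None \<or> is_lim \<alpha> \<and> c = Some (ot \<alpha>) \<and> (\<forall>i\<le>n. walks_from \<alpha> (proj i x) \<gamma>))"
  have ex: "\<exists>\<gamma> c. ?P x \<gamma> c" if x: "x \<in> ?D - B" for x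
  proof -
    obtain \<alpha> where \<alpha>: "dom x = {..<\<alpha>}" using x unfolding derived_tree_def by blast
    have "\<not> \<alpha> \<le> \<delta>" using x \<alpha> unfolding B_def level_def by blast
    then have lt: "\<delta> < \<alpha>" by simp
    have pos: "positive \<alpha>" using lt unfolding positive_def by blast
    show ?thesis
    proof (cases \<alpha> rule: zero_suc_lim)
      case 1
      then show ?thesis using pos by blast
    next
      case (2 \<beta>)
      then have "\<delta> \<le> \<beta>" "\<beta> < \<alpha>" using lt suc_gt[of \<beta>] less_suc_iff[of \<delta> \<beta>] by simp_all
      then show ?thesis using \<alpha> 2 by blast
    next
      case 3
      have "\<forall>i\<in>{..n}. \<exists>g. walks_from \<alpha> (proj i x) g"
        using derivedD(2)[OF s _ \<alpha>] x Lv_walks_from[OF level_ok_all 3] by auto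
      then have "\<exists>g. \<forall>i\<in>{..n}. walks_from \<alpha> (proj i x) (g i)" by (rule bchoice)
      then obtain g where g: "\<And>i. i \<le> n \<Longrightarrow> walks_from \<alpha> (proj i x) (g i)" by auto
      have "Max (insert \<delta> (g ` {..n})) \<in> insert \<delta> (g ` {..n})" by (intro Max_in) auto
      moreover have "c < \<alpha>" if "c \<in> insert \<delta> (g ` {..n})" for c
      proof (cases "c = \<delta>")
        case False
        then obtain i where "i \<le> n" "c = g i" using \<open>c \<in> insert \<delta> (g ` {..n})\<close> by auto
        then show ?thesis using g[of i] Cs_less[of c \<alpha>] unfolding walks_from_def by simp
      qed (use lt in simp)
      ultimately have "Max (insert \<delta> (g ` {..n})) < \<alpha>" by blast
      then obtain \<gamma> where \<gamma>: "\<gamma> \<in> Cs \<alpha>" "Max (insert \<delta> (g ` {..n})) < \<gamma>"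
        using unbd_Cs[OF 3] unfolding unbd_def by blast
      then have "\<delta> < \<gamma>" "\<And>i. i \<le> n \<Longrightarrow> g i < \<gamma>" by simp_all
      then have "\<delta> \<le> \<gamma>" "\<And>i. i \<le> n \<Longrightarrow> walks_from \<alpha> (proj i x) \<gamma>"
        using walks_from_mono[OF level_ok_all 3 g \<gamma>(1)] by (simp_all add: order_less_imp_le)
      then show ?thesis using \<alpha> 3 Cs_less[OF \<gamma>(1)] by blast
    qed
  qed
  define r where "r x = (SOME \<gamma>. \<exists>c. ?P x \<gamma> c)" for x
  define k where "k x = (SOME c. ?P x (r x) c)" for x
  have P: "?P x (r x) (k x)" if "x \<in> ?D - B" for x
    unfolding k_def by (rule someI_ex, unfold r_def, rule someI_ex, rule ex[OF that])
  show ?thesis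
  proof (rule special_by_regression[where B = B and g = "\<lambda>x. x |` {..<r x}" and k = k, OF inf])
    show "\<exists>\<alpha>. dom x = {..<\<alpha>}" if "x \<in> ?D" for x
      using that unfolding derived_tree_def by blast
    have sB: "sm B" unfolding B_def
      by (rule small_UN[OF inf seg_le]) (rule derived_level_small[OF s])
    then show "small TYPE('a) B" unfolding small_def .
    have "(UNIV :: 'a option option set) = insert None (Some ` insert None (Some ` UNIV))"
      by (auto simp: UNIV_option_conv)
    then have "(UNIV :: 'a option option set) = {None, Some None} \<union> (\<lambda>a. Some (Some a)) ` UNIV"
      by auto
    moreover have "small TYPE('a) ({None, Some None} \<union> (\<lambda>a. Some (Some a)) ` (UNIV :: 'a set))"
      by (intro small_Un[OF inf] small_finite[OF inf] small_image small_UNIV) simp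
    ultimately show "small TYPE('a) (UNIV :: 'a option option set)" by simp
  next
    fix x assume x: "x \<in> ?D - B"
    obtain \<alpha> where \<alpha>: "dom x = {..<\<alpha>}" "r x < \<alpha>" using P[OF x] by blast
    then have d: "dom (x |` {..<r x}) = {..<r x}" by (intro dom_restrict_le) auto
    have "x |` {..<r x} \<in> ?D"
      using derived_restrict[OF s _ \<alpha>(1), where \<beta> = "r x"] x \<alpha>(2) by simp
    moreover have "x |` {..<r x} \<subseteq>\<^sub>m x" unfolding map_le_def by auto
    moreover have "x |` {..<r x} \<noteq> x"
    proof
      assume "x |` {..<r x} = x"
      then have "{..<r x} = {..<\<alpha>}" using d \<alpha>(1) by simp
      then show False using \<alpha>(2) by simp
    qed
    ultimately show "x |` {..<r x} \<in> ?D \<and> x |` {..<r x} \<subseteq>\<^sub>m x \<and> x |` {..<r x} \<noteq> x" by blast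
  next
    fix x y assume x: "x \<in> ?D - B" and y: "y \<in> ?D - B" and le: "x \<subseteq>\<^sub>m y"
      and g: "x |` {..<r x} = y |` {..<r y}" and k: "k x = k y"
    obtain \<alpha> where \<alpha>: "dom x = {..<\<alpha>}" "\<delta> \<le> r x" "r x < \<alpha>" and
      cx: "\<alpha> = suc (r x) \<and> k x = None \<or> is_lim \<alpha> \<and> k x = Some (ot \<alpha>) \<and> (\<forall>i\<le>n. walks_from \<alpha> (proj i x) (r x))"
      using P[OF x] by blast
    obtain \<alpha>' where \<alpha>': "dom y = {..<\<alpha>'}" "r y < \<alpha>'" and
      cy: "\<alpha>' = suc (r y) \<and> k y = None \<or> is_lim \<alpha>' \<and> k y = Some (ot \<alpha>') \<and> (\<forall>i\<le>n. walks_from \<alpha>' (proj i y) (r y))"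
      using P[OF y] by blast
    have yx: "y |` {..<\<alpha>} = x" using le map_le_restrict[OF \<alpha>(1)] by simp
    have "{..<r x} = {..<r y}"
      using arg_cong[OF g, of dom] dom_restrict_le[OF \<alpha>(1), of "r x"] dom_restrict_le[OF \<alpha>'(1), of "r y"]
        \<alpha>(3) \<alpha>'(2) by simp
    then have r: "r y = r x" by simp
    have "{..<\<alpha>} \<subseteq> {..<\<alpha>'}" using map_le_implies_dom_le[OF le] \<alpha>(1) \<alpha>'(1) by simp
    then have le': "\<alpha> \<le> \<alpha>'" by (auto simp: not_le[symmetric])
    have "\<alpha> = \<alpha>'"
    proof (rule ccontr)
      assume "\<alpha> \<noteq> \<alpha>'"
      then have lt: "\<alpha> < \<alpha>'" using le' by simp
      then have "\<not> (\<alpha> = suc (r x) \<and> \<alpha>' = suc (r y))" using r by auto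
      then have lim: "is_lim \<alpha>" "is_lim \<alpha>'" and ots: "ot \<alpha> = ot \<alpha>'"
        and wx: "\<And>i. i \<le> n \<Longrightarrow> walks_from \<alpha> (proj i x) (r x)"
        and wy: "\<And>i. i \<le> n \<Longrightarrow> walks_from \<alpha>' (proj i y) (r x)"
        using cx cy k r by auto
      have inj': "inj_on (\<lambda>i. proj i x |` {..<r x}) {..n}"
      proof (rule inj_onI)
        fix i j assume ij: "i \<in> {..n}" "j \<in> {..n}" "proj i x |` {..<r x} = proj j x |` {..<r x}"
        have "s l = (proj l x |` {..<r x}) |` {..<\<delta>}" if "l \<in> {..n}" for l
        proof -
          have "\<delta> \<le> \<alpha>" using \<alpha> by simp
          then have "proj l x |` {..<\<delta>} = s l"
            using derived_proj_restrict[OF s _ \<alpha>(1), where i = l] x that by simp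
          then show ?thesis unfolding restrict_restrict_le[OF \<alpha>(2)] by simp
        qed
        then have "s i = s j" using ij by metis
        then show "i = j" using inj ij(1,2) by (auto dest: inj_onD)
      qed
      have "proj i y |` {..<\<alpha>} = proj i x" for i
        using yx proj_restrict by metis
      then have "\<alpha> \<in> acc (Cs \<alpha>')" using walks_coherent[OF lim wx wy inj' lt] by simp
      then show False using ot ots by blast
    qed
    then show "x = y" using yx \<alpha>' restrict_id[of y "{..<\<alpha>'}"] by simp
  qed
qed

end

section \<open>Sealing antichains\<close>

text \<open>Connects clause (3) with jumps: the next ladder point after \<beta> has only \<beta>
  before it in the remaining ladder and is therefore not an accumulation point.\<close>

lemma suc_n_1_gap:
  assumes "gap C \<beta> \<gamma>" "\<gamma> \<in> C"
  shows "\<gamma> \<in> suc_n 1 (C - {..<\<beta>})"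
proof -
  have eq: "(C - {..<\<beta>}) \<inter> {..<\<gamma>} = {\<beta>}"
    using assms(1) unfolding gap_iff by (auto intro: order.not_eq_order_implies_strict)
  have lt: "\<beta> < \<gamma>" using assms(1) unfolding gap_def by simp
  have "\<not> sup_is {\<beta>} \<gamma>"
    using lt unfolding sup_is_def by (auto simp: not_le)
  then have "\<gamma> \<in> nacc (C - {..<\<beta>})"
    unfolding nacc_def acc_def using assms(2) lt eq by auto
  then show ?thesis unfolding suc_n_def using eq by simp
qed

locale guessing_construction = tree_construction Lam Kap h n Cs code Ds
  for Lam :: "'a itself" and Kap :: "'k::wellorder itself" and h :: "'k \<Rightarrow> 'h" and n Cs code Ds +
  assumes code: "inj_on code (lists nodes \<times> lists nodes)"
    and diamond: "\<And>X. stationary {\<alpha>. X \<inter> {..<\<alpha>} = Ds \<alpha>}"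
    and catch: "\<And>B. (\<And>i. cofinal (B i)) \<Longrightarrow>
      stationary {\<alpha>. \<forall>i<\<alpha>. \<forall>k::nat. sup_is {\<beta>\<in>Cs \<alpha>. suc_n k (Cs \<alpha> - {..<\<beta>}) \<subseteq> B i} \<alpha>}"
begin

abbreviation cuts :: "'k \<Rightarrow> ('k \<rightharpoonup> 'h) list \<Rightarrow> ('k \<rightharpoonup> 'h) list" where
  "cuts \<gamma> \<equiv> map (\<lambda>x. x |` {..<\<gamma>})"

lemma cuts_cuts: "\<beta> \<le> \<gamma> \<Longrightarrow> cuts \<beta> (cuts \<gamma> xs) = cuts \<beta> xs"
  by (simp add: comp_def restrict_restrict_le del: restrict_restrict)

text \<open>Level \<alpha> of a derived tree, with its nodes split into lists of coordinates: walks
  act on each coordinate, and lists are what \<open>code\<close> accepts. The equation fixes the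
  length and the base at once.\<close>

definition tuples :: "('k \<rightharpoonup> 'h) list \<Rightarrow> 'k \<Rightarrow> 'k \<Rightarrow> ('k \<rightharpoonup> 'h) list set" where
  "tuples s \<delta> \<alpha> = {xs \<in> lists (Lv \<alpha>). cuts \<delta> xs = s}"

lemma Lv_nodes: "Lv \<alpha> \<subseteq> nodes"
  unfolding nodes_def using Lv_dom by blast

lemma tuples_nodes: "xs \<in> tuples s \<delta> \<alpha> \<Longrightarrow> xs \<in> lists nodes"
  unfolding tuples_def using Lv_nodes[of \<alpha>] by auto

lemma tuples_length: "xs \<in> tuples s \<delta> \<alpha> \<Longrightarrow> length xs = length s"
  unfolding tuples_def by auto

lemma tuples_nth: "xs \<in> tuples s \<delta> \<alpha> \<Longrightarrow> j < length s \<Longrightarrow> xs ! j \<in> Lv \<alpha>"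
  unfolding tuples_def by auto

lemma tuples_cuts: "xs \<in> tuples s \<delta> \<alpha> \<Longrightarrow> \<delta> \<le> \<beta> \<Longrightarrow> \<beta> \<le> \<alpha> \<Longrightarrow> cuts \<beta> xs \<in> tuples s \<delta> \<beta>"
  unfolding tuples_def using Lv_restrict[of _ \<alpha> \<beta>] by (auto simp: cuts_cuts simp del: map_map)

lemma tuples_small: "sm (tuples s \<delta> \<alpha>)"
  by (rule small_subset[OF small_lists[OF inf Lv_small[of \<alpha>]]]) (auto simp: tuples_def)

lemma tuples_extend:
  assumes ys: "ys \<in> tuples s \<delta> \<eta>" and le: "\<delta> \<le> \<eta>" "\<eta> \<le> \<gamma>"
  obtains us where "us \<in> tuples s \<delta> \<gamma>" "cuts \<eta> us = ys"
proof -
  have "\<forall>y\<in>set ys. \<exists>u. u \<in> Lv \<gamma> \<and> u |` {..<\<eta>} = y"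
    using ys Lv_extend[OF _ le(2)] unfolding tuples_def by blast
  then have "\<exists>f. \<forall>y\<in>set ys. f y \<in> Lv \<gamma> \<and> f y |` {..<\<eta>} = y" by (rule bchoice)
  then obtain f where f: "\<And>y. y \<in> set ys \<Longrightarrow> f y \<in> Lv \<gamma> \<and> f y |` {..<\<eta>} = y" by blast
  have c: "cuts \<eta> (map f ys) = ys" using f by (simp add: map_idI)
  have "cuts \<delta> (map f ys) = cuts \<delta> (cuts \<eta> (map f ys))" by (rule cuts_cuts[OF le(1), symmetric])
  then have "map f ys \<in> tuples s \<delta> \<gamma>"
    unfolding c using ys f unfolding tuples_def by auto
  then show ?thesis using that c by blast
qed

lemma tuples_inj:
  assumes us: "us \<in> tuples s \<delta> \<gamma>" and s: "distinct s" and le: "\<delta> \<le> \<beta>"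
  shows "inj_on (\<lambda>u. u |` {..<\<beta>}) (set us)"
proof -
  have "inj_on (\<lambda>u. u |` {..<\<delta>}) (set us)"
    using us s unfolding tuples_def by (auto simp: distinct_map)
  moreover have "u |` {..<\<delta>} = (u |` {..<\<beta>}) |` {..<\<delta>}" for u :: "'k \<rightharpoonup> 'h"
    by (simp only: restrict_restrict_le[OF le])
  ultimately show ?thesis unfolding inj_on_def by metis
qed

lemma common_start:
  assumes lim: "is_lim \<alpha>" and \<delta>: "\<delta> < \<alpha>" and zs: "finite Z" "Z \<subseteq> Lv \<alpha>"
  obtains \<gamma> where "\<delta> \<le> \<gamma>" "\<gamma> \<in> Cs \<alpha>" "\<And>z. z \<in> Z \<Longrightarrow> walks_from \<alpha> z \<gamma>"
proof -
  have "\<exists>\<gamma>\<in>Cs \<alpha>. \<delta> < \<gamma> \<and> (\<forall>z\<in>Z. walks_from \<alpha> z \<gamma>)"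
    using zs
  proof (induction Z rule: finite_induct)
    case empty
    then show ?case using unbd_Cs[OF lim] \<delta> unfolding unbd_def by blast
  next
    case (insert z Z)
    then obtain \<gamma> where \<gamma>: "\<gamma> \<in> Cs \<alpha>" "\<delta> < \<gamma>" "\<forall>z\<in>Z. walks_from \<alpha> z \<gamma>" by blast
    obtain \<gamma>' where \<gamma>': "walks_from \<alpha> z \<gamma>'" using insert.prems Lv_walks_from[OF level_ok_all lim] by blast
    have C': "\<gamma>' \<in> Cs \<alpha>" using \<gamma>' unfolding walks_from_def by simp
    show ?case
    proof (rule bexI[of _ "max \<gamma> \<gamma>'"])
      show C: "max \<gamma> \<gamma>' \<in> Cs \<alpha>" using C' \<gamma>(1) by (simp add: max_def)
      have "walks_from \<alpha> z' (max \<gamma> \<gamma>')" if "z' \<in> insert z Z" for z'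
        using that \<gamma>(3) walks_from_mono[OF level_ok_all lim \<gamma>' C]
          walks_from_mono[OF level_ok_all lim _ C, of z' \<gamma>] by auto
      then show "\<delta> < max \<gamma> \<gamma>' \<and> (\<forall>z\<in>insert z Z. walks_from \<alpha> z (max \<gamma> \<gamma>'))"
        using \<gamma>(2) by (simp add: less_max_iff_disj)
    qed
  qed
  then show ?thesis using that order_less_imp_le by blast
qed

text \<open>A tuple of a limit level is caught by taking for the index \<open>i\<close> of clause (3) a code of the tuple
  of nodes at which its walks start.\<close>

lemma seal:
  assumes s: "distinct s" "0 < length s" "length s \<le> n"
    and dense: "\<And>\<alpha> xs. \<delta> \<le> \<alpha> \<Longrightarrow> xs \<in> tuples s \<delta> \<alpha> \<Longrightarrow> \<exists>\<beta>\<ge>\<alpha>. \<exists>ys\<in>D \<inter> tuples s \<delta> \<beta>. cuts \<alpha> ys = xs"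
    and up: "\<And>\<beta> \<gamma> ys zs. \<delta> \<le> \<beta> \<Longrightarrow> \<beta> \<le> \<gamma> \<Longrightarrow> ys \<in> D \<inter> tuples s \<delta> \<beta> \<Longrightarrow> zs \<in> tuples s \<delta> \<gamma> \<Longrightarrow> cuts \<beta> zs = ys \<Longrightarrow> zs \<in> D"
  shows "\<exists>\<alpha>\<ge>\<delta>. tuples s \<delta> \<alpha> \<subseteq> D"
proof -
  let ?T = "tuples s \<delta>"
  \<comment> \<open>A closure point \<gamma> of such bounds has, above every tuple of a level
    between \<delta> and \<gamma>, an element of \<open>D\<close> whose height and whose code are
    both below \<gamma>; so a correct guess at \<gamma> sees it. The bound exists because a level
    has at most lambda tuples.\<close>
  let ?G = "\<lambda>x \<beta> v. suc \<beta> < v \<and> (\<delta> \<le> \<beta> \<longrightarrow> (\<forall>xs\<in>?T \<beta>. \<exists>\<eta><v. \<exists>ys\<in>D \<inter> ?T \<eta>. \<delta> \<le> \<eta> \<and> \<beta> \<le> \<eta> \<and> cuts \<beta> ys = xs \<and> code (x, ys) < v))"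
  have "\<exists>v. ?G x \<beta> v" for x \<beta>
  proof -
    let ?Q = "\<lambda>xs v. \<delta> \<le> \<beta> \<longrightarrow> (\<exists>\<eta><v. \<exists>ys\<in>D \<inter> ?T \<eta>. \<delta> \<le> \<eta> \<and> \<beta> \<le> \<eta> \<and> cuts \<beta> ys = xs \<and> code (x, ys) < v)"
    have Q: "\<exists>v. ?Q xs v" if "xs \<in> ?T \<beta>" for xs
    proof (cases "\<delta> \<le> \<beta>")
      case True
      then obtain \<eta> ys where y: "\<beta> \<le> \<eta>" "ys \<in> D \<inter> ?T \<eta>" "cuts \<beta> ys = xs" using dense \<open>xs \<in> ?T \<beta>\<close> by blast
      obtain v where v: "max \<eta> (code (x, ys)) < v" using no_top by blast
      then have "\<eta> < v" "code (x, ys) < v" by simp_all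
      moreover have "\<delta> \<le> \<eta>" using True y(1) by simp
      ultimately show ?thesis using y by blast
    qed simp
    then have "\<exists>f. \<forall>xs\<in>?T \<beta>. ?Q xs (f xs)" by (intro bchoice ballI)
    then obtain f where f: "\<And>xs. xs \<in> ?T \<beta> \<Longrightarrow> ?Q xs (f xs)" by blast
    obtain v where v: "\<forall>xs\<in>?T \<beta>. f xs < v" using bdd_fun[OF tuples_small] by blast
    obtain v' where "max v (suc \<beta>) < v'" using no_top by blast
    then have v': "v < v'" "suc \<beta> < v'" by simp_all
    have "\<exists>\<eta><v'. \<exists>ys\<in>D \<inter> ?T \<eta>. \<delta> \<le> \<eta> \<and> \<beta> \<le> \<eta> \<and> cuts \<beta> ys = xs \<and> code (x, ys) < v'" if le: "\<delta> \<le> \<beta>" and mem: "xs \<in> ?T \<beta>" for xs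
    proof -
      have "f xs < v'" using v v'(1) mem by (meson order.strict_trans)
      moreover obtain \<eta> ys where "\<eta> < f xs" "ys \<in> D \<inter> ?T \<eta>" "\<delta> \<le> \<eta>" "\<beta> \<le> \<eta>" "cuts \<beta> ys = xs" "code (x, ys) < f xs"
        using f[OF mem] le by blast
      ultimately show ?thesis using order.strict_trans by blast
    qed
    then show ?thesis using v'(2) by blast
  qed
  then have "\<forall>x. \<exists>g. \<forall>\<beta>. ?G x \<beta> (g \<beta>)" by (intro allI choice)
  then have "\<exists>g. \<forall>x \<beta>. ?G x \<beta> (g x \<beta>)" by (rule choice)
  then obtain g where g: "\<And>x \<beta>. ?G x \<beta> (g x \<beta>)" by blast
  \<comment> \<open>Each set to be guessed mentions a single starting tuple. A correct guess of
    \<open>X x\<close> therefore cannot divert the jump map to the needs of another tuple.\<close>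
  define X where "X x = code ` ({x} \<times> (D \<inter> (\<Union>\<eta>\<in>{\<delta>..}. ?T \<eta>)))" for x
  \<comment> \<open>Pairing with the empty list turns \<open>code\<close> into an indexing of
    starting tuples; at other indices \<open>dec\<close> is arbitrary.\<close>
  define dec where "dec i = (SOME x. x \<in> lists nodes \<and> code (x, []) = i)" for i
  have dec: "dec (code (x, [])) = x" if "x \<in> lists nodes" for x
  proof -
    have "\<exists>y. y \<in> lists nodes \<and> code (y, []) = code (x, [])" using that by blast
    then have "dec (code (x, [])) \<in> lists nodes \<and> code (dec (code (x, [])), []) = code (x, [])"
      unfolding dec_def by (rule someI_ex)
    then show ?thesis using inj_onD[OF code, of "(dec (code (x, [])), [])" "(x, [])"] that by simp
  qed
  define B where "B i = {\<gamma> \<in> {\<alpha>. X (dec i) \<inter> {..<\<alpha>} = Ds \<alpha>}. \<delta> < \<gamma> \<and> (\<forall>\<beta><\<gamma>. g (dec i) \<beta> < \<gamma>)}" for i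
  have "cofinal (B i)" for i
    unfolding B_def by (rule stationary_Int_club_cofinal[OF diamond])
  then have stat: "stationary {\<alpha>. \<forall>i<\<alpha>. \<forall>k::nat. sup_is {\<beta>\<in>Cs \<alpha>. suc_n k (Cs \<alpha> - {..<\<beta>}) \<subseteq> B i} \<alpha>}"
    by (rule catch)
  \<comment> \<open>Clause (3) handles only the indices below \<alpha>. A closure point \<alpha> of
    these bounds is a limit and contains the index of every tuple of a smaller level, in particular
    of every possible start.\<close>
  have "\<exists>v. suc \<beta> < v \<and> (\<forall>xs\<in>?T \<beta>. code (xs, []) < v)" for \<beta>
  proof -
    obtain v where v: "\<forall>xs\<in>?T \<beta>. code (xs, []) < v" using bdd_fun[OF tuples_small, where f = "\<lambda>xs. code (xs, [])"] by blast
    obtain v' where "max v (suc \<beta>) < v'" using no_top by blast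
    then have "v < v'" "suc \<beta> < v'" by simp_all
    then show ?thesis using v order.strict_trans by blast
  qed
  then obtain g' where g': "\<And>\<beta>. suc \<beta> < g' \<beta>" "\<And>\<beta> xs. xs \<in> ?T \<beta> \<Longrightarrow> code (xs, []) < g' \<beta>"
    using choice[of "\<lambda>\<beta> v. suc \<beta> < v \<and> (\<forall>xs\<in>?T \<beta>. code (xs, []) < v)"] by blast
  obtain \<alpha> where catch: "\<And>i. i < \<alpha> \<Longrightarrow> sup_is {\<beta>\<in>Cs \<alpha>. suc_n 1 (Cs \<alpha> - {..<\<beta>}) \<subseteq> B i} \<alpha>"
    and \<alpha>: "\<delta> < \<alpha>" "\<And>\<beta>. \<beta> < \<alpha> \<Longrightarrow> g' \<beta> < \<alpha>"
    using stat club_closure_points[of \<delta> g'] unfolding stationary_def by blast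
  have lim: "is_lim \<alpha>"
    unfolding is_lim_def positive_def using \<alpha> g'(1) order.strict_trans by blast
  have "zs \<in> D" if zs: "zs \<in> ?T \<alpha>" for zs
  proof -
    have len: "length zs = length s" by (rule tuples_length[OF zs])
    obtain \<gamma>\<^sub>0 where \<gamma>0: "\<delta> \<le> \<gamma>\<^sub>0" "\<gamma>\<^sub>0 \<in> Cs \<alpha>" and walk: "\<And>z. z \<in> set zs \<Longrightarrow> walks_from \<alpha> z \<gamma>\<^sub>0"
      using common_start[OF lim \<alpha>(1), of "set zs"] zs unfolding tuples_def by auto
    define x where "x = cuts \<gamma>\<^sub>0 zs"
    have x: "x \<in> ?T \<gamma>\<^sub>0" unfolding x_def using tuples_cuts[OF zs \<gamma>0(1)] Cs_less[OF \<gamma>0(2)] by simp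
    have "code (x, []) < \<alpha>"
      using g'(2)[OF x] \<alpha>(2)[OF Cs_less[OF \<gamma>0(2)]] by simp
    from sup_isD[OF catch[OF this] Cs_less[OF \<gamma>0(2)]]
    obtain \<beta> where \<beta>: "\<beta> \<in> Cs \<alpha>" "\<gamma>\<^sub>0 < \<beta>" and sub: "suc_n 1 (Cs \<alpha> - {..<\<beta>}) \<subseteq> B (code (x, []))" by blast
    obtain \<gamma> where \<gamma>: "\<gamma> \<in> Cs \<alpha>" "\<beta> < \<gamma>" "Cs \<alpha> \<inter> {\<beta><..<\<gamma>} = {}"
      using Cs_next[OF level_ok_all lim Cs_less[OF \<beta>(1)]] by blast
    then have gap: "gap (Cs \<alpha>) \<beta> \<gamma>" unfolding gap_def using \<beta> by simp
    have "\<gamma> \<in> B (code (x, []))" using suc_n_1_gap[OF gap \<gamma>(1)] sub by blast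
    then have \<gamma>B: "X x \<inter> {..<\<gamma>} = Ds \<gamma>" "\<And>\<xi>. \<xi> < \<gamma> \<Longrightarrow> g x \<xi> < \<gamma>"
      unfolding B_def dec[OF tuples_nodes[OF x]] by auto
    have \<gamma>\<alpha>: "\<gamma> < \<alpha>" by (rule Cs_less[OF \<gamma>(1)])
    \<comment> \<open>The element of \<open>D\<close> must extend the tuple after its marks at
      \<beta> have been written, so the bounds are applied at \<open>suc \<beta>\<close>, which has
      to be below \<gamma>.\<close>
    have \<beta>\<gamma>: "suc \<beta> < \<gamma>" using g[of \<beta> x] \<gamma>B(2)[OF \<gamma>(2)] by (meson order.strict_trans)
    have \<delta>\<beta>: "\<delta> \<le> suc \<beta>" using \<gamma>0(1) \<beta>(2) suc_gt[of \<beta>] by simp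
    have "suc \<beta> \<le> \<alpha>" using \<beta>\<gamma> \<gamma>\<alpha> by simp
    then have v: "cuts (suc \<beta>) zs \<in> ?T (suc \<beta>)" by (rule tuples_cuts[OF zs \<delta>\<beta>])
    obtain \<eta> ys where ys: "\<eta> < \<gamma>" "ys \<in> D \<inter> ?T \<eta>" "\<delta> \<le> \<eta>" "suc \<beta> \<le> \<eta>" "cuts (suc \<beta>) ys = cuts (suc \<beta>) zs" "code (x, ys) < \<gamma>"
    proof -
      obtain \<eta> ys where "\<eta> < g x (suc \<beta>)" "ys \<in> D \<inter> ?T \<eta>" "\<delta> \<le> \<eta>" "suc \<beta> \<le> \<eta>" "cuts (suc \<beta>) ys = cuts (suc \<beta>) zs"
          "code (x, ys) < g x (suc \<beta>)"
        using g[of "suc \<beta>" x] \<delta>\<beta> v by blast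
      then show ?thesis using that \<gamma>B(2)[OF \<beta>\<gamma>] order.strict_trans by blast
    qed
    have yT: "ys \<in> ?T \<eta>" using ys(2) by simp
    have "code (x, ys) \<in> X x" unfolding X_def using ys(2,3) by auto
    then have guess: "code (x, ys) \<in> Ds \<gamma>" using \<gamma>B(1) ys(6) by blast
    have le: "\<eta> \<le> \<gamma>" using ys(1) by simp
    \<comment> \<open>The invariant prescribes values in level \<gamma>, whereas \<open>ys\<close>
      may live lower; any prolongation will do. Its nodes are at most \<open>n\<close> in number and
      have distinct restrictions already at \<delta>, so a promise-keeping map through them
      exists.\<close>
    obtain us where us: "us \<in> ?T \<gamma>" "cuts \<eta> us = ys" by (rule tuples_extend[OF yT ys(3) le])
    have uz: "cuts (suc \<beta>) us = cuts (suc \<beta>) zs"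
      using cuts_cuts[OF ys(4), of us] us(2) ys(5) by simp
    have lenu: "length us = length s" by (rule tuples_length[OF us(1)])
    have "card (set us) \<le> n" using card_length[of us] lenu s(3) by simp
    moreover have "set us \<subseteq> Lv \<gamma>" using us(1) unfolding tuples_def by auto
    moreover have "inj_on (\<lambda>u. u |` {..<suc \<beta>}) (set us)" by (rule tuples_inj[OF us(1) s(1) \<delta>\<beta>])
    ultimately obtain e where e: "good Lv \<beta> \<gamma> e" "\<And>u. u \<in> set us \<Longrightarrow> e (u |` {..<suc \<beta>}) = u"
      using level_ok_extend[OF level_ok \<gamma>(2), of "set us"] by blast
    have lb: "\<gamma>\<^sub>0 \<le> \<beta>" using \<beta>(2) by simp
    note wstep = walks_from_step[OF level_ok_all lim walk gap \<gamma>(1) lb]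
    have pt: "(Wk (Cs \<alpha>) \<beta> (x ! j))(\<beta> \<mapsto> h (supb (Cs \<alpha>) \<beta>)) = (zs ! j) |` {..<suc \<beta>}" if "j < length s" for j
    proof -
      have z: "zs ! j \<in> set zs" using that len by simp
      have "x ! j = (zs ! j) |` {..<\<gamma>\<^sub>0}" unfolding x_def using that len by simp
      then show ?thesis using wstep(1)[OF z] wstep(4)[OF z] by simp
    qed
    have "hits (Wk (Cs \<alpha>) \<beta>) (supb (Cs \<alpha>) \<beta>) \<beta> \<gamma> e"
      unfolding hits_def
    proof (intro exI conjI allI impI)
      show "x \<in> lists nodes" "ys \<in> lists nodes" by (rule tuples_nodes[OF x], rule tuples_nodes[OF yT])
      show "length ys = length x" using tuples_length[OF x] tuples_length[OF yT] by simp
      show "code (x, ys) \<in> Ds \<gamma>" by (rule guess)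
      fix j assume "j < length x"
      then have j: "j < length s" using tuples_length[OF x] by simp
      have "(us ! j) |` {..<suc \<beta>} = (zs ! j) |` {..<suc \<beta>}"
        using arg_cong[OF uz, of "\<lambda>l. l ! j"] j len lenu by simp
      then have "e ((zs ! j) |` {..<suc \<beta>}) = us ! j" using e(2)[of "us ! j"] j lenu by simp
      moreover have "(us ! j) |` {..<\<eta>} = ys ! j"
        using arg_cong[OF us(2), of "\<lambda>l. l ! j"] j lenu by simp
      then have "ys ! j \<subseteq>\<^sub>m us ! j"
        by (simp only: map_le_restrict[OF Lv_dom[OF tuples_nth[OF yT j]]])
      ultimately show "ys ! j \<subseteq>\<^sub>m e ((Wk (Cs \<alpha>) \<beta> (x ! j))(\<beta> \<mapsto> h (supb (Cs \<alpha>) \<beta>)))"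
        unfolding pt[OF j] by simp
    qed
    \<comment> \<open>The map chosen by \<open>step\<close> need not be \<open>e\<close> and may
      realize another guessed pair. But all pairs guessed at \<gamma> come from \<open>X x\<close>,
      so the pair still consists of \<open>x\<close> and an element of \<open>D\<close>, which is
      all that upward closure requires.\<close>
    from step_hits[OF level_ok \<gamma>(2) e(1) this] obtain x' l where
      l: "x' \<in> lists nodes" "l \<in> lists nodes" "code (x', l) \<in> Ds \<gamma>" and
      hit: "\<And>j. j < length x' \<Longrightarrow> l ! j \<subseteq>\<^sub>m st (Cs \<alpha>) \<beta> \<gamma> ((Wk (Cs \<alpha>) \<beta> (x' ! j))(\<beta> \<mapsto> h (supb (Cs \<alpha>) \<beta>)))"
      unfolding hits_def by blast
    have "code (x', l) \<in> X x" using l(3) \<gamma>B(1) by blast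
    then obtain d \<eta>' where d: "code (x', l) = code (x, d)" "d \<in> D \<inter> ?T \<eta>'" "\<delta> \<le> \<eta>'" unfolding X_def by auto
    have "(x', l) = (x, d)"
      by (rule inj_onD[OF code d(1)]) (use l(1,2) tuples_nodes[OF x] tuples_nodes[of d s \<delta> \<eta>'] d(2) in blast)+
    then have xl: "x' = x" "l = d" by simp_all
    have dT: "d \<in> ?T \<eta>'" using d(2) by simp
    have sub: "d ! j \<subseteq>\<^sub>m (zs ! j) |` {..<\<gamma>}" if "j < length s" for j
    proof -
      have z: "zs ! j \<in> set zs" using that len by simp
      have "j < length x'" using that tuples_length[OF x] xl by simp
      from hit[OF this] show ?thesis unfolding xl pt[OF that] wstep(3)[OF z, symmetric] .
    qed
    have domd: "dom (d ! j) = {..<\<eta>'}" if "j < length s" for j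
      by (rule Lv_dom[OF tuples_nth[OF dT that]])
    have "{..<\<eta>'} \<subseteq> {..<\<gamma>}"
      using map_le_implies_dom_le[OF sub[OF s(2)]] domd[OF s(2)] by auto
    then have "\<eta>' \<le> \<gamma>" by (auto simp: not_le[symmetric])
    then have \<eta>': "\<eta>' \<le> \<alpha>" using \<gamma>\<alpha> by simp
    have "cuts \<eta>' zs = d"
    proof (rule nth_equalityI)
      show "length (cuts \<eta>' zs) = length d" using len tuples_length[OF dT] by simp
      fix j assume "j < length (cuts \<eta>' zs)"
      then have j: "j < length s" using len by simp
      have "(zs ! j) |` {..<\<gamma>} \<subseteq>\<^sub>m zs ! j" unfolding map_le_def by auto
      from map_le_trans[OF sub[OF j] this] have "(zs ! j) |` {..<\<eta>'} = d ! j"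
        by (simp only: map_le_restrict[OF domd[OF j]])
      then show "cuts \<eta>' zs ! j = d ! j" using j len by simp
    qed
    from up[OF d(3) \<eta>' d(2) zs this] show ?thesis .
  qed
  then show ?thesis using \<alpha>(1) order_less_imp_le by blast
qed


section \<open>Derived trees of at most n coordinates are Souslin\<close>

context
  fixes m :: nat and s :: "nat \<Rightarrow> ('k \<rightharpoonup> 'h)" and \<delta> :: 'k
  assumes s: "\<forall>i<m. s i \<in> Lv \<delta>" and inj: "inj_on s {..<m}" and m: "0 < m" "m \<le> n"
begin

abbreviation "base \<equiv> map s [0..<m]"

lemma derived_tuple:
  assumes a: "a \<in> derived_tree m tree s" "dom a = {..<\<beta>}" and le: "\<delta> \<le> \<alpha>" "\<alpha> \<le> \<beta>"
  shows "map (\<lambda>j. proj j a |` {..<\<alpha>}) [0..<m] \<in> tuples base \<delta> \<alpha>"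
proof -
  have le': "\<delta> \<le> \<beta>" using le by simp
  have "(proj j a |` {..<\<alpha>}) |` {..<\<delta>} = s j" if "j < m" for j
    unfolding restrict_restrict_le[OF le(1)] by (rule derived_proj_restrict[OF s a le' that])
  moreover have "proj j a |` {..<\<alpha>} \<in> Lv \<alpha>" if "j < m" for j
    by (rule Lv_restrict[OF derivedD(2)[OF s a that] le(2)])
  ultimately show ?thesis unfolding tuples_def by (auto simp del: restrict_restrict)
qed

text \<open>The tuples lying above a member of \<open>A\<close> or below none form a dense, upward
  closed set, so some level \<alpha> lies entirely within it. A member of \<open>A\<close> higher
  than \<alpha> has a restriction to \<alpha> that is below a member, hence above one; two
  comparable members of different heights contradict the antichain property. So \<open>A\<close>
  lives on the levels up to \<alpha>.\<close>

lemma derived_antichain_small: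
  assumes A: "A \<subseteq> derived_tree m tree s" "antichain A"
  shows "sm A"
proof -
  let ?D = "derived_tree m tree s"
  let ?below = "\<lambda>a ys. \<forall>j<m. proj j a \<subseteq>\<^sub>m ys ! j" and ?above = "\<lambda>a ys. \<forall>j<m. ys ! j \<subseteq>\<^sub>m proj j a"
  define D where "D = {ys. (\<exists>a\<in>A. ?below a ys) \<or> (\<forall>a\<in>A. \<not> ?above a ys)}"
  have len: "length base = m" by simp
  have domt: "dom (ys ! j) = {..<\<gamma>}" if "ys \<in> tuples base \<delta> \<gamma>" "j < m" for ys j \<gamma>
    by (rule Lv_dom[OF tuples_nth[OF that(1)]]) (use that in simp)
  have "\<exists>\<alpha>\<ge>\<delta>. tuples base \<delta> \<alpha> \<subseteq> D"
  proof (rule seal)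
    show "distinct base" using inj by (simp add: distinct_map lessThan_atLeast0)
    show "0 < length base" "length base \<le> n" using m by simp_all
  next
    fix \<alpha> xs assume \<alpha>: "\<delta> \<le> \<alpha>" and xs: "xs \<in> tuples base \<delta> \<alpha>"
    show "\<exists>\<beta>\<ge>\<alpha>. \<exists>ys\<in>D \<inter> tuples base \<delta> \<beta>. cuts \<alpha> ys = xs"
    proof (cases "xs \<in> D")
      case True
      have "cuts \<alpha> xs = xs"
        using xs Lv_dom[of _ \<alpha>] unfolding tuples_def by (auto intro!: map_idI restrict_id)
      then show ?thesis using True xs by blast
    next
      case False
      then obtain a where a: "a \<in> A" "?above a xs" unfolding D_def by blast
      have aD: "a \<in> ?D" using a(1) A(1) by blast
      then obtain \<beta> where \<beta>: "dom a = {..<\<beta>}" using derived_dom by blast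
      have "{..<\<alpha>} \<subseteq> {..<\<beta>}"
        using map_le_implies_dom_le[of "xs ! 0" "proj 0 a"] a(2) domt[OF xs m(1)] m(1) \<beta> dom_proj[of 0 a] by simp
      then have le: "\<alpha> \<le> \<beta>" by (auto simp: not_le[symmetric])
      let ?ys = "map (\<lambda>j. proj j a |` {..<\<beta>}) [0..<m]"
      have id: "proj j a |` {..<\<beta>} = proj j a" for j using dom_proj[of j a] \<beta> by (intro restrict_id) simp
      have "\<delta> \<le> \<beta>" using \<alpha> le by simp
      then have ys: "?ys \<in> tuples base \<delta> \<beta>" by (rule derived_tuple[OF aD \<beta> _ order_refl])
      have "?below a ?ys" using id by simp
      then have "?ys \<in> D" unfolding D_def using a(1) by blast
      moreover have "cuts \<alpha> ?ys = xs"
      proof (rule nth_equalityI)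
        show "length (cuts \<alpha> ?ys) = length xs" using tuples_length[OF xs] by simp
        fix j assume "j < length (cuts \<alpha> ?ys)"
        then have j: "j < m" by simp
        have "proj j a |` {..<\<alpha>} = xs ! j"
          by (rule iffD1[OF map_le_restrict[OF domt[OF xs j]]]) (use a(2) j in blast)
        then show "cuts \<alpha> ?ys ! j = xs ! j" using j id by simp
      qed
      ultimately show ?thesis using ys le by blast
    qed
  next
    fix \<beta> \<gamma> ys zs
    assume "\<beta> \<le> \<gamma>" and ys: "ys \<in> D \<inter> tuples base \<delta> \<beta>" and zs: "zs \<in> tuples base \<delta> \<gamma>" and eq: "cuts \<beta> zs = ys"
    have yz: "ys ! j \<subseteq>\<^sub>m zs ! j" if "j < m" for j
    proof -
      have "j < length zs" using that tuples_length[OF zs] by simp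
      then have "ys ! j = (zs ! j) |` {..<\<beta>}" unfolding eq[symmetric] by simp
      then show ?thesis unfolding map_le_def by simp
    qed
    have "ys \<in> D" using ys by blast
    then show "zs \<in> D" unfolding D_def using yz map_le_trans by blast
  qed
  then obtain \<alpha> where \<alpha>: "\<delta> \<le> \<alpha>" "tuples base \<delta> \<alpha> \<subseteq> D" by blast
  have "A \<subseteq> (\<Union>\<beta>\<in>{..\<alpha>}. level ?D \<beta>)"
  proof
    fix a assume a: "a \<in> A"
    then have aD: "a \<in> ?D" using A(1) by blast
    then obtain \<beta> where \<beta>: "dom a = {..<\<beta>}" using derived_dom by blast
    have "\<beta> \<le> \<alpha>"
    proof (rule ccontr)
      assume no: "\<not> \<beta> \<le> \<alpha>"
      then have le: "\<alpha> \<le> \<beta>" by simp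
      let ?zs = "map (\<lambda>j. proj j a |` {..<\<alpha>}) [0..<m]"
      have "?zs \<in> D" using derived_tuple[OF aD \<beta> \<alpha>(1) le] \<alpha>(2) by blast
      moreover have cut: "proj j a |` {..<\<alpha>} \<subseteq>\<^sub>m proj j a" for j unfolding map_le_def by simp
      then have "?above a ?zs" by simp
      ultimately obtain a' where a': "a' \<in> A" "?below a' ?zs" unfolding D_def using a by blast
      have aD': "a' \<in> ?D" using a'(1) A(1) by blast
      then obtain \<beta>' where \<beta>': "dom a' = {..<\<beta>'}" using derived_dom by blast
      have le2: "proj j a' \<subseteq>\<^sub>m proj j a |` {..<\<alpha>}" if "j < m" for j using a'(2) that by simp
      have "{..<\<beta>'} \<subseteq> {..<\<alpha>}"
        using map_le_implies_dom_le[OF le2[OF m(1)]] \<beta>' dom_proj[of 0 a'] by auto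
      then have \<beta>'\<alpha>: "\<beta>' \<le> \<alpha>" by (auto simp: not_le[symmetric])
      then have \<beta>'\<beta>: "\<beta>' \<le> \<beta>" using le by simp
      have "proj j a' = proj j (a |` {..<\<beta>'})" if "j < m" for j
      proof -
        have d: "dom (proj j a') = {..<\<beta>'}" using \<beta>' dom_proj[of j a'] by simp
        have "proj j a |` {..<\<beta>'} = proj j a'"
          by (rule iffD1[OF map_le_restrict[OF d] map_le_trans[OF le2[OF that] cut]])
        then show ?thesis unfolding proj_restrict by simp
      qed
      then have eq: "a' = a |` {..<\<beta>'}"
        using derived_eqI[OF s aD' derived_restrict[OF s aD \<beta> \<beta>'\<beta>] \<beta>' dom_restrict_le[OF \<beta> \<beta>'\<beta>]] by blast
      then have "a' \<subseteq>\<^sub>m a" unfolding map_le_def by simp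
      then have "a' = a" using A(2) a a'(1) unfolding antichain_def by blast
      then have "{..<\<beta>'} = {..<\<beta>}" using \<beta> \<beta>' by simp
      then show False using \<beta>'\<alpha> no by simp
    qed
    then show "a \<in> (\<Union>\<beta>\<in>{..\<alpha>}. level ?D \<beta>)" unfolding level_def using aD \<beta> by blast
  qed
  then show ?thesis
    by (rule small_subset[rotated]) (rule small_UN[OF inf seg_le derived_level_small[OF s]])
qed

text \<open>Every node of a branch above \<delta> has an immediate successor off the branch. These
  offshoots form an antichain of size lambda^+.\<close>

lemma derived_no_branch:
  assumes f: "\<And>\<beta>. (Some \<circ> f) |` {..<\<beta>} \<in> derived_tree m tree s"
  shows False
proof -
  let ?D = "derived_tree m tree s" and ?b = "\<lambda>\<beta>. (Some \<circ> f) |` {..<\<beta>}"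
  have domb: "dom (?b \<beta>) = {..<\<beta>}" for \<beta> by auto
  have "\<exists>x\<in>?D. dom x = {..<suc \<beta>} \<and> x |` {..<\<beta>} = ?b \<beta> \<and> x \<noteq> ?b (suc \<beta>)" if \<beta>: "\<delta> < \<beta>" for \<beta>
  proof -
    define z where "z \<iota> i = (proj i (?b \<beta>))(\<beta> \<mapsto> h \<iota>)" for \<iota> i
    have pL: "proj i (?b \<beta>) \<in> Lv \<beta>" if "i < m" for i by (rule derivedD(2)[OF s f domb that])
    have zL: "z \<iota> i \<in> Lv (suc \<beta>)" if "\<iota> \<le> \<beta>" "i < m" for \<iota> i
      unfolding z_def by (rule Lv_sucI[OF pL[OF that(2)] that(1)])
    have zr: "z \<iota> i |` {..<\<beta>} = proj i (?b \<beta>)" if "i < m" for \<iota> i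
      unfolding z_def by (rule restrict_upd[OF pL[OF that] Lv_dom[OF pL[OF that]]])
    have le: "\<delta> \<le> \<beta>" "\<beta> \<le> suc \<beta>" using \<beta> suc_gt[of \<beta>] by simp_all
    let ?x = "\<lambda>\<iota>. zip_nodes m (suc \<beta>) (z \<iota>)"
    have x: "?x \<iota> \<in> ?D" "?x \<iota> |` {..<\<beta>} = ?b \<beta>" if "\<iota> \<le> \<beta>" for \<iota>
      using derived_extend[OF s f domb le(1) zL[OF that] zr le(2)] by blast+
    \<comment> \<open>The ordinals \<delta> and \<beta> serve as two different admissible values at
      position \<beta>, so at least one of the two extensions leaves the branch.\<close>
    have "?x \<delta> \<noteq> ?x \<beta>"
    proof
      assume "?x \<delta> = ?x \<beta>"
      then have "proj 0 (?x \<delta>) \<beta> = proj 0 (?x \<beta>) \<beta>" by simp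
      then have "h \<delta> = h \<beta>" unfolding proj_def zip_nodes_def z_def using m(1) suc_gt[of \<beta>] by simp
      then show False using h \<beta> by (auto dest: injD)
    qed
    then have "?x \<delta> \<noteq> ?b (suc \<beta>) \<or> ?x \<beta> \<noteq> ?b (suc \<beta>)" by metis
    then show ?thesis
    proof
      assume "?x \<delta> \<noteq> ?b (suc \<beta>)"
      then show ?thesis using x[OF le(1)] dom_zip_nodes by blast
    next
      assume "?x \<beta> \<noteq> ?b (suc \<beta>)"
      then show ?thesis using x[OF order_refl] dom_zip_nodes by blast
    qed
  qed
  then have "\<forall>\<beta>\<in>{\<delta><..}. \<exists>x. x \<in> ?D \<and> dom x = {..<suc \<beta>} \<and> x |` {..<\<beta>} = ?b \<beta> \<and> x \<noteq> ?b (suc \<beta>)" by blast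
  then have "\<exists>g. \<forall>\<beta>\<in>{\<delta><..}. g \<beta> \<in> ?D \<and> dom (g \<beta>) = {..<suc \<beta>} \<and> g \<beta> |` {..<\<beta>} = ?b \<beta> \<and> g \<beta> \<noteq> ?b (suc \<beta>)"
    by (rule bchoice)
  then obtain g where g: "\<And>\<beta>. \<delta> < \<beta> \<Longrightarrow> g \<beta> \<in> ?D" "\<And>\<beta>. \<delta> < \<beta> \<Longrightarrow> dom (g \<beta>) = {..<suc \<beta>}"
    "\<And>\<beta>. \<delta> < \<beta> \<Longrightarrow> g \<beta> |` {..<\<beta>} = ?b \<beta>" "\<And>\<beta>. \<delta> < \<beta> \<Longrightarrow> g \<beta> \<noteq> ?b (suc \<beta>)" by auto
  have incomparable: "\<not> g \<beta> \<subseteq>\<^sub>m g \<gamma>" if "\<delta> < \<beta>" "\<delta> < \<gamma>" "\<beta> \<noteq> \<gamma>" for \<beta> \<gamma>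
  proof
    assume le: "g \<beta> \<subseteq>\<^sub>m g \<gamma>"
    then have "{..<suc \<beta>} \<subseteq> {..<suc \<gamma>}" using map_le_implies_dom_le[OF le] g(2) that by simp
    then have "\<beta> < suc \<gamma>" using suc_gt[of \<beta>] by (simp only: subset_iff lessThan_iff)
    then have lt: "suc \<beta> \<le> \<gamma>" using that(3) less_suc_iff[of \<beta> \<gamma>] suc_le_iff[of \<beta> \<gamma>] by simp
    have "g \<beta> = g \<gamma> |` {..<suc \<beta>}" by (rule iffD1[OF map_le_restrict[OF g(2)[OF that(1)]] le, symmetric])
    also have "\<dots> = (g \<gamma> |` {..<\<gamma>}) |` {..<suc \<beta>}" by (simp only: restrict_restrict_le[OF lt])
    also have "\<dots> = ?b (suc \<beta>)" unfolding g(3)[OF that(2)] by (rule restrict_restrict_le[OF lt])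
    finally show False using g(4)[OF that(1)] by simp
  qed
  have "antichain (g ` {\<delta><..})"
    unfolding antichain_def using incomparable by blast
  moreover have "g ` {\<delta><..} \<subseteq> ?D" using g(1) by auto
  ultimately have "sm (g ` {\<delta><..})" by (intro derived_antichain_small)
  moreover have "inj_on g {\<delta><..}"
  proof (rule inj_onI, rule ccontr)
    fix \<beta> \<gamma> assume "\<beta> \<in> {\<delta><..}" "\<gamma> \<in> {\<delta><..}" "g \<beta> = g \<gamma>" "\<beta> \<noteq> \<gamma>"
    then show False using incomparable[of \<beta> \<gamma>] by simp
  qed
  ultimately have "sm {\<delta><..}" using small_inj_on by blast
  then have "sm ({..\<delta>} \<union> {\<delta><..})" by (rule small_Un[OF inf seg_le])
  moreover have "{..\<delta>} \<union> {\<delta><..} = UNIV" by (auto simp: not_le[symmetric])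
  ultimately show False using not_small_UNIV by simp
qed

end

lemma not_small_antichain: "sm A \<Longrightarrow> (card_of (UNIV :: 'k set), card_of A) \<notin> ordLeq"
  using small_ordLess not_ordLess_ordLeq by blast

lemma souslin_derived:
  assumes "derived_seq m tree s" "0 < m" "m \<le> n"
  shows "souslin (derived_tree m tree s)"
proof -
  obtain \<delta> where s: "\<forall>i<m. s i \<in> Lv \<delta>" and inj: "inj_on s {..<m}"
    using derived_seqD[OF assms(1,2)] by auto
  show ?thesis
    unfolding souslin_def
    using derived_kappa_tree[OF s] derived_no_branch[OF s inj assms(2,3)]
      derived_antichain_small[OF s inj assms(2,3)] not_small_antichain by blast
qed

text \<open>The tree is the 1-derived tree over the empty node up to wrapping values into singleton
  lists. The wrapping \<open>L\<close> carries branches to branches and antichains to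
  antichains.\<close>

lemma souslin_tree:
  assumes n: "1 \<le> n"
  shows "souslin tree"
proof -
  obtain \<delta> where \<delta>: "\<not> positive (\<delta> :: 'k)" using zero_ex by blast
  define s where "s = (\<lambda>i :: nat. Map.empty :: 'k \<rightharpoonup> 'h)"
  have s: "\<forall>i<1. s i \<in> Lv \<delta>" unfolding s_def using Lv_0[OF \<delta>] by simp
  have inj: "inj_on s {..<1}" by (rule inj_onI) simp
  have no: "\<not> \<xi> < \<delta>" for \<xi> using \<delta> unfolding positive_def by blast
  let ?D = "derived_tree 1 tree s"
  define L :: "('k \<rightharpoonup> 'h) \<Rightarrow> ('k \<rightharpoonup> 'h list)" where "L x = (\<lambda>\<beta>. map_option (\<lambda>v. [v]) (x \<beta>))" for x
  have projL: "proj 0 (L x) = x" for x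
    unfolding proj_def L_def by (auto simp: option.map_comp comp_def option.map_ident)
  have domL: "dom (L x) = dom x" for x unfolding L_def by auto
  have LD: "L x \<in> ?D" if x: "x \<in> tree" for x
  proof -
    obtain \<alpha> where \<alpha>: "x \<in> Lv \<alpha>" using x unfolding tree_def by blast
    have d: "dom (L x) = {..<\<alpha>}" using domL Lv_dom[OF \<alpha>] by simp
    show ?thesis
    proof (rule derivedI[OF s d])
      show "length (the (L x \<beta>)) = 1" if "\<beta> < \<alpha>" for \<beta>
      proof -
        have "\<beta> \<in> dom x" using that Lv_dom[OF \<alpha>] by simp
        then show ?thesis unfolding L_def by auto
      qed
      show "proj i (L x) \<in> Lv \<alpha>" if "i < 1" for i using that projL \<alpha> by simp
      show "proj i (L x) \<xi> = s i \<xi>" if "\<xi> < \<delta>" for i \<xi> using that no by blast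
    qed
  qed
  have "False" if f: "\<forall>\<beta>. (Some \<circ> f) |` {..<\<beta>} \<in> tree" for f
  proof -
    have "(Some \<circ> (\<lambda>\<beta>. [f \<beta>])) |` {..<\<beta>} = L ((Some \<circ> f) |` {..<\<beta>})" for \<beta>
      unfolding L_def by (auto simp: restrict_map_def)
    then have "(Some \<circ> (\<lambda>\<beta>. [f \<beta>])) |` {..<\<beta>} \<in> ?D" for \<beta> using LD f by simp
    from derived_no_branch[OF s inj zero_less_one n this] show False .
  qed
  moreover have "sm A" if A: "A \<subseteq> tree" "antichain A" for A
  proof -
    have "antichain (L ` A)"
      unfolding antichain_def
    proof (intro ballI impI)
      fix x' y' assume "x' \<in> L ` A" "y' \<in> L ` A" "x' \<noteq> y'"
      then obtain x y where xy: "x \<in> A" "y \<in> A" "x' = L x" "y' = L y" "x \<noteq> y" by blast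
      have "\<not> x \<subseteq>\<^sub>m y" "\<not> y \<subseteq>\<^sub>m x" using A(2) xy unfolding antichain_def by blast+
      then show "\<not> x' \<subseteq>\<^sub>m y' \<and> \<not> y' \<subseteq>\<^sub>m x'"
        unfolding xy(3,4) using proj_map_le[of "L x" "L y" 0] proj_map_le[of "L y" "L x" 0] projL by auto
    qed
    moreover have "L ` A \<subseteq> ?D" using LD A(1) by blast
    ultimately have "sm (L ` A)" by (intro derived_antichain_small[OF s inj zero_less_one n])
    moreover have "inj_on L A" by (rule inj_onI) (metis projL)
    ultimately show ?thesis using small_inj_on by blast
  qed
  ultimately show ?thesis
    unfolding souslin_def using kappa_tree_tree not_small_antichain by blast
qed

end

section \<open>The theorem\<close>

lemma wo_rel_of_facts:
  assumes kappa: "(wo_rel_of :: ('k::wellorder) rel, cardSuc (card_of (UNIV :: 'a set))) \<in> ordIso"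
  shows "small TYPE('a) {..<\<alpha> :: 'k}" "\<not> small TYPE('a) (UNIV :: 'k set)"
proof -
  let ?r = "wo_rel_of :: 'k rel" and ?l = "card_of (UNIV :: 'a set)"
  have cl: "Card_order ?l" by (rule card_of_Card_order)
  have cs: "Card_order (cardSuc ?l)" by (rule cardSuc_Card_order[OF cl])
  have field: "Field ?r = UNIV" unfolding Field_def wo_rel_of_def by auto
  have cr: "Card_order ?r" by (rule Card_order_ordIso[OF cs kappa])
  have "underS ?r \<alpha> = {..<\<alpha>}" unfolding underS_def wo_rel_of_def by auto
  then have "(card_of {..<\<alpha>}, ?r) \<in> ordLess" using card_of_underS[OF cr, of \<alpha>] field by simp
  then have "(card_of {..<\<alpha>}, cardSuc ?l) \<in> ordLess" using kappa ordLess_ordIso_trans by blast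
  then show "small TYPE('a) {..<\<alpha>}"
    unfolding small_iff using cardSuc_ordLeq_ordLess[OF cl card_of_Card_order] by blast
  have "(card_of (UNIV :: 'k set), ?r) \<in> ordIso"
    using card_of_Field_ordIso[OF cr] unfolding field .
  then have "(cardSuc ?l, card_of (UNIV :: 'k set)) \<in> ordIso"
    using kappa ordIso_transitive ordIso_symmetric by blast
  then have "(?l, card_of (UNIV :: 'k set)) \<in> ordLess"
    using cardSuc_greater[OF cl] ordLess_ordIso_trans by blast
  then show "\<not> small TYPE('a) (UNIV :: 'k set)"
    unfolding small_iff using not_ordLess_ordLeq by blast
qed

text \<open>Regularity: an unbounded set of size at most lambda would cover lambda^+ by at most
  lambda segments, each of size at most lambda.\<close>

lemma succ_cardinalI:
  assumes inf: "infinite (UNIV :: 'a set)"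
    and kappa: "(wo_rel_of :: ('k::wellorder) rel, cardSuc (card_of (UNIV :: 'a set))) \<in> ordIso"
  shows "succ_cardinal TYPE('k) TYPE('a)"
proof
  show "infinite (UNIV :: 'a set)" by (rule inf)
  show seg: "small TYPE('a) {..<\<alpha>}" for \<alpha> :: 'k by (rule wo_rel_of_facts(1)[OF kappa])
  fix S :: "'k set" assume S: "small TYPE('a) S"
  show "\<exists>\<alpha>. \<forall>x\<in>S. x < \<alpha>"
  proof (rule ccontr)
    assume "\<not> (\<exists>\<alpha>. \<forall>x\<in>S. x < \<alpha>)"
    then have "UNIV = (\<Union>x\<in>S. {..<x} \<union> {x})" by (auto simp: not_less order_le_less)
    moreover have "small TYPE('a) (\<Union>x\<in>S. {..<x} \<union> {x})"
      by (intro small_UN[OF inf S] small_Un[OF inf seg small_finite[OF inf]]) simp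
    ultimately show False using wo_rel_of_facts(2)[OF kappa] by simp
  qed
qed

text \<open>Diamond guesses every bounded subset of the successor cardinal exactly, so there are only
  as many of them, and hence only as many nodes, as ordinals.\<close>

lemma small_nodes:
  assumes sc: "succ_cardinal TYPE('k::wellorder) TYPE('a)" and H: "small TYPE('k) (UNIV :: 'h set)"
    and diamond: "\<And>X :: 'k set. stationary {\<alpha>. X \<inter> {..<\<alpha>} = Ds \<alpha>}"
  shows "small TYPE('k) (nodes :: ('k \<rightharpoonup> 'h) set)"
proof -
  interpret succ_cardinal "TYPE('a)" "TYPE('k)" by (rule sc)
  have infk: "infinite (UNIV :: 'k set)" using not_small_UNIV small_finite[OF inf] by blast
  have "small TYPE('k) (UNIV \<times> UNIV :: ('k \<times> 'h) set)"
    by (rule small_Sigma[OF infk small_UNIV H])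
  then obtain p :: "'k \<times> 'h \<Rightarrow> 'k" where p: "inj p" unfolding small_def by auto
  define G where "G x = p ` {(\<xi>, v). x \<xi> = Some v}" for x :: "'k \<rightharpoonup> 'h"
  have "\<exists>\<alpha>. Ds \<alpha> = G x" if "x \<in> nodes" for x
  proof -
    from that obtain \<alpha> where \<alpha>: "dom x = {..<\<alpha>}" unfolding nodes_def by blast
    have "G x = (\<lambda>\<xi>. p (\<xi>, the (x \<xi>))) ` dom x" unfolding G_def by force
    then have "small TYPE('a) (G x)" unfolding \<alpha> by (simp add: small_image seg)
    then obtain \<beta> where \<beta>: "\<forall>\<xi>\<in>G x. \<xi> < \<beta>" using bdd by blast
    \<comment> \<open>Only the unboundedness of the stationary set matters, so the closure condition
      is instantiated with arbitrary constants.\<close>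
    obtain \<gamma> where "\<beta> \<le> \<gamma>" "G x \<inter> {..<\<gamma>} = Ds \<gamma>"
      using stationary_Int_club_cofinal[OF diamond[of "G x"], of undefined "\<lambda>\<beta>. undefined"] unfolding cofinal_def by blast
    moreover have "G x \<inter> {..<\<gamma>} = G x" using \<beta> \<open>\<beta> \<le> \<gamma>\<close> by auto
    ultimately show ?thesis by blast
  qed
  then have "\<forall>x\<in>nodes. \<exists>\<alpha>. Ds \<alpha> = G x" by blast
  then have "\<exists>c. \<forall>x\<in>nodes. Ds (c x) = G x" by (rule bchoice)
  then obtain c where c: "\<And>x. x \<in> nodes \<Longrightarrow> Ds (c x) = G x" by blast
  have "inj_on c nodes"
  proof (rule inj_onI)
    fix x y :: "'k \<rightharpoonup> 'h" assume "x \<in> nodes" "y \<in> nodes" "c x = c y"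
    then have "G x = G y" using c by metis
    then have eq: "{(\<xi>, v). x \<xi> = Some v} = {(\<xi>, v). y \<xi> = Some v}"
      unfolding G_def using p by (simp add: inj_image_eq_iff)
    show "x = y"
    proof (rule ext)
      fix \<xi>
      have "x \<xi> = Some v \<longleftrightarrow> y \<xi> = Some v" for v using eq by blast
      then show "x \<xi> = y \<xi>" by (metis not_None_eq)
    qed
  qed
  then show ?thesis unfolding small_def by blast
qed

theorem theoremB:
  fixes n :: nat
  assumes lam_inf: "infinite (UNIV :: 'a set)"
    and kappa: "(wo_rel_of :: ('k::wellorder) rel, cardSuc (card_of (UNIV :: 'a set))) \<in> ordIso"
    and H: "(card_of (UNIV :: 'h set), card_of (UNIV :: 'k set)) \<in> ordIso"
    and P: "P_principle TYPE('a) TYPE('k)"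
    and n: "1 \<le> n"
  shows "\<exists>T :: ('k \<rightharpoonup> 'h) set. souslin T \<and>
           (\<forall>s. derived_seq n T s \<longrightarrow> souslin (derived_tree n T s)) \<and>
           (\<forall>s. derived_seq (n + 1) T s \<longrightarrow> special TYPE('a) (derived_tree (n + 1) T s))"
proof -
  interpret succ_cardinal "TYPE('a)" "TYPE('k)" by (rule succ_cardinalI[OF lam_inf kappa])
  obtain Ds :: "'k \<Rightarrow> 'k set" where Ds: "\<And>X. stationary {\<alpha>. X \<inter> {..<\<alpha>} = Ds \<alpha>}"
    using P unfolding P_principle_def diamond_def by blast
  obtain Cs :: "'k \<Rightarrow> 'k set" where
    Cs: "\<And>\<alpha>. closed_below (Cs \<alpha>) \<alpha>" "\<And>\<alpha>. same_sup (Cs \<alpha>) {..<\<alpha>}"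
      "\<And>\<alpha>. (Restr wo_rel_of (Cs \<alpha>), card_of (UNIV :: 'a set)) \<in> ordLeq"
      "\<And>\<alpha> \<alpha>'. \<alpha>' \<in> acc (Cs \<alpha>) \<Longrightarrow> Cs \<alpha>' = Cs \<alpha> \<inter> {..<\<alpha>'}"
      "\<And>B. (\<And>i. cofinal (B i)) \<Longrightarrow>
        stationary {\<alpha>. \<forall>i<\<alpha>. \<forall>k::nat. sup_is {\<beta>\<in>Cs \<alpha>. suc_n k (Cs \<alpha> - {..<\<beta>}) \<subseteq> B i} \<alpha>}"
    using P unfolding P_principle_def by blast
  \<comment> \<open>The value type stands for \<open>H_kappa\<close>, which has size kappa because
    diamond gives 2^lambda = lambda^+. The bijection writes ordinals as values, and its inverse
    bounds the number of values when nodes are counted.\<close>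
  obtain h :: "'k \<Rightarrow> 'h" where h: "bij h"
    using ordIso_symmetric[OF H] unfolding card_of_ordIso[symmetric] by blast
  have infk: "infinite (UNIV :: 'k set)" using not_small_UNIV small_finite[OF inf] by blast
  have "inj (inv h)" using h by (simp add: bij_imp_bij_inv bij_is_inj)
  then have H': "small TYPE('k) (UNIV :: 'h set)" unfolding small_def by blast
  have "small TYPE('k) (lists nodes \<times> lists nodes :: (('k \<rightharpoonup> 'h) list \<times> ('k \<rightharpoonup> 'h) list) set)"
    by (intro small_Sigma[OF infk] small_lists[OF infk] small_nodes[OF succ_cardinal_axioms H' Ds])
  then obtain code :: "('k \<rightharpoonup> 'h) list \<times> ('k \<rightharpoonup> 'h) list \<Rightarrow> 'k" where
    code: "inj_on code (lists nodes \<times> lists nodes)" unfolding small_def by blast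
  interpret guessing_construction "TYPE('a)" "TYPE('k)" h n Cs code Ds
    by unfold_locales (use h Cs code Ds in \<open>auto simp: bij_is_inj\<close>)
  show ?thesis
    using souslin_tree[OF n] souslin_derived[of n] special_derived[OF Cs(3)] n by auto
qed

end
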